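(* For each positive integer $n$ there is a constant $R_n$, depending only on $n$, such that the following holds. If $N > n$, $\Sigma^n \subset \mathbf{R}^N$ is a properly embedded shrinker, $R \geq R_n$, $B_R \cap \Sigma \neq \emptyset$ and $B_R \cap \partial \Sigma = \emptyset$, then $\Sigma$ is Gaussian unstable.
   Context: $B_r$ denotes the open Euclidean ball of radius $r$ centered at the origin. A shrinker is a (smooth) $n$-dimensional submanifold $\Sigma^n \subset \mathbf{R}^{N}$, possibly with boundary, satisfying the shrinker equation $\mathbf{H} = \frac{1}{2} x^{\perp}$, where $x$ is the position vector, $\perp$ denotes the component normal to $\Sigma$, and $\mathbf{H}$ is the mean curvature vector with the sign convention $\mathbf{H} = -\sum_i A(f_i,f_i)$ ($A$ the vector-valued second fundamental form $A(X,Y) = (D_X Y)^\perp$, $D$ the Euclidean derivative, $f_i$ an orthonormal tangent frame). Equivalently, $\Sigma$ is a critical point of the Gaussian area $F(\Sigma) = (4\pi)^{-n/2}\int_\Sigma e^{-|x|^2/4}$. The second variation operator $L$ of Gaussian area acts on normal vector fields $v$ by $$L v = \mathcal{L} v + \sum_{i,j}\langle A_{ij}, v\rangle A_{ij} + \tfrac12 v, \qquad \mathcal{L} v = \Delta^\perp v - \tfrac12 \nabla^\perp_{x^T} v,$$ where $A_{ij} = A(f_i,f_j)$, $x^T$ is the tangential part of $x$, and $\nabla^\perp$, $\Delta^\perp$ are the normal connection and its Laplacian. $\Sigma$ is Gaussian stable if $\int_\Sigma \langle \eta, L\eta\rangle e^{-|x|^2/4} \leq 0$ for every (smooth) normal vector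 field $\eta$ with compact support in the interior $\Sigma \setminus \partial\Sigma$; it is Gaussian unstable if it is not Gaussian stable. *)

theory Defs
  imports "HOL-Analysis.Analysis"
begin

section \<open>Euclidean spaces of all dimensions inside one inner product space\<close>

text \<open>
  The constant in the theorem must not depend on the ambient dimension N, so N has to be a
  number and not a type.  All the spaces \<open>\<real>\<^sup>N\<close> are therefore realised as coordinate subspaces
  \<open>euc N\<close> of the space of finitely supported real sequences with its usual inner product.
\<close>

typedef fseq = "{f :: nat \<Rightarrow> real. finite {i. f i \<noteq> 0}}"
  morphisms coord Abs_fseq
  by (rule exI[of _ "\<lambda>_. 0"]) simp

setup_lifting type_definition_fseq

lemma fseq_eqI: "(\<And>i. coord x i = coord y i) \<Longrightarrow> x = y"
  by (metis coord_inject ext)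

lemma finite_coord: "finite {i. coord x i \<noteq> 0}"
  using coord[of x] by simp

instantiation fseq :: real_vector
begin

lift_definition zero_fseq :: fseq is "\<lambda>_. 0" by simp

lift_definition plus_fseq :: "fseq \<Rightarrow> fseq \<Rightarrow> fseq" is "\<lambda>f g i. f i + g i"
  subgoal for f g by (rule finite_subset[of _ "{i. f i \<noteq> 0} \<union> {i. g i \<noteq> 0}"]) auto
  done

lift_definition minus_fseq :: "fseq \<Rightarrow> fseq \<Rightarrow> fseq" is "\<lambda>f g i. f i - g i"
  subgoal for f g by (rule finite_subset[of _ "{i. f i \<noteq> 0} \<union> {i. g i \<noteq> 0}"]) auto
  done

lift_definition uminus_fseq :: "fseq \<Rightarrow> fseq" is "\<lambda>f i. - f i" by simp

lift_definition scaleR_fseq :: "real \<Rightarrow> fseq \<Rightarrow> fseq" is "\<lambda>r f i. r * f i"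
  by (rule rev_finite_subset) auto

instance
  by standard (transfer, force simp: algebra_simps)+

end

lemmas coord_simps [simp] =
  zero_fseq.rep_eq plus_fseq.rep_eq minus_fseq.rep_eq uminus_fseq.rep_eq scaleR_fseq.rep_eq

instantiation fseq :: real_inner
begin

definition inner_fseq :: "fseq \<Rightarrow> fseq \<Rightarrow> real"
  where "inner_fseq x y = (\<Sum>i | coord x i \<noteq> 0. coord x i * coord y i)"

definition norm_fseq :: "fseq \<Rightarrow> real"
  where "norm_fseq x = sqrt (inner x x)"

definition sgn_fseq :: "fseq \<Rightarrow> fseq"
  where "sgn_fseq x = x /\<^sub>R norm x"

definition dist_fseq :: "fseq \<Rightarrow> fseq \<Rightarrow> real"
  where "dist_fseq x y = norm (x - y)"

definition uniformity_fseq :: "(fseq \<times> fseq) filter"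
  where "uniformity_fseq = (INF e\<in>{0<..}. principal {(x, y). dist x y < e})"

definition open_fseq :: "fseq set \<Rightarrow> bool"
  where "open_fseq U = (\<forall>x\<in>U. eventually (\<lambda>(x', y). x' = x \<longrightarrow> y \<in> U) uniformity)"

lemma inner_fseq_superset:
  fixes x y :: fseq
  assumes "finite S" "{i. coord x i \<noteq> 0} \<subseteq> S"
  shows "inner x y = (\<Sum>i\<in>S. coord x i * coord y i)"
  unfolding inner_fseq_def using assms by (intro sum.mono_neutral_left) auto

instance
proof
  fix x y z :: fseq and r :: real
  let ?S = "{i. coord x i \<noteq> 0} \<union> {i. coord y i \<noteq> 0}"
  have fin: "finite ?S" by (simp add: finite_coord)
  show "inner x y = inner y x"
    by (subst (1 2) inner_fseq_superset[OF fin]) (auto simp: mult.commute)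
  have "inner (x + y) z = (\<Sum>i\<in>?S. coord (x + y) i * coord z i)"
    by (rule inner_fseq_superset[OF fin]) auto
  also have "\<dots> = (\<Sum>i\<in>?S. coord x i * coord z i) + (\<Sum>i\<in>?S. coord y i * coord z i)"
    by (simp add: distrib_right sum.distrib)
  also have "\<dots> = inner x z + inner y z"
    by (subst (1 2) inner_fseq_superset[OF fin]) auto
  finally show "inner (x + y) z = inner x z + inner y z" .
  have "inner (r *\<^sub>R x) y = (\<Sum>i | coord x i \<noteq> 0. coord (r *\<^sub>R x) i * coord y i)"
    by (rule inner_fseq_superset) (auto simp: finite_coord)
  then show "inner (r *\<^sub>R x) y = r * inner x y"
    by (simp add: inner_fseq_def sum_distrib_left mult.assoc)
  show "0 \<le> inner x x"
    by (simp add: inner_fseq_def sum_nonneg)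
  show "inner x x = 0 \<longleftrightarrow> x = 0"
  proof
    assume "inner x x = 0"
    then have "\<forall>i\<in>{i. coord x i \<noteq> 0}. coord x i * coord x i = 0"
      unfolding inner_fseq_def by (subst (asm) sum_nonneg_eq_0_iff) (auto simp: finite_coord)
    then show "x = 0" by (intro fseq_eqI) auto
  qed (simp add: inner_fseq_def)
qed (simp_all add: norm_fseq_def sgn_fseq_def dist_fseq_def uniformity_fseq_def open_fseq_def)

end

definition euc :: "nat \<Rightarrow> fseq set"
  where "euc N = {x. \<forall>i\<ge>N. coord x i = 0}"

text \<open>The closed half-space of \<open>euc n\<close> is used only for \<open>n \<ge> 1\<close>.\<close>

definition half_euc :: "nat \<Rightarrow> fseq set"
  where "half_euc n = {x \<in> euc n. 0 \<le> coord x 0}"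


section \<open>Smooth maps on open subsets of a linear subspace\<close>

text \<open>
  \<open>E\<close> is the linear subspace in which \<open>U\<close> is relatively open.  The derivative of \<open>f\<close> within \<open>U\<close>
  is determined only in directions of \<open>E\<close>, so only these are differentiated further.
\<close>

primrec Ck_on ::
  "nat \<Rightarrow> 'a set \<Rightarrow> ('a::real_normed_vector \<Rightarrow> 'b::real_normed_vector) \<Rightarrow> 'a set \<Rightarrow> bool"
where
  "Ck_on 0 E f U \<longleftrightarrow> continuous_on U f"
| "Ck_on (Suc k) E f U \<longleftrightarrow>
     (\<forall>x\<in>U. f differentiable (at x within U)) \<and>
     (\<forall>v\<in>E. Ck_on k E (\<lambda>x. frechet_derivative f (at x within U) v) U)"

definition smooth_on ::
  "'a set \<Rightarrow> ('a::real_normed_vector \<Rightarrow> 'b::real_normed_vector) \<Rightarrow> 'a set \<Rightarrow> bool"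
where
  "smooth_on E f U \<longleftrightarrow> openin (top_of_set E) U \<and> (\<forall>k. Ck_on k E f U)"

definition diffeomorphism ::
  "'a set \<Rightarrow> ('a::real_normed_vector \<Rightarrow> 'a) \<Rightarrow> 'a set \<Rightarrow> 'a set \<Rightarrow> bool"
where
  "diffeomorphism E \<Phi> U V \<longleftrightarrow>
     smooth_on E \<Phi> U \<and> \<Phi> ` U = V \<and>
     (\<exists>\<Psi>. smooth_on E \<Psi> V \<and> (\<forall>x\<in>U. \<Psi> (\<Phi> x) = x))"

text \<open>Smoothness of a map defined on an arbitrary subset \<open>S\<close> of \<open>E\<close>: local smooth extendability.\<close>

definition smooth_along ::
  "'a set \<Rightarrow> ('a::real_normed_vector \<Rightarrow> 'b::real_normed_vector) \<Rightarrow> 'a set \<Rightarrow> bool"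
where
  "smooth_along E f S \<longleftrightarrow>
     (\<forall>p\<in>S. \<exists>U g. p \<in> U \<and> smooth_on E g U \<and> (\<forall>q\<in>U \<inter> S. f q = g q))"


section \<open>Embedded submanifolds with boundary\<close>

text \<open>
  A chart \<open>\<Phi>\<close> around an interior point \<open>p\<close> can be translated and shrunk so that its image does
  not meet \<open>{y. coord y 0 = 0}\<close>; the same kind of chart thus serves interior and boundary points,
  and \<open>p\<close> is a boundary point iff \<open>coord (\<Phi> p) 0 = 0\<close>.
\<close>

definition slice_chart :: "nat \<Rightarrow> nat \<Rightarrow> fseq set \<Rightarrow> fseq set \<Rightarrow> (fseq \<Rightarrow> fseq) \<Rightarrow> bool" where
  "slice_chart N n \<Sigma> U \<Phi> \<longleftrightarrow>
     (\<exists>V. diffeomorphism (euc N) \<Phi> U V \<and> \<Phi> ` (U \<inter> \<Sigma>) = V \<inter> half_euc n)"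

definition embedded_submanifold :: "nat \<Rightarrow> nat \<Rightarrow> fseq set \<Rightarrow> bool" where
  "embedded_submanifold N n \<Sigma> \<longleftrightarrow>
     n \<le> N \<and> \<Sigma> \<subseteq> euc N \<and> (\<forall>p\<in>\<Sigma>. \<exists>U \<Phi>. p \<in> U \<and> slice_chart N n \<Sigma> U \<Phi>)"

definition mfd_boundary :: "nat \<Rightarrow> nat \<Rightarrow> fseq set \<Rightarrow> fseq set" where
  "mfd_boundary N n \<Sigma> = {p \<in> \<Sigma>. \<exists>U \<Phi>. p \<in> U \<and> slice_chart N n \<Sigma> U \<Phi> \<and> coord (\<Phi> p) 0 = 0}"

text \<open>Properly embedded: the inclusion into \<open>euc N\<close> is a proper map.\<close>

definition properly_embedded :: "nat \<Rightarrow> nat \<Rightarrow> fseq set \<Rightarrow> bool" where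
  "properly_embedded N n \<Sigma> \<longleftrightarrow>
     embedded_submanifold N n \<Sigma> \<and> (\<forall>K. K \<subseteq> euc N \<and> compact K \<longrightarrow> compact (K \<inter> \<Sigma>))"


section \<open>Extrinsic geometry\<close>

text \<open>
  Velocities of curves that start at \<open>p\<close> and stay in \<open>\<Sigma>\<close> for a short time fill the tangent space
  at an interior point and a closed half of it at a boundary point; hence the span.
\<close>

definition tangent_space :: "'a::real_inner set \<Rightarrow> 'a \<Rightarrow> 'a set" where
  "tangent_space \<Sigma> p = span {v. \<exists>\<gamma> :: real \<Rightarrow> 'a. \<gamma> 0 = p \<and>
     (\<forall>\<^sub>F t in at_right 0. \<gamma> t \<in> \<Sigma>) \<and> (\<gamma> has_vector_derivative v) (at_right 0)}"

definition tan_part :: "'a::real_inner set \<Rightarrow> 'a \<Rightarrow> 'a \<Rightarrow> 'a" where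
  "tan_part \<Sigma> p x =
     (THE y. y \<in> tangent_space \<Sigma> p \<and> (\<forall>w\<in>tangent_space \<Sigma> p. inner (x - y) w = 0))"

definition nor_part :: "'a::real_inner set \<Rightarrow> 'a \<Rightarrow> 'a \<Rightarrow> 'a" where
  "nor_part \<Sigma> p x = x - tan_part \<Sigma> p x"

definition orthonormal_basis :: "'a::real_inner set \<Rightarrow> 'a set \<Rightarrow> bool" where
  "orthonormal_basis S B \<longleftrightarrow>
     finite B \<and> span B = S \<and> pairwise orthogonal B \<and> (\<forall>b\<in>B. norm b = 1)"

definition tangent_basis :: "'a::real_inner set \<Rightarrow> 'a \<Rightarrow> 'a set" where
  "tangent_basis \<Sigma> p = (SOME B. orthonormal_basis (tangent_space \<Sigma> p) B)"

text \<open>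
  Euclidean derivative of \<open>Y\<close> along a tangent field \<open>X\<close>.  The derivative within \<open>\<Sigma>\<close> uses only the
  values of \<open>Y\<close> on \<open>\<Sigma>\<close> and is uniquely determined on the tangent space.
\<close>

definition euclidean_deriv ::
  "'a::real_inner set \<Rightarrow> ('a \<Rightarrow> 'a) \<Rightarrow> ('a \<Rightarrow> 'a) \<Rightarrow> 'a \<Rightarrow> 'a"
where
  "euclidean_deriv \<Sigma> X Y p = frechet_derivative Y (at p within \<Sigma>) (X p)"

definition tangential_conn ::
  "'a::real_inner set \<Rightarrow> ('a \<Rightarrow> 'a) \<Rightarrow> ('a \<Rightarrow> 'a) \<Rightarrow> 'a \<Rightarrow> 'a"
where
  "tangential_conn \<Sigma> X Y p = tan_part \<Sigma> p (euclidean_deriv \<Sigma> X Y p)"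

definition second_ff ::
  "'a::real_inner set \<Rightarrow> ('a \<Rightarrow> 'a) \<Rightarrow> ('a \<Rightarrow> 'a) \<Rightarrow> 'a \<Rightarrow> 'a"
where
  "second_ff \<Sigma> X Y p = nor_part \<Sigma> p (euclidean_deriv \<Sigma> X Y p)"

definition normal_conn ::
  "'a::real_inner set \<Rightarrow> ('a \<Rightarrow> 'a) \<Rightarrow> ('a \<Rightarrow> 'a) \<Rightarrow> 'a \<Rightarrow> 'a"
where
  "normal_conn \<Sigma> X v p = nor_part \<Sigma> p (euclidean_deriv \<Sigma> X v p)"

text \<open>
  The smooth tangent field \<open>q \<mapsto> e\<^sup>T(q)\<close> through a tangent vector \<open>e\<close> at \<open>p\<close>.  Applied to an
  orthonormal basis at \<open>p\<close> it yields a tangent frame near \<open>p\<close> that is orthonormal at \<open>p\<close>.  This is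
  all that is needed below: the second fundamental form and the second covariant derivative
  \<open>\<nabla>\<^sub>X\<nabla>\<^sub>Y v - \<nabla>\<^bsub>\<nabla>\<^sub>X Y\<^esub> v\<close> at \<open>p\<close> depend only on the values of \<open>X\<close> and \<open>Y\<close> at \<open>p\<close>.
\<close>

definition tan_field :: "'a::real_inner set \<Rightarrow> 'a \<Rightarrow> 'a \<Rightarrow> 'a" where
  "tan_field \<Sigma> e = (\<lambda>q. tan_part \<Sigma> q e)"

definition second_ff_at :: "'a::real_inner set \<Rightarrow> 'a \<Rightarrow> 'a \<Rightarrow> 'a \<Rightarrow> 'a" where
  "second_ff_at \<Sigma> p e e' = second_ff \<Sigma> (tan_field \<Sigma> e) (tan_field \<Sigma> e') p"

definition mean_curvature :: "'a::real_inner set \<Rightarrow> 'a \<Rightarrow> 'a" where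
  "mean_curvature \<Sigma> p = - (\<Sum>e\<in>tangent_basis \<Sigma> p. second_ff_at \<Sigma> p e e)"

definition normal_laplacian :: "'a::real_inner set \<Rightarrow> ('a \<Rightarrow> 'a) \<Rightarrow> 'a \<Rightarrow> 'a" where
  "normal_laplacian \<Sigma> v p =
     (\<Sum>e\<in>tangent_basis \<Sigma> p.
        let F = tan_field \<Sigma> e in
          normal_conn \<Sigma> F (normal_conn \<Sigma> F v) p - normal_conn \<Sigma> (tangential_conn \<Sigma> F F) v p)"

definition drift_laplacian :: "'a::real_inner set \<Rightarrow> ('a \<Rightarrow> 'a) \<Rightarrow> 'a \<Rightarrow> 'a" where
  "drift_laplacian \<Sigma> v p =
     normal_laplacian \<Sigma> v p - (1/2) *\<^sub>R normal_conn \<Sigma> (\<lambda>q. tan_part \<Sigma> q q) v p"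

definition L_op :: "'a::real_inner set \<Rightarrow> ('a \<Rightarrow> 'a) \<Rightarrow> 'a \<Rightarrow> 'a" where
  "L_op \<Sigma> v p =
     drift_laplacian \<Sigma> v p
     + (\<Sum>e\<in>tangent_basis \<Sigma> p. \<Sum>e'\<in>tangent_basis \<Sigma> p.
          inner (second_ff_at \<Sigma> p e e') (v p) *\<^sub>R second_ff_at \<Sigma> p e e')
     + (1/2) *\<^sub>R v p"


section \<open>Area\<close>

text \<open>
  The n-dimensional area is the n-dimensional Hausdorff measure, normalised to agree with Lebesgue
  measure on \<open>\<real>\<^sup>n\<close>.  The outer measure below is a metric outer measure, so its
  restriction to the Borel sets is a measure and \<open>measure_of\<close> returns it.
\<close>

definition hausdorff_pre :: "nat \<Rightarrow> real \<Rightarrow> 'a::metric_space set \<Rightarrow> ennreal" where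
  "hausdorff_pre n \<delta> A =
     (INF C \<in> {C :: nat \<Rightarrow> 'a set. A \<subseteq> (\<Union>i. C i) \<and> (\<forall>i. bounded (C i) \<and> diameter (C i) \<le> \<delta>)}.
        \<Sum>i. if C i = {} then 0
             else ennreal (unit_ball_vol (real n) * (diameter (C i) / 2) ^ n))"

definition hausdorff_outer :: "nat \<Rightarrow> 'a::metric_space set \<Rightarrow> ennreal" where
  "hausdorff_outer n A = (SUP \<delta>\<in>{0<..}. hausdorff_pre n \<delta> A)"

definition hausdorff_measure :: "nat \<Rightarrow> 'a::metric_space measure" where
  "hausdorff_measure n = measure_of UNIV (sets borel) (hausdorff_outer n)"


section \<open>Shrinkers and Gaussian stability\<close>

definition shrinker :: "nat \<Rightarrow> nat \<Rightarrow> fseq set \<Rightarrow> bool" where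
  "shrinker N n \<Sigma> \<longleftrightarrow>
     embedded_submanifold N n \<Sigma> \<and> (\<forall>x\<in>\<Sigma>. mean_curvature \<Sigma> x = (1/2) *\<^sub>R nor_part \<Sigma> x x)"

definition normal_field :: "nat \<Rightarrow> fseq set \<Rightarrow> (fseq \<Rightarrow> fseq) \<Rightarrow> bool" where
  "normal_field N \<Sigma> \<eta> \<longleftrightarrow>
     smooth_along (euc N) \<eta> \<Sigma> \<and>
     (\<forall>p\<in>\<Sigma>. \<eta> p \<in> euc N \<and> (\<forall>w\<in>tangent_space \<Sigma> p. inner (\<eta> p) w = 0))"

definition compactly_supported_in :: "fseq set \<Rightarrow> (fseq \<Rightarrow> fseq) \<Rightarrow> fseq set \<Rightarrow> bool" where
  "compactly_supported_in \<Sigma> \<eta> S \<longleftrightarrow>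
     compact (closure {p \<in> \<Sigma>. \<eta> p \<noteq> 0}) \<and> closure {p \<in> \<Sigma>. \<eta> p \<noteq> 0} \<subseteq> S"

definition gaussian_stable :: "nat \<Rightarrow> nat \<Rightarrow> fseq set \<Rightarrow> bool" where
  "gaussian_stable N n \<Sigma> \<longleftrightarrow>
     (\<forall>\<eta>. normal_field N \<Sigma> \<eta> \<and> compactly_supported_in \<Sigma> \<eta> (\<Sigma> - mfd_boundary N n \<Sigma>) \<longrightarrow>
        (LINT p:\<Sigma>|hausdorff_measure n. inner (\<eta> p) (L_op \<Sigma> \<eta> p) * exp (- (norm p)\<^sup>2 / 4)) \<le> 0)"

abbreviation gaussian_unstable :: "nat \<Rightarrow> nat \<Rightarrow> fseq set \<Rightarrow> bool" where
  "gaussian_unstable N n \<Sigma> \<equiv> \<not> gaussian_stable N n \<Sigma>"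

end

theory Submission
  imports Defs
begin

text \<open>
  For a constant vector \<open>e\<close>, the normal part \<open>e\<^sup>\<bottom>\<close> satisfies \<open>L e\<^sup>\<bottom> = e\<^sup>\<bottom> / 2\<close> on a shrinker.  For a
  function \<open>\<phi>\<close> this gives
  \<open>L (\<phi> e\<^sup>\<bottom>) = (\<L> \<phi> + \<phi> / 2) e\<^sup>\<bottom> + 2 \<nabla>\<^sup>\<bottom>\<^bsub>\<nabla>\<phi>\<^esub> e\<^sup>\<bottom>\<close>.  Summed over an orthonormal basis of the ambient space
  the cross terms \<open>\<langle>\<nabla>\<^sup>\<bottom> e\<^sup>\<bottom>, e\<^sup>\<bottom>\<rangle>\<close> cancel, because \<open>\<Sum> |e\<^sup>\<bottom>|\<^sup>2 = N - n\<close> is constant, so that pointwise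
  \<open>\<Sum> \<langle>\<phi> e\<^sup>\<bottom>, L (\<phi> e\<^sup>\<bottom>)\<rangle> = (N - n) \<phi> (\<L> \<phi> + \<phi> / 2)\<close>, without any integration by parts.
  For \<open>\<phi> = g (|x|\<^sup>2)\<close> one has \<open>\<L> \<phi> = 4 g'' |x\<^sup>T|\<^sup>2 + g' (2 n - |x|\<^sup>2)\<close>.  With \<open>c \<ge> 16 n\<close> and
  \<open>g s = exp (- 2 c / (c - s))\<close> for \<open>s < c\<close>, extended by zero, \<open>g\<close> is smooth, convex and decreasing with
  \<open>|g'| \<le> g / (4 n)\<close> on \<open>[0, 2 n]\<close>, which makes the sum positive wherever \<open>\<phi> \<noteq> 0\<close>; so one of the fields
  \<open>\<phi> e\<^sup>\<bottom>\<close> destabilises.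

  Near an interior point, the tangential projection of \<open>\<Sigma>\<close> is extended to the projections \<open>P\<close> onto the
  tangent spaces of the leaves of a slice chart.  The second fundamental form of the leaves is
  \<open>(DP X) Y\<close> on tangent vectors; its symmetry and the Codazzi equation follow from the symmetry of
  second derivatives in the ambient space.
\<close>

subsection \<open>Orthonormal bases and coordinates\<close>

text \<open>The sum over a basis is forced by the cross term, which has no sign for a single
  \<open>e\<close>. Convexity of \<open>g\<close> is imposed because nothing is known about |x^T|^2
  beyond its sign, so its coefficient 4 g'' must be nonnegative. For exp (- a / (c - s)) this holds
  on all of [0, c) exactly if a >= 2 c; hence the factor 2 in the exponent. The bound on g' amounts
  to (c - 2 n)^2 >= 8 c n, which c >= 16 n satisfies with room to spare, and 16 n is the square of 4
  sqrt n.

  The tangent bases in the operators are chosen pointwise, without any continuity. Traces are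
  therefore rewritten as sums over the fixed ambient basis, which makes the integrands continuous.

  On the measure side two facts enter: compact pieces away from the boundary have finite area, and
  nonempty relatively open pieces have positive area. The first is essential because the integral of
  a nonintegrable function is 0 by convention, so that stability would carry no information. Both
  facts only use that charts are locally Lipschitz in both directions; no area formula is
  involved.\<close>

lemma orthonormal_basis_inner:
  assumes "orthonormal_basis E B" "a \<in> B" "b \<in> B"
  shows "inner a b = (if a = b then 1 else 0)"
  using assms unfolding orthonormal_basis_def pairwise_def orthogonal_def
  by (metis norm_eq_1)

lemma orthonormal_basis_expand:
  assumes B: "orthonormal_basis E B" and y: "y \<in> E"
  shows "y = (\<Sum>b\<in>B. inner y b *\<^sub>R b)"
proof -
  have fin: "finite B" and "y \<in> span B" using B y by (auto simp: orthonormal_basis_def)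
  from this(2) show ?thesis
  proof (induction rule: span_induct_alt)
    case (step c x y)
    have "(\<Sum>b\<in>B. inner x b *\<^sub>R b) = (\<Sum>b\<in>B. if x = b then b else 0)"
      by (rule sum.cong) (auto simp: orthonormal_basis_inner[OF B step(1)])
    also have "\<dots> = x" using fin step(1) by simp
    moreover have "(\<Sum>b\<in>B. inner (c *\<^sub>R x + y) b *\<^sub>R b)
        = c *\<^sub>R (\<Sum>b\<in>B. inner x b *\<^sub>R b) + (\<Sum>b\<in>B. inner y b *\<^sub>R b)"
      by (simp add: inner_add_left scaleR_add_left sum.distrib scaleR_sum_right)
    ultimately show ?case using step by metis
  qed simp
qed

lemma orthonormal_basis_subspace: "orthonormal_basis E B \<Longrightarrow> subspace E"
  by (auto simp: orthonormal_basis_def subspace_span)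

lemma orthonormal_basis_mem: "orthonormal_basis E B \<Longrightarrow> b \<in> B \<Longrightarrow> b \<in> E"
  by (auto simp: orthonormal_basis_def span_base)

lemma orthonormal_basis_finite: "orthonormal_basis E B \<Longrightarrow> finite B"
  by (auto simp: orthonormal_basis_def)

lemma orthonormal_basis_parseval:
  assumes B: "orthonormal_basis E B" and "y \<in> E"
  shows "inner y z = (\<Sum>b\<in>B. inner y b * inner b z)"
  by (subst orthonormal_basis_expand[OF assms]) (simp add: inner_sum_left)

lemma orthonormal_basis_span_exists:
  fixes T :: "'a::real_inner set"
  assumes "finite T"
  shows "\<exists>B. orthonormal_basis (span T) B"
proof -
  obtain C where C: "finite C" "span C = span T" "pairwise orthogonal C"
    using basis_orthogonal[OF assms] by blast
  define B where "B = (\<lambda>c. c /\<^sub>R norm c) ` (C - {0})"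
  have "span B = span (C - {0})"
    unfolding B_def using C(1) by (intro span_image_scale) auto
  then have "span B = span T" using C by (simp add: span_delete_0)
  moreover have "pairwise orthogonal B"
    using C(3) unfolding B_def pairwise_def orthogonal_def by auto
  ultimately have "orthonormal_basis (span T) B"
    using C(1) unfolding orthonormal_basis_def B_def by auto
  then show ?thesis ..
qed

text \<open>\<open>E\<close> is the set of fixed points of its orthogonal projection, a finite and
  hence continuous sum; the ambient type may be infinite-dimensional.\<close>

lemma closed_orthonormal_basis:
  assumes B: "orthonormal_basis E B"
  shows "closed E"
proof -
  have "E = {y. y = (\<Sum>b\<in>B. inner y b *\<^sub>R b)}"
    using orthonormal_basis_expand[OF B] orthonormal_basis_subspace[OF B] orthonormal_basis_mem[OF B]
    by (auto, metis (no_types, lifting) subspace_scale subspace_sum)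
  moreover have "closed {y. y = (\<Sum>b\<in>B. inner y b *\<^sub>R b)}"
    by (intro closed_Collect_eq continuous_intros)
  ultimately show ?thesis by metis
qed

text \<open>Each further basis vector contributes a factor \<open>{-r..r}\<close>, and the new box
  is a continuous image of a product of compact sets.\<close>

lemma compact_coefficient_box:
  fixes B :: "'a::real_normed_vector set"
  assumes "finite B"
  shows "compact {(\<Sum>b\<in>B. c b *\<^sub>R b) | c. \<forall>b\<in>B. \<bar>c b\<bar> \<le> r}"
  using assms
proof (induction B)
  case (insert a B)
  let ?S = "\<lambda>B. {(\<Sum>b\<in>B. c b *\<^sub>R b) | c. \<forall>b\<in>B. \<bar>c b\<bar> \<le> r}"
  have "?S (insert a B) = (\<lambda>(t, x). t *\<^sub>R a + x) ` ({-r..r} \<times> ?S B)"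
  proof (intro equalityI subsetI)
    fix y assume "y \<in> ?S (insert a B)"
    then obtain c where c: "\<forall>b\<in>insert a B. \<bar>c b\<bar> \<le> r" "y = (\<Sum>b\<in>insert a B. c b *\<^sub>R b)" by blast
    then have "y = (\<lambda>(t, x). t *\<^sub>R a + x) (c a, \<Sum>b\<in>B. c b *\<^sub>R b)" using insert(1,2) by simp
    moreover have "(c a, \<Sum>b\<in>B. c b *\<^sub>R b) \<in> {-r..r} \<times> ?S B" using c(1) by (auto simp: abs_le_iff)
    ultimately show "y \<in> (\<lambda>(t, x). t *\<^sub>R a + x) ` ({-r..r} \<times> ?S B)" by blast
  next
    fix y assume "y \<in> (\<lambda>(t, x). t *\<^sub>R a + x) ` ({-r..r} \<times> ?S B)"
    then obtain t x where tx: "t \<in> {-r..r}" "x \<in> ?S B" "y = t *\<^sub>R a + x"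
      by (elim imageE SigmaE) simp
    from tx(2) obtain c where c: "\<forall>b\<in>B. \<bar>c b\<bar> \<le> r" "x = (\<Sum>b\<in>B. c b *\<^sub>R b)" by blast
    have tc: "\<bar>t\<bar> \<le> r" "\<forall>b\<in>B. \<bar>c b\<bar> \<le> r" "y = t *\<^sub>R a + (\<Sum>b\<in>B. c b *\<^sub>R b)"
      using tx c by auto
    have "(\<Sum>b\<in>B. (c(a := t)) b *\<^sub>R b) = (\<Sum>b\<in>B. c b *\<^sub>R b)"
      using insert(2) by (intro sum.cong) auto
    then have "y = (\<Sum>b\<in>insert a B. (c(a := t)) b *\<^sub>R b)"
      using insert(1,2) tc by simp
    moreover have "\<forall>b\<in>insert a B. \<bar>(c(a := t)) b\<bar> \<le> r" using tc by auto
    ultimately show "y \<in> ?S (insert a B)" by blast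
  qed
  moreover have "compact \<dots>"
    using insert(3) by (intro compact_continuous_image compact_Times)
      (auto simp: split_def intro!: continuous_intros)
  ultimately show ?case by simp
qed simp

text \<open>Heine-Borel for a finite-dimensional subspace: by Cauchy-Schwarz the coefficients of a
  bounded set are bounded, so the set is a closed part of a compact coefficient box.\<close>

lemma compact_orthonormal_basis:
  fixes K :: "'a::real_inner set"
  assumes B: "orthonormal_basis E B" and K: "closed K" "bounded K"
  shows "compact (K \<inter> E)"
proof -
  obtain r where r: "\<And>x. x \<in> K \<Longrightarrow> norm x \<le> r" using K(2) by (auto simp: bounded_iff)
  let ?S = "{(\<Sum>b\<in>B. c b *\<^sub>R b) | c. \<forall>b\<in>B. \<bar>c b\<bar> \<le> r}"
  have "K \<inter> E \<subseteq> ?S"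
  proof
    fix x assume x: "x \<in> K \<inter> E"
    have "\<bar>inner x b\<bar> \<le> r" if "b \<in> B" for b
      using Cauchy_Schwarz_ineq2[of x b] r[of x] x that B by (auto simp: orthonormal_basis_def)
    then show "x \<in> ?S" using orthonormal_basis_expand[OF B, of x] x by blast
  qed
  then have "K \<inter> E = ?S \<inter> (K \<inter> E)" by auto
  moreover have "compact (?S \<inter> (K \<inter> E))"
    using compact_coefficient_box[OF orthonormal_basis_finite[OF B]] K(1) closed_orthonormal_basis[OF B]
    by (intro compact_Int_closed closed_Int)
  ultimately show ?thesis by simp
qed

lift_definition bas :: "nat \<Rightarrow> fseq" is "\<lambda>i j. if j = i then 1 else 0"
  by simp

lemma coord_bas: "coord (bas i) j = (if j = i then 1 else 0)"
  by (simp add: bas.rep_eq)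

lemma inner_bas [simp]: "inner x (bas i) = coord x i"
proof -
  have "{j. coord (bas i) j \<noteq> 0} = {i}" by (auto simp: coord_bas)
  then have "inner (bas i) x = coord x i"
    by (simp add: inner_fseq_def coord_bas)
  then show ?thesis by (simp add: inner_commute)
qed

lemma inner_bas_left [simp]: "inner (bas i) x = coord x i"
  by (simp add: inner_commute[of "bas i"])

lemma norm_bas [simp]: "norm (bas i) = 1"
  by (simp add: norm_eq_sqrt_inner coord_bas)

lemma coord_sum: "coord (\<Sum>i\<in>I. f i) j = (\<Sum>i\<in>I. coord (f i) j)"
  by (simp add: inner_sum_left flip: inner_bas)

lemma subspace_euc: "subspace (euc N)"
  by (auto simp: euc_def subspace_def)

lemma bas_in_euc [simp]: "bas i \<in> euc N \<longleftrightarrow> i < N"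
  by (auto simp: euc_def coord_bas)

lemma euc_expand: "x \<in> euc N \<Longrightarrow> x = (\<Sum>i<N. coord x i *\<^sub>R bas i)"
  by (rule fseq_eqI) (auto simp: coord_sum coord_bas euc_def if_distrib[of "\<lambda>x. _ * x"] not_less cong: if_cong)

lemma orthonormal_basis_euc: "orthonormal_basis (euc N) (bas ` {..<N})"
proof -
  have "x \<in> span (bas ` {..<N})" if "x \<in> euc N" for x
    by (subst euc_expand[OF that]) (intro span_sum span_scale span_base, auto)
  moreover have "span (bas ` {..<N}) \<subseteq> euc N"
    by (intro span_minimal subspace_euc) auto
  ultimately show ?thesis
    by (auto simp: orthonormal_basis_def pairwise_def orthogonal_def coord_bas)
qed

text \<open>Makes the chain rule, stated for spaces with a finite orthonormal basis, applicable to
  functions of a real variable.\<close>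

lemma orthonormal_basis_real: "orthonormal_basis (UNIV :: real set) {1}"
  unfolding orthonormal_basis_def
  by (auto simp: span_singleton)

lemma closed_euc: "closed (euc N)"
  by (rule closed_orthonormal_basis[OF orthonormal_basis_euc])

subsection \<open>Derivatives along curves\<close>

lemma has_derivative_along_curve:
  fixes f :: "'a::real_normed_vector \<Rightarrow> 'b::real_normed_vector"
  assumes f: "(f has_derivative f') (at p within S)" and \<gamma>: "(\<gamma> has_vector_derivative v) (at_right 0)"
    and "\<gamma> 0 = p" "\<forall>\<^sub>F t in at_right 0. \<gamma> t \<in> S"
  shows "((\<lambda>t. f (\<gamma> t)) has_vector_derivative f' v) (at_right (0::real))"
proof -
  obtain e where e: "e > 0" "\<And>t. 0 < t \<Longrightarrow> t < e \<Longrightarrow> \<gamma> t \<in> S"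
    using assms(4) unfolding eventually_at_right[OF zero_less_one] by auto
  \<comment> \<open>On this interval the curve stays in \<open>S\<close> throughout, so its image
    lies where \<open>f\<close> is differentiated.\<close>
  have eq: "at_right 0 = at 0 within {0<..<e}"
    using e(1) by (intro at_within_nhd[of _ "{..<e}"]) auto
  have "((\<lambda>t. f (\<gamma> t)) has_derivative (\<lambda>t. f' (t *\<^sub>R v))) (at 0 within {0<..<e})"
  proof (rule has_derivative_in_compose[of \<gamma> "\<lambda>t. t *\<^sub>R v" 0 _ f f'])
    show "(\<gamma> has_derivative (\<lambda>t. t *\<^sub>R v)) (at 0 within {0<..<e})"
      using \<gamma> unfolding eq has_vector_derivative_def .
    show "(f has_derivative f') (at (\<gamma> 0) within \<gamma> ` {0<..<e})"
      unfolding assms(3) using e by (intro has_derivative_subset[OF f]) auto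
  qed
  moreover have "f' (t *\<^sub>R v) = t *\<^sub>R f' v" for t
    using linear_scale[OF has_derivative_linear[OF f]] .
  ultimately show ?thesis unfolding eq has_vector_derivative_def by simp
qed

text \<open>A derivative within an arbitrary set is not unique, but on velocities of curves in the
  set it is the one-sided derivative along the curve.\<close>

lemma has_derivative_unique_curve:
  fixes f :: "'a::real_normed_vector \<Rightarrow> 'b::real_normed_vector"
  assumes "(f has_derivative f1) (at p within S)" "(f has_derivative f2) (at p within S)"
    and "(\<gamma> has_vector_derivative v) (at_right (0::real))"
    and "\<gamma> 0 = p" "\<forall>\<^sub>F t in at_right 0. \<gamma> t \<in> S"
  shows "f1 v = f2 v"
  using has_derivative_along_curve[OF assms(1,3-5)] has_derivative_along_curve[OF assms(2-5)]
  by (intro vector_derivative_unique_within[of 0 "{0<..}" "\<lambda>t. f (\<gamma> t)"]) auto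

lemma line_has_vector_derivative:
  "((\<lambda>t. p + t *\<^sub>R v) has_vector_derivative v) (at t within T)"
  by (auto intro!: derivative_eq_intros)

lemma eventually_line_openin:
  fixes p :: "'a::real_normed_vector"
  assumes U: "openin (top_of_set E) U" and "subspace E" "p \<in> U" "v \<in> E"
  shows "\<forall>\<^sub>F t in nhds (0::real). p + t *\<^sub>R v \<in> U"
proof -
  obtain O' where O: "open O'" "U = E \<inter> O'" using U by (auto simp: openin_open)
  have "\<forall>\<^sub>F t in nhds (0::real). p + t *\<^sub>R v \<in> O'"
    using O assms(3) by (intro topological_tendstoD[where l = "p + 0 *\<^sub>R v"])
      (auto intro!: tendsto_eq_intros filterlim_ident)
  moreover have "p + t *\<^sub>R v \<in> E" for t
    using assms O by (auto intro: subspace_add subspace_scale)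
  ultimately show ?thesis using O by (auto elim: eventually_mono)
qed

lemma has_derivative_unique_openin:
  fixes f :: "'a::real_normed_vector \<Rightarrow> 'b::real_normed_vector"
  assumes f: "(f has_derivative f1) (at p within U)" "(f has_derivative f2) (at p within U)"
    and "openin (top_of_set E) U" "subspace E" "p \<in> U" "v \<in> E"
  shows "f1 v = f2 v"
proof (rule has_derivative_unique_curve[OF f line_has_vector_derivative])
  have "\<forall>\<^sub>F t in nhds (0::real). p + t *\<^sub>R v \<in> U"
    using assms by (intro eventually_line_openin)
  then show "\<forall>\<^sub>F t in at_right (0::real). p + t *\<^sub>R v \<in> U"
    by (auto simp: eventually_at_filter elim: eventually_mono)
qed simp

lemma at_within_openin:
  assumes "openin (top_of_set E) U" "p \<in> U"
  shows "at p within U = at p within E"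
proof -
  obtain O' where O: "open O'" "U = E \<inter> O'" using assms by (auto simp: openin_open)
  then show ?thesis using assms by (intro at_within_nhd[of _ O']) auto
qed

lemma frechet_derivative_cong:
  assumes "x \<in> U" "\<And>y. y \<in> U \<Longrightarrow> f y = g y"
  shows "frechet_derivative f (at x within U) = frechet_derivative g (at x within U)"
proof -
  have "(f has_derivative f') (at x within U) = (g has_derivative f') (at x within U)" for f'
    using assms has_derivative_transform[of x U f g f'] has_derivative_transform[of x U g f f'] by metis
  then show ?thesis unfolding frechet_derivative_def by simp
qed

subsection \<open>Calculus of smooth maps\<close>

text \<open>The derivative is taken within the fixed subspace \<open>E\<close> instead of the
  domain: on a relatively open domain both agree (\<open>at_within_openin\<close>), and shrinking
  the domain then changes nothing. It is determined only for \<open>v\<close> in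
  \<open>E\<close>.\<close>

abbreviation dderiv :: "'a set \<Rightarrow> ('a::real_normed_vector \<Rightarrow> 'b::real_normed_vector) \<Rightarrow> 'a \<Rightarrow> 'a \<Rightarrow> 'b" where
  "dderiv E f x v \<equiv> frechet_derivative f (at x within E) v"

lemma dderiv_eq:
  fixes f :: "'a::real_normed_vector \<Rightarrow> 'b::real_normed_vector"
  assumes "(f has_derivative f') (at p within U)"
    and "openin (top_of_set E) U" "subspace E" "p \<in> U" "v \<in> E"
  shows "dderiv E f p v = f' v"
proof -
  have "(f has_derivative dderiv U f p) (at p within U)"
    using assms(1) differentiableI frechet_derivative_works by blast
  from has_derivative_unique_openin[OF this assms] show ?thesis
    using at_within_openin[OF assms(2,4)] by simp
qed

lemma Ck_on_cong:
  assumes "\<And>x. x \<in> U \<Longrightarrow> f x = g x" "Ck_on k E f U"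
  shows "Ck_on k E g U"
  using assms
proof (induction k arbitrary: f g)
  case 0
  then show ?case by (metis Ck_on.simps(1) continuous_on_cong)
next
  case (Suc k)
  have "g differentiable (at x within U)" if "x \<in> U" for x
    using Suc.prems that has_derivative_transform[of x U g f] unfolding Ck_on.simps differentiable_def by metis
  moreover have "Ck_on k E (\<lambda>x. dderiv U g x v) U" if "v \<in> E" for v
  proof (rule Suc.IH)
    show "dderiv U f x v = dderiv U g x v" if "x \<in> U" for x
      using frechet_derivative_cong[OF that Suc.prems(1)] by simp
  qed (use Suc.prems(2) that in simp)
  ultimately show ?case by simp
qed

text \<open>Replaces the chosen \<open>frechet_derivative\<close> of the definition by any
  explicitly given derivative; both agree in the directions of \<open>E\<close>.\<close>

lemma Ck_on_SucI:
  assumes U: "openin (top_of_set E) U" "subspace E"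
    and f: "\<And>x. x \<in> U \<Longrightarrow> (f has_derivative f' x) (at x within U)"
    and "\<And>v. v \<in> E \<Longrightarrow> Ck_on k E (\<lambda>x. f' x v) U"
  shows "Ck_on (Suc k) E f U"
proof -
  have "Ck_on k E (\<lambda>x. dderiv U f x v) U" if "v \<in> E" for v
    using assms(4)[OF that]
    by (rule Ck_on_cong[rotated])
       (metis dderiv_eq[OF f U] that at_within_openin[OF U(1)])
  then show ?thesis using f by (auto simp: differentiable_def)
qed

lemma Ck_on_has_derivative:
  assumes "Ck_on (Suc k) E f U" "x \<in> U"
  shows "(f has_derivative dderiv U f x) (at x within U)"
  using assms by (auto simp flip: frechet_derivative_works)

lemma Ck_on_dderiv:
  "Ck_on (Suc k) E f U \<Longrightarrow> v \<in> E \<Longrightarrow> Ck_on k E (\<lambda>x. dderiv U f x v) U"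
  by simp

lemma Ck_on_pred: "Ck_on (Suc k) E f U \<Longrightarrow> Ck_on k E f U"
proof (induction k arbitrary: f)
  case 0
  then show ?case
    by (auto simp: continuous_on_eq_continuous_within intro: differentiable_imp_continuous_within)
qed auto

lemma Ck_on_subset:
  assumes "openin (top_of_set E) U" "openin (top_of_set E) V" "V \<subseteq> U" "Ck_on k E f U"
  shows "Ck_on k E f V"
  using assms(4)
proof (induction k arbitrary: f)
  case (Suc k)
  have eq: "at x within V = at x within U" if "x \<in> V" for x
    using at_within_openin[of E] assms(1-3) that by auto
  have "Ck_on k E (\<lambda>x. dderiv V f x v) V" if "v \<in> E" for v
  proof (rule Ck_on_cong)
    show "Ck_on k E (\<lambda>x. dderiv U f x v) V"
      using Suc.prems that by (intro Suc.IH) simp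
  qed (simp add: eq)
  moreover have "f differentiable at x within V" if "x \<in> V" for x
    using Suc.prems assms(3) that eq[OF that] by auto
  ultimately show ?case by simp
qed (use assms in \<open>auto intro: continuous_on_subset\<close>)

context
  fixes E :: "'a::real_normed_vector set" and U :: "'a set"
  assumes U: "openin (top_of_set E) U" "subspace E"
begin

lemma Ck_on_const: "Ck_on k E (\<lambda>x. c) U"
  by (induction k arbitrary: c)
     (auto intro!: Ck_on_SucI[OF U] derivative_eq_intros simp del: Ck_on.simps(2))

lemma Ck_on_linear_compose:
  assumes h: "bounded_linear h" and f: "Ck_on k E f U"
  shows "Ck_on k E (\<lambda>x. h (f x)) U"
  using f
proof (induction k arbitrary: f)
  case 0
  then show ?case using h by (simp add: bounded_linear.continuous_on)
next
  case (Suc k)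
  show ?case
    using Suc.IH[OF Ck_on_dderiv[OF Suc.prems]]
    by (intro Ck_on_SucI[OF U, where f' = "\<lambda>x v. h (dderiv U f x v)"])
       (auto intro: bounded_linear.has_derivative[OF h] Ck_on_has_derivative[OF Suc.prems])
qed

lemma Ck_on_add:
  assumes "Ck_on k E f U" "Ck_on k E g U"
  shows "Ck_on k E (\<lambda>x. f x + g x) U"
  using assms
proof (induction k arbitrary: f g)
  case 0
  then show ?case by (auto intro: continuous_on_add)
next
  case (Suc k)
  show ?case
    using Suc.IH[OF Ck_on_dderiv[OF Suc.prems(1)] Ck_on_dderiv[OF Suc.prems(2)]]
    by (intro Ck_on_SucI[OF U, where f' = "\<lambda>x v. dderiv U f x v
            + dderiv U g x v"])
       (auto intro: has_derivative_add Ck_on_has_derivative[OF Suc.prems(1)] Ck_on_has_derivative[OF Suc.prems(2)])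
qed

lemma Ck_on_sum:
  assumes "finite I" "\<And>i. i \<in> I \<Longrightarrow> Ck_on k E (f i) U"
  shows "Ck_on k E (\<lambda>x. \<Sum>i\<in>I. f i x) U"
  using assms by (induction I) (auto intro: Ck_on_const Ck_on_add)

lemma Ck_on_bilinear:
  assumes h: "bounded_bilinear h" and "Ck_on k E f U" "Ck_on k E g U"
  shows "Ck_on k E (\<lambda>x. h (f x) (g x)) U"
  using assms(2,3)
proof (induction k arbitrary: f g)
  case 0
  then show ?case using h by (simp add: bounded_bilinear.continuous_on)
next
  case (Suc k)
  show ?case
    using Suc.IH[OF Ck_on_dderiv[OF Suc.prems(1)] Ck_on_pred[OF Suc.prems(2)]]
      Suc.IH[OF Ck_on_pred[OF Suc.prems(1)] Ck_on_dderiv[OF Suc.prems(2)]]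
    by (intro Ck_on_SucI[OF U, where f' = "\<lambda>x v. h (f x) (dderiv U g x v)
            + h (dderiv U f x v) (g x)"])
       (auto intro!: bounded_bilinear.FDERIV[OF h] Ck_on_has_derivative[OF Suc.prems(1)]
          Ck_on_has_derivative[OF Suc.prems(2)] Ck_on_add)
qed

end

text \<open>The derivative is a limit of difference quotients, and these lie in the closed subspace
  \<open>F\<close>.\<close>

lemma has_vector_derivative_in_subspace:
  assumes \<gamma>: "(\<gamma> has_vector_derivative v) (at_right (0::real))"
    and F: "subspace F" "closed F" and "\<gamma> 0 \<in> F" and ev: "\<forall>\<^sub>F t in at_right 0. \<gamma> t \<in> F"
  shows "v \<in> F"
proof -
  have "((\<lambda>t. (1 / norm (t - 0)) *\<^sub>R (\<gamma> t - (\<gamma> 0 + (t - 0) *\<^sub>R v)) + v) \<longlongrightarrow> 0 + v) (at_right 0)"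
    using \<gamma> unfolding has_vector_derivative_def has_derivative_within by (intro tendsto_add) auto
  moreover have "\<forall>\<^sub>F t in at_right 0. (1 / norm (t - 0)) *\<^sub>R (\<gamma> t - (\<gamma> 0 + (t - 0) *\<^sub>R v)) + v
      = (1 / t) *\<^sub>R (\<gamma> t - \<gamma> 0)"
    using eventually_at_right_less[of 0] by eventually_elim (simp add: scaleR_diff_right scaleR_add_right)
  ultimately have lim: "((\<lambda>t. (1 / t) *\<^sub>R (\<gamma> t - \<gamma> 0)) \<longlongrightarrow> v) (at_right 0)"
    using Lim_transform_eventually by fastforce
  have "\<forall>\<^sub>F t in at_right 0. (1 / t) *\<^sub>R (\<gamma> t - \<gamma> 0) \<in> F"
    using ev by eventually_elim (use assms in \<open>auto intro: subspace_scale subspace_diff\<close>)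
  then show ?thesis using Lim_in_closed_set[OF F(2) _ _ lim] by simp
qed

lemma has_derivative_in_subspace:
  fixes f :: "'a::real_normed_vector \<Rightarrow> 'b::real_normed_vector"
  assumes f: "(f has_derivative f') (at p within U)"
    and U: "openin (top_of_set E) U" "subspace E" "p \<in> U" "v \<in> E"
    and F: "subspace F" "closed F" "\<And>x. x \<in> U \<Longrightarrow> f x \<in> F"
  shows "f' v \<in> F"
proof -
  have ev: "\<forall>\<^sub>F t in at_right (0::real). p + t *\<^sub>R v \<in> U"
    using eventually_line_openin[OF U] by (auto simp: eventually_at_filter elim: eventually_mono)
  have "((\<lambda>t. f (p + t *\<^sub>R v)) has_vector_derivative f' v) (at_right (0::real))"
    by (rule has_derivative_along_curve[OF f line_has_vector_derivative _ ev]) simp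
  moreover have "\<forall>\<^sub>F t in at_right (0::real). f (p + t *\<^sub>R v) \<in> F"
    using ev by eventually_elim (rule F(3))
  ultimately show ?thesis
    using has_vector_derivative_in_subspace[of "\<lambda>t. f (p + t *\<^sub>R v)"] F U(3) by auto
qed

text \<open>The derivative of \<open>g (f x)\<close> evaluates the derivative of \<open>g\<close> in
  a direction that moves with \<open>x\<close>. Expanding this direction in the finite basis
  \<open>B\<close> leaves derivatives in constant directions, to which the induction hypothesis
  applies.\<close>

lemma Ck_on_compose:
  fixes f :: "'a::real_normed_vector \<Rightarrow> 'b::real_inner" and g :: "'b \<Rightarrow> 'c::real_normed_vector"
  assumes U: "openin (top_of_set E) U" "subspace E"
    and V: "openin (top_of_set F) V" and B: "orthonormal_basis F B"
    and "Ck_on k E f U" "Ck_on k F g V" and fUV: "f ` U \<subseteq> V"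
  shows "Ck_on k E (\<lambda>x. g (f x)) U"
  using assms(5,6)
proof (induction k arbitrary: g)
  case 0
  then show ?case using fUV by (auto intro: continuous_on_compose2)
next
  case (Suc k)
  note F = orthonormal_basis_subspace[OF B]
  let ?f = "\<lambda>x. dderiv U f x" and ?g = "\<lambda>y. dderiv V g y"
  have f': "(f has_derivative ?f x) (at x within U)" if "x \<in> U" for x
    using Ck_on_has_derivative[OF Suc.prems(1)] that .
  have g': "(g has_derivative ?g y) (at y within V)" if "y \<in> V" for y
    using Ck_on_has_derivative[OF Suc.prems(2)] that .
  show ?case
  proof (rule Ck_on_SucI[OF U])
    show "((\<lambda>x. g (f x)) has_derivative (\<lambda>v. ?g (f x) (?f x v))) (at x within U)" if "x \<in> U" for x
      using fUV that by (intro has_derivative_in_compose2[of V, OF g'] f') auto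
    fix v assume v: "v \<in> E"
    have "Ck_on k E (\<lambda>x. \<Sum>b\<in>B. inner (?f x v) b *\<^sub>R ?g (f x) b) U"
      using Ck_on_dderiv[OF Suc.prems(1) v] Suc.IH[OF Ck_on_pred[OF Suc.prems(1)] Ck_on_dderiv[OF Suc.prems(2)]]
      by (intro Ck_on_sum[OF U] Ck_on_bilinear[OF U bounded_bilinear_scaleR]
           Ck_on_linear_compose[OF U bounded_linear_inner_left])
         (auto simp: orthonormal_basis_finite[OF B] orthonormal_basis_mem[OF B])
    moreover have "(\<Sum>b\<in>B. inner (?f x v) b *\<^sub>R ?g (f x) b) = ?g (f x) (?f x v)" if x: "x \<in> U" for x
    proof -
      have "?f x v \<in> F"
        using has_derivative_in_subspace[OF f'[OF x] U x v F closed_orthonormal_basis[OF B]] fUV V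
        by (auto dest: openin_imp_subset)
      then have "?g (f x) (?f x v) = ?g (f x) (\<Sum>b\<in>B. inner (?f x v) b *\<^sub>R b)"
        using orthonormal_basis_expand[OF B] by metis
      also have "\<dots> = (\<Sum>b\<in>B. inner (?f x v) b *\<^sub>R ?g (f x) b)"
        using has_derivative_linear[OF g', of "f x"] fUV x by (auto simp: linear_sum linear_scale)
      finally show ?thesis ..
    qed
    ultimately show "Ck_on k E (\<lambda>x. ?g (f x) (?f x v)) U" by (rule Ck_on_cong[rotated])
  qed
qed

lemma Ck_on_inverse: "Ck_on k UNIV inverse {0 :: real<..}"
proof (induction k)
  case 0
  then show ?case by (auto intro!: continuous_intros)
next
  case (Suc k)
  have U: "openin (top_of_set UNIV) {0 :: real<..}" "subspace (UNIV :: real set)" by auto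
  have "Ck_on k UNIV (\<lambda>x::real. (inverse x * inverse x) * (- v)) {0<..}" for v
    by (intro Ck_on_bilinear[OF U bounded_bilinear_mult] Suc Ck_on_const[OF U])
  then show ?case
    by (intro Ck_on_SucI[OF U, where f' = "\<lambda>x v. (inverse x * inverse x) * (- v)"])
       (auto intro!: derivative_eq_intros)
qed

lemma smooth_on_openin: "smooth_on E f U \<Longrightarrow> openin (top_of_set E) U"
  by (simp add: smooth_on_def)

lemma smooth_on_subset:
  "smooth_on E f U \<Longrightarrow> openin (top_of_set E) V \<Longrightarrow> V \<subseteq> U \<Longrightarrow> smooth_on E f V"
  unfolding smooth_on_def by (auto intro: Ck_on_subset)

lemma smooth_on_cong: "smooth_on E f U \<Longrightarrow> (\<And>x. x \<in> U \<Longrightarrow> f x = g x) \<Longrightarrow> smooth_on E g U"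
  unfolding smooth_on_def using Ck_on_cong[of U f g] by auto

lemma smooth_on_has_derivative:
  assumes f: "smooth_on E f U" and x: "x \<in> U"
  shows "(f has_derivative dderiv E f x) (at x within E)"
proof -
  have "Ck_on (Suc 0) E f U" using f unfolding smooth_on_def by blast
  then show ?thesis
    using Ck_on_has_derivative[OF _ x, of 0 E f] at_within_openin[OF smooth_on_openin[OF f] x] by metis
qed

lemma smooth_on_dderiv:
  assumes f: "smooth_on E f U" and v: "v \<in> E"
  shows "smooth_on E (\<lambda>x. dderiv E f x v) U"
proof -
  have "Ck_on k E (\<lambda>x. dderiv E f x v) U" for k
  proof (rule Ck_on_cong)
    have "Ck_on (Suc k) E f U" using f unfolding smooth_on_def by blast
    then show "Ck_on k E (\<lambda>x. dderiv U f x v) U"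
      using v by (rule Ck_on_dderiv)
  qed (simp add: at_within_openin[OF smooth_on_openin[OF f]])
  then show ?thesis using smooth_on_openin[OF f] by (simp add: smooth_on_def)
qed

lemma smooth_on_continuous_on: "smooth_on E f U \<Longrightarrow> continuous_on U f"
  unfolding smooth_on_def by (metis Ck_on.simps(1))

lemma smooth_on_dderiv_eq:
  fixes f :: "'a::real_normed_vector \<Rightarrow> 'b::real_normed_vector"
  assumes "(f has_derivative f') (at p within E)"
    and "subspace E" "p \<in> E" "v \<in> E"
  shows "dderiv E f p v = f' v"
  using dderiv_eq[OF assms(1) _ assms(2-4)] by simp

context
  fixes E :: "'a::real_normed_vector set" and U :: "'a set"
  assumes U: "openin (top_of_set E) U" "subspace E"
begin

lemma smooth_on_const: "smooth_on E (\<lambda>x. c) U"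
  using U by (auto simp: smooth_on_def intro: Ck_on_const)

lemma smooth_on_linear_compose:
  "bounded_linear h \<Longrightarrow> smooth_on E f U \<Longrightarrow> smooth_on E (\<lambda>x. h (f x)) U"
  using U by (auto simp: smooth_on_def intro: Ck_on_linear_compose)

lemma smooth_on_add: "smooth_on E f U \<Longrightarrow> smooth_on E g U \<Longrightarrow> smooth_on E (\<lambda>x. f x + g x) U"
  using U by (auto simp: smooth_on_def intro: Ck_on_add)

lemma smooth_on_minus: "smooth_on E f U \<Longrightarrow> smooth_on E (\<lambda>x. - f x) U"
  by (rule smooth_on_linear_compose[OF bounded_linear_minus[OF bounded_linear_ident]])

lemma smooth_on_diff: "smooth_on E f U \<Longrightarrow> smooth_on E g U \<Longrightarrow> smooth_on E (\<lambda>x. f x - g x) U"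
  using smooth_on_add[of f "\<lambda>x. - g x"] smooth_on_minus[of g] by simp

lemma smooth_on_sum:
  "finite I \<Longrightarrow> (\<And>i. i \<in> I \<Longrightarrow> smooth_on E (f i) U) \<Longrightarrow> smooth_on E (\<lambda>x. \<Sum>i\<in>I. f i x) U"
  using U by (auto simp: smooth_on_def intro: Ck_on_sum)

lemma smooth_on_bilinear:
  "bounded_bilinear h \<Longrightarrow> smooth_on E f U \<Longrightarrow> smooth_on E g U \<Longrightarrow> smooth_on E (\<lambda>x. h (f x) (g x)) U"
  using U by (auto simp: smooth_on_def intro: Ck_on_bilinear)

lemmas smooth_on_scaleR = smooth_on_bilinear[OF bounded_bilinear_scaleR]
lemmas smooth_on_inner = smooth_on_bilinear[OF bounded_bilinear_inner]
lemmas smooth_on_mult = smooth_on_bilinear[OF bounded_bilinear_mult]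

lemma smooth_on_id: "smooth_on E (\<lambda>x. x) U"
proof -
  have "Ck_on k E (\<lambda>x. x) U" for k
  proof (cases k)
    case (Suc j)
    show ?thesis unfolding Suc
      by (rule Ck_on_SucI[OF U, where f' = "\<lambda>x v. v"]) (auto intro: has_derivative_ident Ck_on_const[OF U])
  qed (auto intro: continuous_on_id)
  then show ?thesis using U by (simp add: smooth_on_def)
qed

lemma smooth_on_compose:
  fixes f :: "'a \<Rightarrow> 'b::real_inner" and g :: "'b \<Rightarrow> 'c::real_normed_vector"
  assumes "orthonormal_basis F B" "smooth_on E f U" "smooth_on F g V" "f ` U \<subseteq> V"
  shows "smooth_on E (\<lambda>x. g (f x)) U"
  using assms U by (auto simp: smooth_on_def intro: Ck_on_compose[OF U _ assms(1)])

lemma smooth_on_inverse: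
  assumes "smooth_on E f U" "\<And>x. x \<in> U \<Longrightarrow> f x > (0::real)"
  shows "smooth_on E (\<lambda>x. inverse (f x)) U"
proof (rule smooth_on_compose[OF orthonormal_basis_real assms(1)])
  show "smooth_on UNIV inverse {0 :: real<..}" by (simp add: smooth_on_def Ck_on_inverse)
qed (use assms(2) in auto)

end

lemma smooth_on_real_sequence:
  fixes G :: "nat \<Rightarrow> real \<Rightarrow> real"
  assumes "\<And>k x. (G k has_real_derivative G (Suc k) x) (at x)"
  shows "smooth_on UNIV (G k) UNIV"
proof -
  have U: "openin (top_of_set UNIV) (UNIV :: real set)" "subspace (UNIV :: real set)" by auto
  have "Ck_on j UNIV (G k) UNIV" for j
  proof (induction j arbitrary: k)
    case 0
    then show ?case using assms by (auto intro: DERIV_isCont simp: continuous_on_eq_continuous_at)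
  next
    case (Suc j)
    show ?case
    proof (rule Ck_on_SucI[OF U])
      show "(G k has_derivative (\<lambda>v. G (Suc k) x * v)) (at x within UNIV)" for x
        using assms[of k x] by (simp add: has_field_derivative_def)
      show "Ck_on j UNIV (\<lambda>x. G (Suc k) x * v) UNIV" for v
        by (rule Ck_on_bilinear[OF U bounded_bilinear_mult Suc Ck_on_const[OF U]])
    qed
  qed
  then show ?thesis by (simp add: smooth_on_def)
qed

text \<open>Only increments \<open>y - x\<close> from \<open>E\<close> enter the limit, so a
  derivative can be changed off \<open>E\<close> at will.\<close>

lemma has_derivative_within_subspace_cong:
  assumes f: "(f has_derivative D) (at x within E)" and E: "subspace E" "x \<in> E"
    and D': "bounded_linear D'" "\<And>v. v \<in> E \<Longrightarrow> D' v = D v"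
  shows "(f has_derivative D') (at x within E)"
proof -
  have "((\<lambda>y. (1 / norm (y - x)) *\<^sub>R (f y - (f x + D (y - x)))) \<longlongrightarrow> 0) (at x within E)"
    using f by (simp add: has_derivative_within)
  moreover have "\<forall>\<^sub>F y in at x within E. (1 / norm (y - x)) *\<^sub>R (f y - (f x + D (y - x)))
      = (1 / norm (y - x)) *\<^sub>R (f y - (f x + D' (y - x)))"
    using E D'(2) by (auto simp: eventually_at_filter subspace_diff)
  ultimately show ?thesis
    using D'(1) unfolding has_derivative_within by (blast intro: Lim_transform_eventually)
qed

lemma smooth_on_locally_lipschitz:
  fixes f :: "'a::real_inner \<Rightarrow> 'b::real_normed_vector"
  assumes B: "orthonormal_basis E B" and f: "smooth_on E f U" and p: "p \<in> U"
  shows "\<exists>r>0. \<exists>L>0. E \<inter> ball p r \<subseteq> U \<and>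
    (\<forall>x\<in>E \<inter> ball p r. \<forall>y\<in>E \<inter> ball p r. dist (f x) (f y) \<le> L * dist x y)"
proof -
  note E = orthonormal_basis_subspace[OF B] and fin = orthonormal_basis_finite[OF B]
  obtain O' where O: "open O'" "U = E \<inter> O'" using smooth_on_openin[OF f] by (auto simp: openin_open)
  have cont: "continuous_on U (\<lambda>x. \<Sum>b\<in>B. norm (dderiv E f x b))"
    using smooth_on_continuous_on[OF smooth_on_dderiv[OF f]] orthonormal_basis_mem[OF B]
    by (intro continuous_on_sum continuous_on_norm) auto
  obtain r1 where r1: "r1 > 0" "\<And>x. x \<in> U \<Longrightarrow> dist x p < r1 \<Longrightarrow>
      dist (\<Sum>b\<in>B. norm (dderiv E f x b)) (\<Sum>b\<in>B. norm (dderiv E f p b)) < 1"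
    using cont p unfolding continuous_on_iff by (meson zero_less_one)
  obtain r2 where r2: "r2 > 0" "ball p r2 \<subseteq> O'" using O p open_contains_ball by blast
  define r where "r = min r1 r2"
  define L where "L = (\<Sum>b\<in>B. norm (dderiv E f p b)) + 1"
  have L: "L > 0" unfolding L_def by (intro add_nonneg_pos sum_nonneg) auto
  have sub: "E \<inter> ball p r \<subseteq> U" using r2 O by (auto simp: r_def)
  \<comment> \<open>Equals the derivative on \<open>E\<close> and vanishes on the orthogonal
    complement. The chosen derivative is not controlled off \<open>E\<close>, whereas
    \<open>?D\<close> is bounded by its values on \<open>B\<close>.\<close>
  let ?D = "\<lambda>x v. \<Sum>b\<in>B. inner v b *\<^sub>R dderiv E f x b"
  have D: "(f has_derivative ?D x) (at x within E \<inter> ball p r)" if x: "x \<in> E \<inter> ball p r" for x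
  proof -
    have fx: "(f has_derivative dderiv E f x) (at x within E)"
      using smooth_on_has_derivative[OF f] sub x by auto
    have "(f has_derivative ?D x) (at x within E)"
    proof (rule has_derivative_within_subspace_cong[OF fx E])
      show "bounded_linear (?D x)"
        by (intro bounded_linear_sum bounded_linear_compose[OF bounded_linear_scaleR_left] bounded_linear_inner_left)
      show "?D x v = dderiv E f x v" if "v \<in> E" for v
        by (subst (2) orthonormal_basis_expand[OF B that])
           (simp add: linear_sum[OF has_derivative_linear[OF fx]] linear_scale[OF has_derivative_linear[OF fx]])
    qed (use x in auto)
    then show ?thesis by (rule has_derivative_subset) auto
  qed
  have bound: "onorm (?D x) \<le> L" if x: "x \<in> E \<inter> ball p r" for x
  proof (rule onorm_bound)
    show "0 \<le> L" using L by simp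
    fix v
    have "norm (?D x v) \<le> (\<Sum>b\<in>B. norm v * norm (dderiv E f x b))"
    proof (rule order_trans[OF norm_sum sum_mono])
      fix b assume "b \<in> B"
      then have "\<bar>inner v b\<bar> \<le> norm v"
        using Cauchy_Schwarz_ineq2[of v b] B by (auto simp: orthonormal_basis_def)
      then show "norm (inner v b *\<^sub>R dderiv E f x b) \<le> norm v * norm (dderiv E f x b)"
        by (simp add: mult_right_mono)
    qed
    also have "\<dots> = (\<Sum>b\<in>B. norm (dderiv E f x b)) * norm v" by (simp add: sum_distrib_left mult.commute)
    also have "\<dots> \<le> L * norm v"
      using r1(2)[of x] x sub by (intro mult_right_mono) (auto simp: L_def r_def dist_commute dist_real_def)
    finally show "norm (?D x v) \<le> L * norm v" .
  qed
  have "dist (f x) (f y) \<le> L * dist x y" if "x \<in> E \<inter> ball p r" "y \<in> E \<inter> ball p r" for x y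
    unfolding dist_norm using that E
    by (intro differentiable_bound[OF _ D bound]) (auto intro: convex_Int subspace_imp_convex)
  then show ?thesis using sub L r1(1) r2(1) by (intro exI[of _ r] exI[of _ L] conjI) (auto simp: r_def)
qed

section \<open>Symmetry of second derivatives\<close>

lemma smooth_on_line_derivative:
  fixes f :: "'a::real_normed_vector \<Rightarrow> real"
  assumes f: "smooth_on E f U" and E: "subspace E" "v \<in> E" and x: "q + t *\<^sub>R v \<in> U"
  shows "((\<lambda>t. f (q + t *\<^sub>R v)) has_real_derivative dderiv E f (q + t *\<^sub>R v) v) (at t)"
proof -
  have "q + t *\<^sub>R v \<in> E" using x smooth_on_openin[OF f] by (auto dest: openin_imp_subset)
  then have "q \<in> E" using subspace_diff[OF E(1), of "q + t *\<^sub>R v" "t *\<^sub>R v"] E by (simp add: subspace_scale)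
  then have "(\<lambda>t. q + t *\<^sub>R v) ` UNIV \<subseteq> E" using E by (auto intro: subspace_add subspace_scale)
  then have "((\<lambda>t. f (q + t *\<^sub>R v)) has_derivative (\<lambda>h. dderiv E f (q + t *\<^sub>R v) (h *\<^sub>R v))) (at t)"
    using has_derivative_subset[OF smooth_on_has_derivative[OF f x]]
    by (intro has_derivative_in_compose[of "\<lambda>t. q + t *\<^sub>R v" "\<lambda>h. h *\<^sub>R v" t UNIV f])
       (auto intro!: derivative_eq_intros)
  moreover have "dderiv E f (q + t *\<^sub>R v) (h *\<^sub>R v) = dderiv E f (q + t *\<^sub>R v) v * h" for h
    using linear_scale[OF has_derivative_linear[OF smooth_on_has_derivative[OF f x]], of h v] by simp
  ultimately show ?thesis by (simp add: has_field_derivative_def)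
qed

text \<open>The mean value theorem is applied in direction \<open>v\<close> to the difference over
  \<open>s *\<^sub>R w\<close>, and then in direction \<open>w\<close> to the derivative. The second
  difference itself is symmetric in \<open>v\<close> and \<open>w\<close>.\<close>

lemma second_difference_mean_value:
  fixes f :: "'a::real_normed_vector \<Rightarrow> real"
  assumes f: "smooth_on E f U" and E: "subspace E" "v \<in> E" "w \<in> E" and s: "s > 0"
    and U: "\<And>a b. 0 \<le> a \<Longrightarrow> a \<le> s \<Longrightarrow> 0 \<le> b \<Longrightarrow> b \<le> s \<Longrightarrow> p + a *\<^sub>R v + b *\<^sub>R w \<in> U"
  shows "\<exists>a b. 0 < a \<and> a < s \<and> 0 < b \<and> b < s \<and>
    f (p + s *\<^sub>R v + s *\<^sub>R w) - f (p + s *\<^sub>R v) - f (p + s *\<^sub>R w) + f p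
      = s * s * dderiv E (\<lambda>x. dderiv E f x v) (p + a *\<^sub>R v + b *\<^sub>R w) w"
proof -
  have eq: "p + a *\<^sub>R v + b *\<^sub>R w = (p + b *\<^sub>R w) + a *\<^sub>R v" for a b by simp
  define G where "G = (\<lambda>x. dderiv E f x v)"
  have G: "smooth_on E G U" unfolding G_def by (rule smooth_on_dderiv[OF f E(2)])
  have "\<exists>a>0. a < s \<and> (f (p + s *\<^sub>R w + s *\<^sub>R v) - f (p + s *\<^sub>R v))
      - (f (p + s *\<^sub>R w + 0 *\<^sub>R v) - f (p + 0 *\<^sub>R v))
      = (s - 0) * (G (p + s *\<^sub>R w + a *\<^sub>R v) - G (p + a *\<^sub>R v))"
    unfolding G_def
  proof (rule MVT2)
    fix t assume t: "0 \<le> t" "t \<le> s"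
    show "((\<lambda>t. f (p + s *\<^sub>R w + t *\<^sub>R v) - f (p + t *\<^sub>R v)) has_real_derivative
        dderiv E f (p + s *\<^sub>R w + t *\<^sub>R v) v - dderiv E f (p + t *\<^sub>R v) v) (at t)"
      using U[of t s] U[of t 0] t s
      by (intro DERIV_diff smooth_on_line_derivative[OF f E(1,2)]) (auto simp: eq)
  qed (use s in simp)
  then obtain a where a: "0 < a" "a < s" "(f (p + s *\<^sub>R w + s *\<^sub>R v) - f (p + s *\<^sub>R v))
      - (f (p + s *\<^sub>R w + 0 *\<^sub>R v) - f (p + 0 *\<^sub>R v))
      = (s - 0) * (G (p + s *\<^sub>R w + a *\<^sub>R v) - G (p + a *\<^sub>R v))" by blast
  have "\<exists>b>0. b < s \<and> G (p + a *\<^sub>R v + s *\<^sub>R w) - G (p + a *\<^sub>R v + 0 *\<^sub>R w)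
      = (s - 0) * dderiv E G (p + a *\<^sub>R v + b *\<^sub>R w) w"
    using U a(1,2) s by (intro MVT2 smooth_on_line_derivative[OF G E(1,3)]) auto
  then obtain b where b: "0 < b" "b < s" "G (p + a *\<^sub>R v + s *\<^sub>R w) - G (p + a *\<^sub>R v + 0 *\<^sub>R w)
      = (s - 0) * dderiv E G (p + a *\<^sub>R v + b *\<^sub>R w) w" by blast
  have "f (p + s *\<^sub>R v + s *\<^sub>R w) - f (p + s *\<^sub>R v) - f (p + s *\<^sub>R w) + f p
      = s * (G (p + a *\<^sub>R v + s *\<^sub>R w) - G (p + a *\<^sub>R v))"
    using a(3) by (simp add: eq)
  also have "\<dots> = s * s * dderiv E G (p + a *\<^sub>R v + b *\<^sub>R w) w" using b(3) by simp
  finally show ?thesis using a(1,2) b(1,2) unfolding G_def by blast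
qed

lemma dderiv_commute_real:
  fixes f :: "'a::real_normed_vector \<Rightarrow> real"
  assumes f: "smooth_on E f U" and E: "subspace E" "v \<in> E" "w \<in> E" and p: "p \<in> U"
  shows "dderiv E (\<lambda>x. dderiv E f x v) p w = dderiv E (\<lambda>x. dderiv E f x w) p v"
proof (rule ccontr)
  define G H where "G x = dderiv E (\<lambda>x. dderiv E f x v) x w" and "H x = dderiv E (\<lambda>x. dderiv E f x w) x v" for x
  assume "dderiv E (\<lambda>x. dderiv E f x v) p w \<noteq> dderiv E (\<lambda>x. dderiv E f x w) p v"
  then have d: "0 < dist (G p) (H p) / 2" by (simp add: G_def H_def)
  have cont: "continuous_on U G" "continuous_on U H"
    unfolding G_def H_def
    by (rule smooth_on_continuous_on[OF smooth_on_dderiv[OF smooth_on_dderiv[OF f E(2)] E(3)]]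
             smooth_on_continuous_on[OF smooth_on_dderiv[OF smooth_on_dderiv[OF f E(3)] E(2)]])+
  obtain d1 where d1: "d1 > 0" "\<And>x. x \<in> U \<Longrightarrow> dist x p < d1 \<Longrightarrow> dist (G x) (G p) < dist (G p) (H p) / 2"
    using cont(1) p d unfolding continuous_on_iff by meson
  obtain d2 where d2: "d2 > 0" "\<And>x. x \<in> U \<Longrightarrow> dist x p < d2 \<Longrightarrow> dist (H x) (H p) < dist (G p) (H p) / 2"
    using cont(2) p d unfolding continuous_on_iff by meson
  obtain O' where O: "open O'" "U = E \<inter> O'" using smooth_on_openin[OF f] by (auto simp: openin_open)
  obtain d3 where d3: "d3 > 0" "ball p d3 \<subseteq> O'" using O p open_contains_ball by blast
  define e where "e = min d1 (min d2 d3)"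
  have e: "e > 0" using d1 d2 d3 by (simp add: e_def)
  \<comment> \<open>Keeps the whole parallelogram within distance \<open>e\<close> of
    \<open>p\<close>; the summand 1 covers the case that \<open>v\<close> and \<open>w\<close> both
    vanish.\<close>
  define s where "s = e / (2 * (norm v + norm w + 1))"
  have s: "s > 0" unfolding s_def using e by (intro divide_pos_pos) (auto intro: add_nonneg_pos)
  have near: "p + a *\<^sub>R v + b *\<^sub>R w \<in> U \<and> dist (p + a *\<^sub>R v + b *\<^sub>R w) p < e"
    if "0 \<le> a" "a \<le> s" "0 \<le> b" "b \<le> s" for a b
  proof -
    have "dist (p + a *\<^sub>R v + b *\<^sub>R w) p \<le> norm (a *\<^sub>R v) + norm (b *\<^sub>R w)"
      by (simp add: dist_norm) (metis norm_triangle_ineq norm_scaleR)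
    also have "\<dots> \<le> s * norm v + s * norm w" using that by (intro add_mono) (auto intro: mult_right_mono)
    also have "\<dots> = s * (norm v + norm w)" by (simp add: algebra_simps)
    also have "\<dots> \<le> s * (norm v + norm w + 1)" using s by (intro mult_left_mono) auto
    also have "\<dots> = e / 2" unfolding s_def by (simp add: field_simps add_nonneg_eq_0_iff)
    also have "\<dots> < e" using e by simp
    finally have "dist (p + a *\<^sub>R v + b *\<^sub>R w) p < e" .
    moreover have "p + a *\<^sub>R v + b *\<^sub>R w \<in> E" using E p O by (auto intro: subspace_add subspace_scale)
    ultimately show ?thesis using d3 O by (auto simp: e_def dist_commute subset_eq)
  qed
  obtain a b where ab: "0 < a" "a < s" "0 < b" "b < s"
    "f (p + s *\<^sub>R v + s *\<^sub>R w) - f (p + s *\<^sub>R v) - f (p + s *\<^sub>R w) + f p = s * s * G (p + a *\<^sub>R v + b *\<^sub>R w)"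
    using second_difference_mean_value[OF f E s, of p] near unfolding G_def by blast
  have near': "p + b *\<^sub>R w + a *\<^sub>R v = p + a *\<^sub>R v + b *\<^sub>R w" for a b by simp
  obtain a' b' where ab': "0 < a'" "a' < s" "0 < b'" "b' < s"
    "f (p + s *\<^sub>R w + s *\<^sub>R v) - f (p + s *\<^sub>R w) - f (p + s *\<^sub>R v) + f p = s * s * H (p + a' *\<^sub>R w + b' *\<^sub>R v)"
    using second_difference_mean_value[OF f E(1,3,2) s, of p] near unfolding H_def near' by blast
  have "s * s * G (p + a *\<^sub>R v + b *\<^sub>R w) = s * s * H (p + b' *\<^sub>R v + a' *\<^sub>R w)"
    using ab(5) ab'(5) unfolding near'[where a = b' and b = a'] near'[where a = s and b = s] by linarith
  then have eq: "G (p + a *\<^sub>R v + b *\<^sub>R w) = H (p + b' *\<^sub>R v + a' *\<^sub>R w)" using s by simp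
  have "dist (G (p + a *\<^sub>R v + b *\<^sub>R w)) (G p) < dist (G p) (H p) / 2"
    using near[of a b] ab by (intro d1) (auto simp: e_def)
  moreover have "dist (H (p + b' *\<^sub>R v + a' *\<^sub>R w)) (H p) < dist (G p) (H p) / 2"
    using near[of b' a'] ab' by (intro d2) (auto simp: e_def)
  ultimately show False unfolding eq
    using dist_triangle2[of "G p" "H p" "H (p + b' *\<^sub>R v + a' *\<^sub>R w)"] by (simp add: dist_commute)
qed

lemma dderiv_inner_left:
  assumes f: "smooth_on E f U" and E: "subspace E" "v \<in> E" and p: "p \<in> U"
  shows "dderiv E (\<lambda>x. inner (f x) y) p v = inner (dderiv E f p v) y"
proof -
  have "p \<in> E" using p smooth_on_openin[OF f] by (auto dest: openin_imp_subset)
  then show ?thesis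
    using E by (intro smooth_on_dderiv_eq has_derivative_inner_left smooth_on_has_derivative[OF f p])
qed

text \<open>Testing against an arbitrary vector \<open>y\<close> reduces the claim to real-valued
  functions.\<close>

lemma dderiv_commute:
  fixes f :: "'a::real_normed_vector \<Rightarrow> 'b::real_inner"
  assumes f: "smooth_on E f U" and E: "subspace E" "v \<in> E" "w \<in> E" and p: "p \<in> U"
  shows "dderiv E (\<lambda>x. dderiv E f x v) p w = dderiv E (\<lambda>x. dderiv E f x w) p v"
proof -
  note U = smooth_on_openin[OF f]
  have swap: "dderiv E (\<lambda>x. dderiv E (\<lambda>x. inner (f x) y) x a) p b
      = inner (dderiv E (\<lambda>x. dderiv E f x a) p b) y" if ab: "a \<in> E" "b \<in> E" for a b y
  proof -
    have "dderiv U (\<lambda>x. dderiv E (\<lambda>x. inner (f x) y) x a) p = dderiv U (\<lambda>x. inner (dderiv E f x a) y) p"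
      using dderiv_inner_left[OF f E(1) ab(1)] by (intro frechet_derivative_cong[OF p])
    then show ?thesis
      using dderiv_inner_left[OF smooth_on_dderiv[OF f ab(1)] E(1) ab(2) p, of y] at_within_openin[OF U p] by simp
  qed
  have "inner (dderiv E (\<lambda>x. dderiv E f x v) p w) y = inner (dderiv E (\<lambda>x. dderiv E f x w) p v) y" for y
    using dderiv_commute_real[OF smooth_on_linear_compose[OF U E(1) bounded_linear_inner_left f] E p, of y]
    using swap[OF E(2,3)] swap[OF E(3,2)] by simp
  then show ?thesis using vector_eq_rdot by blast
qed

section \<open>Computation rules for directional derivatives\<close>

lemma dderiv_cong:
  assumes "openin (top_of_set E) U" "p \<in> U" "\<And>x. x \<in> U \<Longrightarrow> f x = g x"
  shows "dderiv E f p = dderiv E g p"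
  using frechet_derivative_cong[OF assms(2,3)] at_within_openin[OF assms(1,2)] by simp

context
  fixes E :: "'a::real_normed_vector set" and U :: "'a set" and p W :: 'a
  assumes U: "openin (top_of_set E) U" and E: "subspace E" and p: "p \<in> U" and W: "W \<in> E"
begin

private lemma pE: "p \<in> E" using U p by (auto dest: openin_imp_subset)

lemma dderiv_const: "dderiv E (\<lambda>x. c) p W = 0"
  by (rule smooth_on_dderiv_eq[OF has_derivative_const E pE W])

lemma dderiv_id: "dderiv E (\<lambda>x. x) p W = W"
  by (rule smooth_on_dderiv_eq[OF has_derivative_ident E pE W])

lemma dderiv_add:
  "smooth_on E f U \<Longrightarrow> smooth_on E g U \<Longrightarrow>
    dderiv E (\<lambda>x. f x + g x) p W = dderiv E f p W + dderiv E g p W"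
  by (rule smooth_on_dderiv_eq[OF has_derivative_add E pE W]) (rule smooth_on_has_derivative[OF _ p], assumption)+

lemma dderiv_diff:
  "smooth_on E f U \<Longrightarrow> smooth_on E g U \<Longrightarrow>
    dderiv E (\<lambda>x. f x - g x) p W = dderiv E f p W - dderiv E g p W"
  by (rule smooth_on_dderiv_eq[OF has_derivative_diff E pE W]) (rule smooth_on_has_derivative[OF _ p], assumption)+

lemma dderiv_linear:
  "bounded_linear h \<Longrightarrow> smooth_on E f U \<Longrightarrow> dderiv E (\<lambda>x. h (f x)) p W = h (dderiv E f p W)"
  by (rule smooth_on_dderiv_eq[OF bounded_linear.has_derivative E pE W])
     (auto intro: smooth_on_has_derivative[OF _ p])

lemma dderiv_bilinear:
  "bounded_bilinear h \<Longrightarrow> smooth_on E f U \<Longrightarrow> smooth_on E g U \<Longrightarrow>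
    dderiv E (\<lambda>x. h (f x) (g x)) p W = h (f p) (dderiv E g p W) + h (dderiv E f p W) (g p)"
  by (rule smooth_on_dderiv_eq[OF bounded_bilinear.FDERIV E pE W])
     (auto intro: smooth_on_has_derivative[OF _ p])

lemmas dderiv_scaleR = dderiv_bilinear[OF bounded_bilinear_scaleR]
lemmas dderiv_inner = dderiv_bilinear[OF bounded_bilinear_inner]

lemma dderiv_sum:
  "(\<And>i. i \<in> I \<Longrightarrow> smooth_on E (f i) U) \<Longrightarrow>
    dderiv E (\<lambda>x. \<Sum>i\<in>I. f i x) p W = (\<Sum>i\<in>I. dderiv E (f i) p W)"
  by (rule smooth_on_dderiv_eq[OF has_derivative_sum E pE W])
     (auto intro: smooth_on_has_derivative[OF _ p])

lemma dderiv_compose: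
  assumes f: "smooth_on E f U" and g: "smooth_on F g V" and "f ` U \<subseteq> V"
  shows "dderiv E (\<lambda>x. g (f x)) p W = dderiv F g (f p) (dderiv E f p W)"
proof -
  have V: "V \<subseteq> F" using smooth_on_openin[OF g] by (auto dest: openin_imp_subset)
  have fp: "(f has_derivative dderiv E f p) (at p within U)"
    using smooth_on_has_derivative[OF f p] at_within_openin[OF U p] by simp
  have "((\<lambda>x. g (f x)) has_derivative (\<lambda>v. dderiv F g (f p) (dderiv E f p v))) (at p within U)"
  proof (rule has_derivative_in_compose[OF fp])
    have "f p \<in> V" using p assms(3) by blast
    then show "(g has_derivative dderiv F g (f p)) (at (f p) within f ` U)"
      using V assms(3) by (intro has_derivative_subset[OF smooth_on_has_derivative[OF g]]) auto
  qed
  then show ?thesis by (rule dderiv_eq[OF _ U E p W])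
qed

lemma dderiv_in_subspace:
  assumes "smooth_on E f U" "orthonormal_basis F B" "\<And>x. x \<in> U \<Longrightarrow> f x \<in> F"
  shows "dderiv E f p W \<in> F"
proof -
  have fp: "(f has_derivative dderiv E f p) (at p within U)"
    using smooth_on_has_derivative[OF assms(1) p] at_within_openin[OF U p] by simp
  show ?thesis
    using assms(2,3) orthonormal_basis_subspace closed_orthonormal_basis
    by (intro has_derivative_in_subspace[OF fp U E p W]) auto
qed

lemma linear_dderiv: "smooth_on E f U \<Longrightarrow> linear (dderiv E f p)"
  using smooth_on_has_derivative[OF _ p] has_derivative_linear by blast

end

text \<open>Two derivatives within \<open>\<Sigma>\<close> agree on a subspace that contains all
  velocities of curves, hence on their span. Thus the choice hidden in
  \<open>frechet_derivative\<close> is harmless on tangent vectors.\<close>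

lemma has_derivative_unique_tangent:
  fixes Y :: "'a::real_inner \<Rightarrow> 'b::real_normed_vector"
  assumes "(Y has_derivative D) (at p within \<Sigma>)" "v \<in> tangent_space \<Sigma> p"
  shows "dderiv \<Sigma> Y p v = D v"
proof -
  have D': "(Y has_derivative dderiv \<Sigma> Y p) (at p within \<Sigma>)"
    using assms(1) differentiableI frechet_derivative_works by blast
  note lin = has_derivative_linear[OF D'] has_derivative_linear[OF assms(1)]
  have "tangent_space \<Sigma> p \<subseteq> {v. dderiv \<Sigma> Y p v = D v}"
    unfolding tangent_space_def
    by (intro span_minimal) (use has_derivative_unique_curve[OF D' assms(1)] lin in
        \<open>auto simp: subspace_def linear_add linear_scale linear_0\<close>)
  then show ?thesis using assms(2) by blast
qed

subsection \<open>Gram--Schmidt projections\<close>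

text \<open>Projection onto the span of the first \<open>k\<close> vectors, rational in these
  vectors and therefore smooth in parameters. Since \<open>inverse 0 = 0\<close>, a dependent vector
  contributes nothing, and the algebraic facts hold for any family; independence enters only for
  smoothness.\<close>

primrec gs_proj :: "nat \<Rightarrow> (nat \<Rightarrow> 'a::real_inner) \<Rightarrow> 'a \<Rightarrow> 'a" where
  "gs_proj 0 t x = 0"
| "gs_proj (Suc k) t x = gs_proj k t x
     + (inner x (t k - gs_proj k t (t k)) * inverse (inner (t k - gs_proj k t (t k)) (t k - gs_proj k t (t k))))
        *\<^sub>R (t k - gs_proj k t (t k))"

lemma linear_gs_proj: "linear (gs_proj k t)"
proof (induction k)
  case (Suc k)
  show ?case
    by (rule linearI)
       (auto simp: linear_add[OF Suc] linear_scale[OF Suc] inner_add_left algebra_simps)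
qed (auto intro: linearI)

lemma gs_proj_in_span: "gs_proj k t x \<in> span (t ` {..<k})"
proof (induction k arbitrary: x)
  case (Suc k)
  have "t ` {..<k} \<subseteq> t ` {..<Suc k}" by auto
  then have "gs_proj k t y \<in> span (t ` {..<Suc k})" for y
    using Suc span_mono by blast
  then show ?case by (auto intro!: span_add span_scale span_diff intro: span_base)
qed simp

lemma gs_proj_orthogonal:
  "y \<in> span (t ` {..<k}) \<Longrightarrow> inner (x - gs_proj k t x) y = 0"
proof (induction k arbitrary: x y)
  case (Suc k)
  define u where "u = t k - gs_proj k t (t k)"
  have u: "inner u z = 0" "inner z u = 0" if "z \<in> span (t ` {..<k})" for z
    using Suc.IH[OF that, of "t k"] by (auto simp: u_def inner_commute)
  have x: "x - gs_proj (Suc k) t x = (x - gs_proj k t x) - (inner x u * inverse (inner u u)) *\<^sub>R u"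
    by (simp add: u_def[symmetric])
  have "inner (x - gs_proj (Suc k) t x) z = 0" if "z \<in> t ` {..<Suc k}" for z
  proof (cases "z \<in> t ` {..<k}")
    case True
    then have "z \<in> span (t ` {..<k})" by (rule span_base)
    then show ?thesis unfolding x inner_diff_left using Suc.IH[of z x] u by (simp add: inner_diff_left)
  next
    case False
    then have "z = t k" using that by (auto simp: less_Suc_eq)
    \<comment> \<open>\<open>t k\<close> is its Gram-Schmidt residue \<open>u\<close> plus a vector
      of the previous span; the new summand of the projection takes care of \<open>u\<close>, the
      induction hypothesis of the rest.\<close>
    then have z: "z = u + gs_proj k t (t k)" by (simp add: u_def)
    have "inner (x - gs_proj k t x) (gs_proj k t (t k)) = 0" by (rule Suc.IH[OF gs_proj_in_span])
    then have "inner (x - gs_proj (Suc k) t x) z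
        = inner x u - inner (gs_proj k t x) u - inner x u * inverse (inner u u) * inner u u
          - inner x u * inverse (inner u u) * inner u (gs_proj k t (t k))"
      unfolding x z by (simp add: inner_diff_left inner_add_right algebra_simps)
    also have "\<dots> = 0" using u[OF gs_proj_in_span] by (cases "u = 0") auto
    finally show ?thesis .
  qed
  then have "t ` {..<Suc k} \<subseteq> {z. inner (x - gs_proj (Suc k) t x) z = 0}" by blast
  then have "span (t ` {..<Suc k}) \<subseteq> {z. inner (x - gs_proj (Suc k) t x) z = 0}"
    by (rule span_minimal) (auto simp: subspace_def inner_add_right)
  then show ?case using Suc.prems by blast
qed simp

lemma gs_proj_fixes: "y \<in> span (t ` {..<k}) \<Longrightarrow> gs_proj k t y = y"
proof -
  assume "y \<in> span (t ` {..<k})"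
  then have "y - gs_proj k t y \<in> span (t ` {..<k})" by (intro span_diff gs_proj_in_span)
  then have "inner (y - gs_proj k t y) (y - gs_proj k t y) = 0" by (rule gs_proj_orthogonal)
  then show ?thesis by simp
qed

lemma gs_proj_self_adjoint: "inner (gs_proj k t x) y = inner x (gs_proj k t y)"
proof -
  have "inner x (gs_proj k t y) = inner (gs_proj k t x) (gs_proj k t y)" for x y
    using gs_proj_orthogonal[OF gs_proj_in_span, of x k t y] by (simp add: inner_diff_left)
  then show ?thesis by (metis inner_commute)
qed

lemma smooth_on_gs_proj:
  assumes U: "openin (top_of_set E) U" "subspace E"
    and t: "\<And>j. j < k \<Longrightarrow> smooth_on E (t j) U"
    and ind: "\<And>j q. j < k \<Longrightarrow> q \<in> U \<Longrightarrow> t j q \<notin> span ((\<lambda>i. t i q) ` {..<j})"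
    and y: "smooth_on E y U"
  shows "smooth_on E (\<lambda>q. gs_proj k (\<lambda>j. t j q) (y q)) U"
  using t ind y
proof (induction k arbitrary: y)
  case 0
  then show ?case by (simp add: smooth_on_const[OF U])
next
  case (Suc k)
  define u where "u q = t k q - gs_proj k (\<lambda>j. t j q) (t k q)" for q
  have IH: "smooth_on E (\<lambda>q. gs_proj k (\<lambda>j. t j q) (z q)) U" if "smooth_on E z U" for z
    using Suc.prems(1,2) that by (intro Suc.IH) auto
  have tk: "smooth_on E (t k) U" using Suc.prems(1) by simp
  have u: "smooth_on E u U" unfolding u_def by (intro smooth_on_diff[OF U] tk IH)
  have "u q \<noteq> 0" if "q \<in> U" for q
    using Suc.prems(2)[of k q] that gs_proj_in_span[of k "\<lambda>j. t j q" "t k q"] by (auto simp: u_def)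
  then have "smooth_on E (\<lambda>q. inverse (inner (u q) (u q))) U"
    by (intro smooth_on_inverse[OF U] smooth_on_inner[OF U] u) auto
  then have "smooth_on E (\<lambda>q. gs_proj k (\<lambda>j. t j q) (y q)
      + (inner (y q) (u q) * inverse (inner (u q) (u q))) *\<^sub>R u q) U"
    by (intro smooth_on_add[OF U] smooth_on_scaleR[OF U] smooth_on_mult[OF U] smooth_on_inner[OF U]
        IH Suc.prems(3) u)
  then show ?case by (simp add: u_def)
qed

subsection \<open>Charts at interior points\<close>

text \<open>A chart onto \<open>euc n\<close> instead of a half-space. It straightens a
  neighbourhood in \<open>euc N\<close>, so that besides \<open>\<Sigma>\<close> it carries the
  foliation by parallel slices, from which all smooth extensions off \<open>\<Sigma>\<close> are
  built.\<close>

locale slice =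
  fixes N n :: nat and \<Sigma> U V :: "fseq set" and \<Phi> \<Psi> :: "fseq \<Rightarrow> fseq"
  assumes nN: "n \<le> N" and sub: "\<Sigma> \<subseteq> euc N"
    and \<Phi>: "smooth_on (euc N) \<Phi> U" and \<Psi>: "smooth_on (euc N) \<Psi> V"
    and img: "\<Phi> ` U = V" and inv: "\<And>q. q \<in> U \<Longrightarrow> \<Psi> (\<Phi> q) = q"
    and slice: "\<Phi> ` (U \<inter> \<Sigma>) = V \<inter> euc n"
begin

abbreviation "E \<equiv> euc N"

lemmas E = subspace_euc[of N]
lemmas onb = orthonormal_basis_euc[of N]
lemmas U = smooth_on_openin[OF \<Phi>]
lemmas V = smooth_on_openin[OF \<Psi>]

lemma U_sub: "q \<in> U \<Longrightarrow> q \<in> E" using U by (auto dest: openin_imp_subset)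
lemma V_sub: "y \<in> V \<Longrightarrow> y \<in> E" using V by (auto dest: openin_imp_subset)

lemma inv': "y \<in> V \<Longrightarrow> \<Phi> (\<Psi> y) = y" using img inv by auto
lemma img': "y \<in> V \<Longrightarrow> \<Psi> y \<in> U" using img inv by auto
lemma \<Phi>_mem: "q \<in> U \<Longrightarrow> \<Phi> q \<in> V" using img by auto
lemma \<Psi>_slice: "y \<in> V \<Longrightarrow> y \<in> euc n \<Longrightarrow> \<Psi> y \<in> \<Sigma>"
proof -
  assume "y \<in> V" "y \<in> euc n"
  then obtain q where "q \<in> U \<inter> \<Sigma>" "y = \<Phi> q" using slice by blast
  then show ?thesis using inv by auto
qed

text \<open>The coordinate fields of the chart; for \<open>j < n\<close> they are tangent to the
  leaf through \<open>q\<close>, whether or not \<open>q\<close> lies on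
  \<open>\<Sigma>\<close>.\<close>

definition tvec :: "nat \<Rightarrow> fseq \<Rightarrow> fseq" where "tvec j q = dderiv E \<Psi> (\<Phi> q) (bas j)"

abbreviation "tspan q \<equiv> span ((\<lambda>j. tvec j q) ` {..<n})"

definition proj :: "fseq \<Rightarrow> fseq \<Rightarrow> fseq" where "proj q x = gs_proj n (\<lambda>j. tvec j q) x"

lemma tvec_mem: "q \<in> U \<Longrightarrow> j < N \<Longrightarrow> tvec j q \<in> E"
  unfolding tvec_def using dderiv_in_subspace[OF V E \<Phi>_mem _ \<Psi> onb] U_sub[OF img'] by simp

lemma smooth_tvec: "j < N \<Longrightarrow> smooth_on E (tvec j) U"
  unfolding tvec_def
  using smooth_on_compose[OF U E onb \<Phi> smooth_on_dderiv[OF \<Psi>]] img by auto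

lemma d\<Phi>_d\<Psi>: "q \<in> U \<Longrightarrow> W \<in> E \<Longrightarrow> dderiv E \<Phi> q (dderiv E \<Psi> (\<Phi> q) W) = W"
proof -
  assume q: "q \<in> U" and W: "W \<in> E"
  have "dderiv E (\<lambda>y. \<Phi> (\<Psi> y)) (\<Phi> q) W = dderiv E \<Phi> (\<Psi> (\<Phi> q)) (dderiv E \<Psi> (\<Phi> q) W)"
    using img' by (intro dderiv_compose[OF V E \<Phi>_mem[OF q] W \<Psi> \<Phi>]) auto
  moreover have "dderiv E (\<lambda>y. \<Phi> (\<Psi> y)) (\<Phi> q) W = W"
    using dderiv_cong[OF V \<Phi>_mem[OF q], of "\<lambda>y. \<Phi> (\<Psi> y)" "\<lambda>y. y"] inv'
      dderiv_id[OF V E \<Phi>_mem[OF q] W] by simp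
  ultimately show ?thesis using inv[OF q] by simp
qed

lemma d\<Psi>_d\<Phi>: "q \<in> U \<Longrightarrow> W \<in> E \<Longrightarrow> dderiv E \<Psi> (\<Phi> q) (dderiv E \<Phi> q W) = W"
proof -
  assume q: "q \<in> U" and W: "W \<in> E"
  have "dderiv E (\<lambda>y. \<Psi> (\<Phi> y)) q W = dderiv E \<Psi> (\<Phi> q) (dderiv E \<Phi> q W)"
    using img by (intro dderiv_compose[OF U E q W \<Phi> \<Psi>]) auto
  moreover have "dderiv E (\<lambda>y. \<Psi> (\<Phi> y)) q W = W"
    using dderiv_cong[OF U q, of "\<lambda>y. \<Psi> (\<Phi> y)" "\<lambda>y. y"] inv dderiv_id[OF U E q W] by simp
  ultimately show ?thesis by simp
qed

text \<open>The derivative of \<open>\<Phi>\<close> maps the coordinate fields to the unit vectors,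
  and \<open>bas j\<close> is not in \<open>euc j\<close>.\<close>

lemma tvec_independent:
  assumes q: "q \<in> U" and j: "j < n"
  shows "tvec j q \<notin> span ((\<lambda>i. tvec i q) ` {..<j})"
proof
  let ?D = "dderiv E \<Phi> q"
  have D: "?D (tvec i q) = bas i" if "i < N" for i
    unfolding tvec_def using d\<Phi>_d\<Psi>[OF q] that by simp
  have lin: "linear ?D" using linear_dderiv[OF U E q _ \<Phi>] subspace_0[OF E] by blast
  assume "tvec j q \<in> span ((\<lambda>i. tvec i q) ` {..<j})"
  then have "?D (tvec j q) \<in> ?D ` span ((\<lambda>i. tvec i q) ` {..<j})" by blast
  also have "\<dots> = span (?D ` (\<lambda>i. tvec i q) ` {..<j})" by (rule linear_span_image[OF lin, symmetric])
  also have "?D ` (\<lambda>i. tvec i q) ` {..<j} = bas ` {..<j}"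
    unfolding image_image using D j nN by (intro image_cong) auto
  finally have "bas j \<in> euc j"
    using D[of j] j nN orthonormal_basis_euc[of j] by (simp add: orthonormal_basis_def)
  then show False by simp
qed

lemma smooth_proj: "smooth_on E y U \<Longrightarrow> smooth_on E (\<lambda>q. proj q (y q)) U"
  unfolding proj_def using nN tvec_independent by (intro smooth_on_gs_proj[OF U E] smooth_tvec) auto

lemma linear_proj: "linear (proj q)"
  using linear_gs_proj[of n "\<lambda>j. tvec j q"] by (simp add: proj_def[abs_def])

lemma proj_idem: "proj q (proj q x) = proj q x"
  unfolding proj_def by (intro gs_proj_fixes gs_proj_in_span)

lemma proj_self_adjoint: "inner (proj q x) y = inner x (proj q y)"
  unfolding proj_def by (rule gs_proj_self_adjoint)

lemma proj_tvec: "j < n \<Longrightarrow> proj q (tvec j q) = tvec j q"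
  unfolding proj_def by (intro gs_proj_fixes span_base) auto

lemma proj_mem: "q \<in> U \<Longrightarrow> proj q x \<in> E"
proof -
  assume "q \<in> U"
  then have "tspan q \<subseteq> E"
    using tvec_mem nN by (intro span_minimal E) auto
  then show ?thesis unfolding proj_def using gs_proj_in_span by blast
qed

text \<open>In the chart, curves in \<open>\<Sigma>\<close> become curves in \<open>euc n\<close>,
  whose velocities stay in \<open>euc n\<close>. Conversely, coordinate lines through
  \<open>\<Phi> q\<close> realise every \<open>tvec j q\<close>.\<close>

lemma tangent_space_eq:
  assumes q: "q \<in> U" "q \<in> \<Sigma>"
  shows "tangent_space \<Sigma> q = tspan q"
proof
  have \<Phi>q: "\<Phi> q \<in> euc n" using q slice by blast
  have D\<Phi>: "(\<Phi> has_derivative dderiv E \<Phi> q) (at q within U)"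
    using smooth_on_has_derivative[OF \<Phi> q(1)] at_within_openin[OF U q(1)] by simp
  show "tangent_space \<Sigma> q \<subseteq> tspan q"
    unfolding tangent_space_def
  proof (rule span_minimal[OF subsetI subspace_span])
    fix v assume "v \<in> {v. \<exists>\<gamma>. \<gamma> 0 = q \<and> (\<forall>\<^sub>F t in at_right 0. \<gamma> t \<in> \<Sigma>)
        \<and> (\<gamma> has_vector_derivative v) (at_right 0)}"
    then obtain \<gamma> :: "real \<Rightarrow> fseq" where \<gamma>: "q = \<gamma> 0" "\<forall>\<^sub>F t in at_right 0. \<gamma> t \<in> \<Sigma>"
      "(\<gamma> has_vector_derivative v) (at_right 0)" by blast
    obtain O' where O: "open O'" "U = E \<inter> O'" using U by (auto simp: openin_open)
    have "continuous (at_right 0) \<gamma>" using \<gamma>(3) has_vector_derivative_continuous by blast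
    then have "(\<gamma> \<longlongrightarrow> \<gamma> 0) (at_right 0)" by (simp add: continuous_within)
    then have "\<forall>\<^sub>F t in at_right 0. \<gamma> t \<in> O'" using O q \<gamma>(1) by (intro topological_tendstoD) auto
    with \<gamma>(2) have ev: "\<forall>\<^sub>F t in at_right 0. \<gamma> t \<in> U \<and> \<gamma> t \<in> \<Sigma>"
      by eventually_elim (use O sub in auto)
    have vE: "v \<in> E"
      using \<gamma> sub q by (intro has_vector_derivative_in_subspace[OF \<gamma>(3) E closed_euc]) (auto elim: eventually_mono)
    have "((\<lambda>t. \<Phi> (\<gamma> t)) has_vector_derivative dderiv E \<Phi> q v) (at_right 0)"
      using ev by (intro has_derivative_along_curve[OF D\<Phi> \<gamma>(3)]) (auto simp: \<gamma>(1) elim: eventually_mono)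
    then have "dderiv E \<Phi> q v \<in> euc n"
    proof (rule has_vector_derivative_in_subspace[OF _ subspace_euc closed_euc])
      show "\<forall>\<^sub>F t in at_right 0. \<Phi> (\<gamma> t) \<in> euc n" using ev by eventually_elim (use slice in blast)
    qed (use \<Phi>q \<gamma>(1) in simp)
    then have "dderiv E \<Psi> (\<Phi> q) (dderiv E \<Phi> q v)
        = dderiv E \<Psi> (\<Phi> q) (\<Sum>j<n. coord (dderiv E \<Phi> q v) j *\<^sub>R bas j)"
      using euc_expand by metis
    also have "\<dots> = (\<Sum>j<n. coord (dderiv E \<Phi> q v) j *\<^sub>R tvec j q)"
      using linear_dderiv[OF V E \<Phi>_mem[OF q(1)] vE \<Psi>] by (simp add: linear_sum linear_scale tvec_def)
    finally have "v = (\<Sum>j<n. coord (dderiv E \<Phi> q v) j *\<^sub>R tvec j q)"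
      using d\<Psi>_d\<Phi>[OF q(1) vE] by simp
    moreover have "(\<Sum>j<n. coord (dderiv E \<Phi> q v) j *\<^sub>R tvec j q) \<in> tspan q"
      by (intro span_sum span_scale span_base) auto
    ultimately show "v \<in> tspan q" by simp
  qed
  show "tspan q \<subseteq> tangent_space \<Sigma> q"
    unfolding tangent_space_def
  proof (rule span_mono, safe)
    fix j assume "j < n"
    then have j: "bas j \<in> E" "bas j \<in> euc n" using nN by auto
    let ?\<gamma> = "\<lambda>t::real. \<Psi> (\<Phi> q + t *\<^sub>R bas j)"
    have ev: "\<forall>\<^sub>F t in at_right (0::real). \<Phi> q + t *\<^sub>R bas j \<in> V"
      using eventually_line_openin[OF V E \<Phi>_mem[OF q(1)] j(1)]
      by (auto simp: eventually_at_filter elim: eventually_mono)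
    have "(?\<gamma> has_vector_derivative dderiv E \<Psi> (\<Phi> q) (bas j)) (at_right 0)"
      using ev V_sub
      by (intro has_derivative_along_curve[OF smooth_on_has_derivative[OF \<Psi> \<Phi>_mem[OF q(1)]] line_has_vector_derivative])
         (auto elim: eventually_mono)
    moreover have "\<forall>\<^sub>F t in at_right 0. ?\<gamma> t \<in> \<Sigma>"
      using ev by eventually_elim
        (intro \<Psi>_slice subspace_add[OF subspace_euc] subspace_scale[OF subspace_euc] j(2) \<Phi>q)
    ultimately show "\<exists>\<gamma>. \<gamma> 0 = q \<and> (\<forall>\<^sub>F t in at_right 0. \<gamma> t \<in> \<Sigma>)
        \<and> (\<gamma> has_vector_derivative tvec j q) (at_right 0)"
      using inv[OF q(1)] by (intro exI[of _ ?\<gamma>]) (auto simp: tvec_def)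
  qed
qed

lemma tangent_space_range:
  assumes "q \<in> U" "q \<in> \<Sigma>"
  shows "tangent_space \<Sigma> q = range (proj q)"
  unfolding tangent_space_eq[OF assms] proj_def
  using gs_proj_in_span gs_proj_fixes by (metis (no_types, lifting) rangeI subsetI subset_antisym image_subsetI)

lemma tan_part_eq:
  assumes "q \<in> U" "q \<in> \<Sigma>"
  shows "tan_part \<Sigma> q x = proj q x"
  unfolding tan_part_def tangent_space_eq[OF assms] proj_def
proof (rule the_equality)
  let ?S = "tspan q"
  fix y assume y: "y \<in> ?S \<and> (\<forall>w\<in>?S. inner (x - y) w = 0)"
  have "gs_proj n (\<lambda>j. tvec j q) (x - y) = 0"
  proof -
    have "inner (gs_proj n (\<lambda>j. tvec j q) (x - y)) (gs_proj n (\<lambda>j. tvec j q) (x - y)) = 0"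
      using y gs_proj_in_span[of n "\<lambda>j. tvec j q"] by (subst gs_proj_self_adjoint) (simp add: gs_proj_fixes)
    then show ?thesis by simp
  qed
  then show "y = gs_proj n (\<lambda>j. tvec j q) x"
    using y by (simp add: linear_diff[OF linear_gs_proj] gs_proj_fixes)
qed (use gs_proj_in_span gs_proj_orthogonal in blast)

text \<open>The bridge between the intrinsic operators and calculus in \<open>E\<close>: in tangent
  directions the derivative within \<open>\<Sigma>\<close> can be computed from any smooth extension
  \<open>Y'\<close>.\<close>

lemma euclidean_deriv_eq:
  assumes q: "q \<in> U" "q \<in> \<Sigma>" and Y': "smooth_on E Y' U" "\<And>r. r \<in> U \<Longrightarrow> r \<in> \<Sigma> \<Longrightarrow> Y r = Y' r"
    and X: "X q \<in> range (proj q)"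
  shows "euclidean_deriv \<Sigma> X Y q = dderiv E Y' q (X q)"
proof -
  obtain O' where O: "open O'" "U = E \<inter> O'" using U by (auto simp: openin_open)
  obtain d where d: "d > 0" "ball q d \<subseteq> O'" using O q open_contains_ball by blast
  have "(Y' has_derivative dderiv E Y' q) (at q within \<Sigma>)"
    using smooth_on_has_derivative[OF Y'(1) q(1)] sub has_derivative_subset by blast
  then have "(Y has_derivative dderiv E Y' q) (at q within \<Sigma>)"
  proof (rule has_derivative_transform_within[OF _ d(1) q(2)])
    fix r assume "r \<in> \<Sigma>" "dist r q < d"
    then have "r \<in> U" using d(2) O(2) sub by (auto simp: dist_commute)
    then show "Y' r = Y r" using Y'(2) \<open>r \<in> \<Sigma>\<close> by simp
  qed
  then show ?thesis
    unfolding euclidean_deriv_def using X tangent_space_range[OF q]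
    by (intro has_derivative_unique_tangent) auto
qed

text \<open>Coordinate fields commute: both sides are the same second derivative of
  \<open>\<Psi>\<close>.\<close>

lemma dderiv_tvec_commute:
  assumes q: "q \<in> U" and jk: "j < n" "k < n"
  shows "dderiv E (tvec k) q (tvec j q) = dderiv E (tvec j) q (tvec k q)"
proof -
  have "dderiv E (tvec k) q (tvec j q) = dderiv E (\<lambda>y. dderiv E \<Psi> y (bas k)) (\<Phi> q) (bas j)"
    if "j < n" "k < n" for j k
  proof -
    have "dderiv E (\<lambda>q. dderiv E \<Psi> (\<Phi> q) (bas k)) q (tvec j q)
        = dderiv E (\<lambda>y. dderiv E \<Psi> y (bas k)) (\<Phi> q) (dderiv E \<Phi> q (tvec j q))"
      using that nN img by (intro dderiv_compose[OF U E q tvec_mem[OF q] \<Phi> smooth_on_dderiv[OF \<Psi>]]) auto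
    then show ?thesis
      using d\<Phi>_d\<Psi>[OF q, of "bas j"] that nN by (simp add: tvec_def[abs_def])
  qed
  then show ?thesis
    using jk nN dderiv_commute[OF \<Psi> E _ _ \<Phi>_mem[OF q], of "bas k" "bas j"] by simp
qed

end

text \<open>At an interior point every chart has a nonzero, hence positive, zeroth coordinate.
  Restricting to the open half-space \<open>H\<close> makes \<open>half_euc n\<close> and
  \<open>euc n\<close> indistinguishable.\<close>

lemma interior_slice:
  assumes M: "embedded_submanifold N n \<Sigma>" and p: "p \<in> \<Sigma>" "p \<notin> mfd_boundary N n \<Sigma>" and n: "n \<ge> 1"
  shows "\<exists>U V \<Phi> \<Psi>. slice N n \<Sigma> U V \<Phi> \<Psi> \<and> p \<in> U"
proof -
  obtain U \<Phi> where U: "p \<in> U" "slice_chart N n \<Sigma> U \<Phi>"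
    using M p by (auto simp: embedded_submanifold_def)
  then obtain V \<Psi> where c: "smooth_on (euc N) \<Phi> U" "\<Phi> ` U = V" "smooth_on (euc N) \<Psi> V"
    "\<forall>x\<in>U. \<Psi> (\<Phi> x) = x" "\<Phi> ` (U \<inter> \<Sigma>) = V \<inter> half_euc n"
    by (auto simp: slice_chart_def diffeomorphism_def)
  define H where "H = {y. 0 < coord y 0}"
  have "H = {y. 0 < inner y (bas 0)}" by (simp add: H_def)
  moreover have "open {y. 0 < inner y (bas 0)}" by (intro open_Collect_less continuous_intros)
  ultimately have H: "open H" by simp
  have "coord (\<Phi> p) 0 \<noteq> 0" using U p by (auto simp: mfd_boundary_def)
  moreover have "\<Phi> p \<in> half_euc n" using U p c(5) by blast
  ultimately have pH: "\<Phi> p \<in> H" by (auto simp: H_def half_euc_def)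
  define U' V' where "U' = U \<inter> \<Phi> -` H" and "V' = V \<inter> H"
  have oU: "openin (top_of_set (euc N)) U'"
  proof -
    have "openin (top_of_set U) U'"
      unfolding U'_def using smooth_on_continuous_on[OF c(1)] H by (rule continuous_openin_preimage_gen)
    then show ?thesis using smooth_on_openin[OF c(1)] openin_trans by blast
  qed
  have oV: "openin (top_of_set (euc N)) V'"
    unfolding V'_def using smooth_on_openin[OF c(3)] H by (metis openin_Int_open)
  have "slice N n \<Sigma> U' V' \<Phi> \<Psi>"
  proof
    show "smooth_on (euc N) \<Phi> U'" using smooth_on_subset[OF c(1) oU] by (auto simp: U'_def)
    show "smooth_on (euc N) \<Psi> V'" using smooth_on_subset[OF c(3) oV] by (auto simp: V'_def)
    show "\<Phi> ` U' = V'" using c(2) by (auto simp: U'_def V'_def)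
    have "\<Phi> ` (U' \<inter> \<Sigma>) = \<Phi> ` (U \<inter> \<Sigma>) \<inter> H" by (auto simp: U'_def)
    also have "\<dots> = V' \<inter> euc n" unfolding c(5) by (auto simp: V'_def H_def half_euc_def)
    finally show "\<Phi> ` (U' \<inter> \<Sigma>) = V' \<inter> euc n" .
  qed (use M c(4) in \<open>auto simp: embedded_submanifold_def U'_def\<close>)
  then show ?thesis using U(1) pH by (auto simp: U'_def)
qed

subsection \<open>A convex cutoff function\<close>

text \<open>In the variable \<open>y = 1 / (c - s)\<close> all derivatives of \<open>exp (- a / (c - s))\<close> have the form
  \<open>p y * exp (- a y)\<close> with a polynomial \<open>p\<close>, and \<open>dy / ds = y\<^sup>2\<close>.\<close>

definition cutoff_poly :: "real \<Rightarrow> real \<Rightarrow> real poly \<Rightarrow> real \<Rightarrow> real" where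
  "cutoff_poly a c p s = (if s < c then poly p (1 / (c - s)) * exp (- a * (1 / (c - s))) else 0)"

definition cutoff_step :: "real \<Rightarrow> real poly \<Rightarrow> real poly" where
  "cutoff_step a p = monom 1 2 * (pderiv p - smult a p)"

lemma poly_exp_tendsto_0:
  assumes "a > (0::real)"
  shows "((\<lambda>y. poly q y * exp (- a * y)) \<longlongrightarrow> 0) at_top"
proof -
  have "((\<lambda>y. y ^ i * exp (- a * y)) \<longlongrightarrow> 0) at_top" for i
  proof -
    have "filterlim (\<lambda>y. a * y) at_top at_top"
      by (rule filterlim_tendsto_pos_mult_at_top[OF tendsto_const assms filterlim_ident])
    then have "((\<lambda>y. (a * y) ^ i / exp (a * y)) \<longlongrightarrow> 0) at_top"
      by (rule filterlim_compose[OF tendsto_power_div_exp_0])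
    then have "((\<lambda>y. (1 / a ^ i) * ((a * y) ^ i / exp (a * y))) \<longlongrightarrow> (1 / a ^ i) * 0) at_top"
      by (intro tendsto_mult tendsto_const)
    then show ?thesis using assms by (simp add: power_mult_distrib exp_minus field_simps)
  qed
  then have "((\<lambda>y. \<Sum>i\<le>degree q. coeff q i * (y ^ i * exp (- a * y))) \<longlongrightarrow> (\<Sum>i\<le>degree q. coeff q i * 0)) at_top"
    by (intro tendsto_sum tendsto_mult tendsto_const)
  then show ?thesis by (simp add: poly_altdef sum_distrib_right mult.assoc)
qed

lemma cutoff_poly_has_derivative:
  assumes a: "a > 0"
  shows "(cutoff_poly a c p has_real_derivative cutoff_poly a c (cutoff_step a p) s) (at s)"
proof -
  let ?f = "cutoff_poly a c p"
  consider "s < c" | "s > c" | "s = c" by linarith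
  then show ?thesis
  proof cases
    case 1
    have "((\<lambda>s. poly p (1 / (c - s)) * exp (- a * (1 / (c - s)))) has_real_derivative
        cutoff_poly a c (cutoff_step a p) s) (at s)"
      using 1 by (auto intro!: derivative_eq_intros simp: cutoff_poly_def cutoff_step_def poly_monom
          power2_eq_square field_simps)
    then show ?thesis
      using 1 by (rule_tac has_field_derivative_transform_within_open[of _ _ _ "{..<c}"])
        (auto simp: cutoff_poly_def)
  next
    case 2
    have "((\<lambda>s. 0) has_real_derivative 0) (at s)" by simp
    then have "(?f has_real_derivative 0) (at s)"
      using 2 by (rule_tac has_field_derivative_transform_within_open[of _ _ _ "{c<..}"])
        (auto simp: cutoff_poly_def)
    then show ?thesis using 2 by (simp add: cutoff_poly_def)
  next
    case 3
    have lim: "((\<lambda>t. (?f t - ?f c) / (t - c)) \<longlongrightarrow> 0) (at_left c)"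
    proof -
      have "filterlim (\<lambda>t. c - t) (at_right 0) (at_left c)"
        by (auto simp: filterlim_at eventually_at_filter intro!: tendsto_eq_intros)
      then have "filterlim (\<lambda>t. 1 / (c - t)) at_top (at_left c)"
        using filterlim_compose[OF filterlim_inverse_at_top_right] by (simp add: inverse_eq_divide)
      \<comment> \<open>With \<open>y = 1 / (c - t)\<close> the difference quotient at
        \<open>c\<close> is \<open>- y * poly p y * exp (- a * y)\<close>; \<open>pCons 0 p\<close>
        is \<open>p\<close> times the variable.\<close>
      then have "((\<lambda>t. poly (- pCons 0 p) (1 / (c - t)) * exp (- a * (1 / (c - t)))) \<longlongrightarrow> 0) (at_left c)"
        by (rule filterlim_compose[OF poly_exp_tendsto_0[OF a]])
      then show ?thesis
      proof (rule Lim_transform_eventually)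
        show "\<forall>\<^sub>F t in at_left c. poly (- pCons 0 p) (1 / (c - t)) * exp (- a * (1 / (c - t)))
            = (?f t - ?f c) / (t - c)"
          by (auto simp: eventually_at_filter cutoff_poly_def divide_simps algebra_simps)
      qed
    qed
    have "((\<lambda>t. (?f t - ?f c) / (t - c)) \<longlongrightarrow> 0) (at_right c)"
      by (rule Lim_transform_eventually[OF tendsto_const]) (auto simp: eventually_at_filter cutoff_poly_def)
    with lim have "((\<lambda>t. (?f t - ?f c) / (t - c)) \<longlongrightarrow> 0) (at c)"
      by (simp add: filterlim_at_split)
    then show ?thesis using 3 by (simp add: has_field_derivative_iff cutoff_poly_def)
  qed
qed

text \<open>\<open>k\<close> is the order of the derivative. The parameter \<open>2 * c\<close> is
  the smallest one for which the function is convex on [0, c); compare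
  \<open>cutoff_2\<close>.\<close>

definition cutoff :: "real \<Rightarrow> nat \<Rightarrow> real \<Rightarrow> real" where
  "cutoff c k = cutoff_poly (2 * c) c ((cutoff_step (2 * c) ^^ k) 1)"

lemma cutoff_has_derivative:
  "c > 0 \<Longrightarrow> (cutoff c k has_real_derivative cutoff c (Suc k) s) (at s)"
  unfolding cutoff_def by (simp add: cutoff_poly_has_derivative)

lemma cutoff_0: "cutoff c 0 s = (if s < c then exp (- (2 * c / (c - s))) else 0)"
  by (simp add: cutoff_def cutoff_poly_def)

lemma cutoff_Suc_0: "s < c \<Longrightarrow> cutoff c (Suc 0) s = - (2 * c / (c - s)\<^sup>2) * cutoff c 0 s"
  by (simp add: cutoff_def cutoff_poly_def cutoff_step_def poly_monom field_simps)

lemma cutoff_2: "s < c \<Longrightarrow> cutoff c (Suc (Suc 0)) s = (4 * c * s / (c - s) ^ 4) * cutoff c 0 s"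
proof -
  assume s: "s < c"
  define y where "y = 1 / (c - s)"
  have ys: "y * (c - s) = 1" using s by (simp add: y_def)
  have "cutoff c (Suc (Suc 0)) s = y\<^sup>2 * (- 4 * c * y + 4 * c\<^sup>2 * y\<^sup>2) * cutoff c 0 s"
    using s by (simp add: cutoff_def cutoff_poly_def cutoff_step_def poly_monom pderiv_mult pderiv_smult
        pderiv_monom pderiv_diff pderiv_minus algebra_simps power2_eq_square y_def[symmetric])
  \<comment> \<open>Homogenising the cubic term by \<open>1 = y * (c - s)\<close> leaves the factor
    \<open>c - (c - s) = s\<close>.\<close>
  also have "y\<^sup>2 * (- 4 * c * y + 4 * c\<^sup>2 * y\<^sup>2) = 4 * c * s * y ^ 4"
    using ys by algebra
  finally show ?thesis by (simp add: y_def power_divide)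
qed

lemma cutoff_beyond: "c \<le> s \<Longrightarrow> cutoff c k s = 0"
  by (simp add: cutoff_def cutoff_poly_def)

lemma smooth_on_cutoff: "c > 0 \<Longrightarrow> smooth_on UNIV (cutoff c k) UNIV"
  by (rule smooth_on_real_sequence) (rule cutoff_has_derivative)

text \<open>For \<open>s \<ge> 2 n\<close> every term is nonnegative, and for \<open>s < 2 n\<close> the logarithmic derivative of the cutoff is small.\<close>

lemma cutoff_second_variation_pos:
  assumes n: "m \<le> n" "n \<ge> (1::real)" "c \<ge> 16 * n" and s: "0 \<le> s" "s < c" and t: "0 \<le> t"
  shows "0 < cutoff c 0 s / 2 + (4 * cutoff c (Suc (Suc 0)) s * t + cutoff c (Suc 0) s * (2 * m - s))"
proof -
  have c: "c > 0" using n by linarith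
  have g: "cutoff c 0 s > 0" using s by (simp add: cutoff_0)
  have 1: "4 * cutoff c (Suc (Suc 0)) s * t \<ge> 0"
    unfolding cutoff_2[OF s(2)] using g s t c by simp
  have 2: "2 * c / (c - s)\<^sup>2 * (2 * m - s) < 1 / 2"
  proof (cases "2 * n \<le> s")
    case True
    then have "2 * c / (c - s)\<^sup>2 * (2 * m - s) \<le> 0" using n c by (intro mult_nonneg_nonpos) auto
    then show ?thesis by linarith
  next
    case False
    have "2 * c / (c - s)\<^sup>2 * (2 * m - s) \<le> 2 * c / (c - s)\<^sup>2 * (2 * n)"
      using c n s by (intro mult_left_mono) auto
    also have "\<dots> < 1 / 2"
    proof -
      \<comment> \<open>The claim is \<open>8 * (c * n) < (c - s)\<^sup>2\<close>. Since
        \<open>s < 2 * n \<le> c / 8\<close>, the right-hand side exceeds 49/64 of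
        \<open>c\<^sup>2\<close>, and \<open>c\<^sup>2 \<ge> 16 * (c * n)\<close>.\<close>
      have "c - s > 14 / 16 * c" using False n by linarith
      then have "(c - s)\<^sup>2 > (14 / 16 * c)\<^sup>2" using c by (intro power_strict_mono) auto
      moreover have "(14 / 16 * c)\<^sup>2 \<ge> 8 * (c * n)"
      proof -
        have "c * (16 * n) \<le> c * c" using n c by (intro mult_left_mono) auto
        then have "16 * (c * n) \<le> c * c" by simp
        moreover have "0 \<le> c * c" by simp
        ultimately have "8 * (c * n) \<le> 14 / 16 * (14 / 16) * (c * c)" by linarith
        then show ?thesis by (simp add: power2_eq_square)
      qed
      ultimately have "(c - s)\<^sup>2 > 8 * (c * n)" by linarith
      then show ?thesis using s by (simp add: field_simps)
    qed
    finally show ?thesis .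
  qed
  have "cutoff c 0 s / 2 + cutoff c (Suc 0) s * (2 * m - s)
      = cutoff c 0 s * (1 / 2 - 2 * c / (c - s)\<^sup>2 * (2 * m - s))"
    unfolding cutoff_Suc_0[OF s(2)] by (simp add: algebra_simps)
  also have "\<dots> > 0" using g 2 by simp
  finally show ?thesis using 1 by linarith
qed

subsection \<open>Fields of orthogonal projections\<close>

lemma linear_sum_bas:
  assumes "linear f" "y \<in> euc N"
  shows "f y = (\<Sum>i<N. coord y i *\<^sub>R f (bas i))"
  by (subst euc_expand[OF assms(2)]) (simp add: linear_sum[OF assms(1)] linear_scale[OF assms(1)])

text \<open>Product rule for a family of linear maps applied to a moving vector: expanding the
  vector in coordinates leaves only the constant arguments \<open>bas i\<close>.\<close>

lemma
  fixes F :: "fseq \<Rightarrow> fseq \<Rightarrow> 'b::real_normed_vector"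
  assumes U: "openin (top_of_set (euc N)) U" and lin: "\<And>q. q \<in> U \<Longrightarrow> linear (F q)"
    and F: "\<And>i. i < N \<Longrightarrow> smooth_on (euc N) (\<lambda>q. F q (bas i)) U"
    and y: "smooth_on (euc N) y U" "\<And>q. q \<in> U \<Longrightarrow> y q \<in> euc N"
  shows smooth_on_family: "smooth_on (euc N) (\<lambda>q. F q (y q)) U"
    and dderiv_family: "p \<in> U \<Longrightarrow> W \<in> euc N \<Longrightarrow> dderiv (euc N) (\<lambda>q. F q (y q)) p W
      = dderiv (euc N) (\<lambda>q. F q (y p)) p W + F p (dderiv (euc N) y p W)"
proof -
  let ?E = "euc N"
  note E = subspace_euc[of N]
  have c: "smooth_on ?E (\<lambda>q. coord (z q) i) U" if "smooth_on ?E z U" for z i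
    using smooth_on_linear_compose[OF U E bounded_linear_inner_left[of "bas i"] that] by simp
  have dc: "dderiv ?E (\<lambda>q. coord (z q) i) p W = coord (dderiv ?E z p W) i"
    if "smooth_on ?E z U" "p \<in> U" "W \<in> ?E" for z i p W
    using dderiv_linear[OF U E that(2,3) bounded_linear_inner_left[of "bas i"] that(1)] by simp
  have eq: "F q z = (\<Sum>i<N. coord z i *\<^sub>R F q (bas i))" if "q \<in> U" "z \<in> ?E" for q z
    using linear_sum_bas[OF lin] that by blast
  have sm: "smooth_on ?E (\<lambda>q. \<Sum>i<N. coord (z q) i *\<^sub>R F q (bas i)) U" if "smooth_on ?E z U" for z
    using F that by (intro smooth_on_sum[OF U E] smooth_on_scaleR[OF U E] c) auto
  have d: "dderiv ?E (\<lambda>q. F q (z q)) p W = (\<Sum>i<N. coord (z p) i *\<^sub>R dderiv ?E (\<lambda>q. F q (bas i)) p W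
      + coord (dderiv ?E z p W) i *\<^sub>R F p (bas i))"
    if z: "smooth_on ?E z U" "\<And>q. q \<in> U \<Longrightarrow> z q \<in> ?E" and p: "p \<in> U" "W \<in> ?E" for z p W
  proof -
    have "dderiv ?E (\<lambda>q. F q (z q)) p W = dderiv ?E (\<lambda>q. \<Sum>i<N. coord (z q) i *\<^sub>R F q (bas i)) p W"
      using z(2) by (intro fun_cong[OF dderiv_cong[OF U p(1)]] eq) auto
    also have "dderiv ?E (\<lambda>q. \<Sum>i<N. coord (z q) i *\<^sub>R F q (bas i)) p W
        = (\<Sum>i<N. dderiv ?E (\<lambda>q. coord (z q) i *\<^sub>R F q (bas i)) p W)"
      using F by (intro dderiv_sum[OF U E p] smooth_on_scaleR[OF U E] c z(1)) auto
    also have "\<dots> = (\<Sum>i<N. coord (z p) i *\<^sub>R dderiv ?E (\<lambda>q. F q (bas i)) p W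
        + coord (dderiv ?E z p W) i *\<^sub>R F p (bas i))"
      using dderiv_scaleR[OF U E p c[OF z(1)] F] by (intro sum.cong) (auto simp: dc[OF z(1) p])
    finally show ?thesis .
  qed
  show "smooth_on ?E (\<lambda>q. F q (y q)) U"
    using sm[OF y(1)] by (rule smooth_on_cong) (use eq y(2) in simp)
  assume p: "p \<in> U" "W \<in> ?E"
  have "dderiv ?E (\<lambda>q. F q (y p)) p W = (\<Sum>i<N. coord (y p) i *\<^sub>R dderiv ?E (\<lambda>q. F q (bas i)) p W)"
    using d[OF smooth_on_const[OF U E, of "y p"] _ p] y(2)[OF p(1)] dderiv_const[OF U E p, of "y p"] by simp
  moreover have "F p (dderiv ?E y p W) = (\<Sum>i<N. coord (dderiv ?E y p W) i *\<^sub>R F p (bas i))"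
    using dderiv_in_subspace[OF U E p y(1) orthonormal_basis_euc y(2)] by (intro eq p) simp
  ultimately show "dderiv ?E (\<lambda>q. F q (y q)) p W = dderiv ?E (\<lambda>q. F q (y p)) p W + F p (dderiv ?E y p W)"
    using d[OF y p] by (simp add: sum.distrib)
qed

locale projection_field =
  fixes N :: nat and U :: "fseq set" and P :: "fseq \<Rightarrow> fseq \<Rightarrow> fseq"
  assumes U: "openin (top_of_set (euc N)) U"
    and lin: "linear (P q)"
    and mem: "q \<in> U \<Longrightarrow> P q x \<in> euc N"
    and idem: "P q (P q x) = P q x"
    and self_adjoint: "inner (P q x) y = inner x (P q y)"
    and smooth: "smooth_on (euc N) f U \<Longrightarrow> smooth_on (euc N) (\<lambda>q. P q (f q)) U"
begin

abbreviation "E \<equiv> euc N"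

lemmas E = subspace_euc[of N]

text \<open>The derivative of \<open>P\<close> at \<open>q\<close> in direction \<open>X\<close>,
  applied to \<open>y\<close>. Writing it through partial derivatives at unit vectors makes it
  bilinear in all arguments, also off \<open>E\<close>, where the derivative itself is
  uncontrolled.\<close>

definition DP :: "fseq \<Rightarrow> fseq \<Rightarrow> fseq \<Rightarrow> fseq" where
  "DP q X y = (\<Sum>i<N. coord X i *\<^sub>R (\<Sum>k<N. coord y k *\<^sub>R dderiv E (\<lambda>r. P r (bas k)) q (bas i)))"

definition D2P :: "fseq \<Rightarrow> fseq \<Rightarrow> fseq \<Rightarrow> fseq \<Rightarrow> fseq" where
  "D2P q W X y = dderiv E (\<lambda>r. DP r X y) q W"

lemma linear_DP: "linear (DP q X)"
  by (rule linearI) (simp_all add: DP_def scaleR_add_left sum.distrib scaleR_add_right scaleR_sum_right mult_ac)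

lemma linear_DP_left: "linear (\<lambda>X. DP q X y)"
  by (rule linearI)
     (simp_all add: DP_def scaleR_sum_right distrib_right scaleR_add_left sum.distrib mult.assoc)

lemmas lins = linear_add linear_diff linear_scale linear_0 linear_neg

lemma U_sub: "q \<in> U \<Longrightarrow> q \<in> E" using U by (auto dest: openin_imp_subset)

lemma smooth_P: "smooth_on E (\<lambda>q. P q x) U"
  by (intro smooth smooth_on_const[OF U E])

lemma smooth_coord: "smooth_on E f U \<Longrightarrow> smooth_on E (\<lambda>q. coord (f q) i) U"
  using smooth_on_linear_compose[OF U E bounded_linear_inner_left[of "bas i"]] by simp

lemma smooth_DP: "smooth_on E X U \<Longrightarrow> smooth_on E y U \<Longrightarrow> smooth_on E (\<lambda>q. DP q (X q) (y q)) U"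
  unfolding DP_def
  by (intro smooth_on_sum[OF U E] smooth_on_scaleR[OF U E] smooth_coord smooth_on_dderiv smooth_P) auto

lemma smooth_DP_const: "smooth_on E (\<lambda>q. DP q X y) U"
  by (intro smooth_DP smooth_on_const[OF U E])

lemma DP_eq:
  assumes q: "q \<in> U" and "X \<in> E" "y \<in> E"
  shows "dderiv E (\<lambda>r. P r y) q X = DP q X y"
proof -
  have "dderiv E (\<lambda>r. P r y) q X = (\<Sum>i<N. coord X i *\<^sub>R dderiv E (\<lambda>r. P r y) q (bas i))"
    by (intro linear_sum_bas linear_dderiv[OF U E q \<open>X \<in> E\<close> smooth_P] assms)
  also have "\<dots> = DP q X y"
    unfolding DP_def
  proof (rule sum.cong)
    fix i assume "i \<in> {..<N}"
    then have i: "bas i \<in> E" by simp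
    have "dderiv E (\<lambda>r. P r y) q = dderiv E (\<lambda>r. \<Sum>k<N. coord y k *\<^sub>R P r (bas k)) q"
      using linear_sum_bas[OF lin assms(3)] by simp
    then show "coord X i *\<^sub>R dderiv E (\<lambda>r. P r y) q (bas i) =
        coord X i *\<^sub>R (\<Sum>k<N. coord y k *\<^sub>R dderiv E (\<lambda>r. P r (bas k)) q (bas i))"
      by (simp add: dderiv_sum[OF U E q i] dderiv_linear[OF U E q i bounded_linear_scaleR_right]
          smooth_P smooth_on_linear_compose[OF U E bounded_linear_scaleR_right])
  qed simp
  finally show ?thesis .
qed

lemma dderiv_P:
  assumes "p \<in> U" "W \<in> E" "smooth_on E y U" "\<And>q. q \<in> U \<Longrightarrow> y q \<in> E"
  shows "dderiv E (\<lambda>q. P q (y q)) p W = DP p W (y p) + P p (dderiv E y p W)"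
  using dderiv_family[OF U lin smooth_P assms(3,4,1,2)] DP_eq[OF assms(1,2)] assms(1,4) by simp

lemma DP_mem: "p \<in> U \<Longrightarrow> X \<in> E \<Longrightarrow> y \<in> E \<Longrightarrow> DP p X y \<in> E"
  using dderiv_in_subspace[OF U E _ _ smooth_P orthonormal_basis_euc mem] DP_eq by metis

lemma dderiv_DP:
  assumes p: "p \<in> U" "W \<in> E" and X: "smooth_on E X U" "\<And>q. q \<in> U \<Longrightarrow> X q \<in> E"
    and y: "smooth_on E y U" "\<And>q. q \<in> U \<Longrightarrow> y q \<in> E"
  shows "dderiv E (\<lambda>q. DP q (X q) (y q)) p W
    = D2P p W (X p) (y p) + DP p (dderiv E X p W) (y p) + DP p (X p) (dderiv E y p W)"
proof -
  have "dderiv E (\<lambda>q. DP q (X q) (y q)) p W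
      = dderiv E (\<lambda>q. DP q (X q) (y p)) p W + DP p (X p) (dderiv E y p W)"
    using X y p by (intro dderiv_family[OF U linear_DP smooth_DP]) (auto intro: smooth_on_const[OF U E])
  also have "dderiv E (\<lambda>q. DP q (X q) (y p)) p W = D2P p W (X p) (y p) + DP p (dderiv E X p W) (y p)"
    unfolding D2P_def using X p
    by (intro dderiv_family[OF U linear_DP_left smooth_DP]) (auto intro: smooth_on_const[OF U E])
  finally show ?thesis .
qed

lemma linear_D2P: "p \<in> U \<Longrightarrow> W \<in> E \<Longrightarrow> linear (D2P p W X)"
  unfolding D2P_def
  by (rule linearI) (simp_all add: lins[OF linear_DP] dderiv_add[OF U E] smooth_DP_const
      dderiv_linear[OF U E _ _ bounded_linear_scaleR_right])

lemma linear_D2P_left: "p \<in> U \<Longrightarrow> W \<in> E \<Longrightarrow> linear (\<lambda>X. D2P p W X y)"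
  unfolding D2P_def
  by (rule linearI) (simp_all add: lins[OF linear_DP_left] dderiv_add[OF U E] smooth_DP_const
      dderiv_linear[OF U E _ _ bounded_linear_scaleR_right])

lemma D2P_commute:
  assumes p: "p \<in> U" and "W \<in> E" "X \<in> E" "y \<in> E"
  shows "D2P p W X y = D2P p X W y"
proof -
  have "D2P p W X y = dderiv E (\<lambda>r. dderiv E (\<lambda>r. P r y) r X) p W" if "W \<in> E" "X \<in> E" for W X
    unfolding D2P_def using dderiv_cong[OF U p, of "\<lambda>r. DP r X y"] DP_eq that assms(4) by metis
  then show ?thesis using dderiv_commute[OF smooth_P E _ _ p] assms by simp
qed

text \<open>Differentiated idempotence of \<open>P\<close>. It means that \<open>DP p X\<close> maps
  tangent vectors to normal ones and normal vectors to tangent ones.\<close>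

lemma DP_split:
  assumes "p \<in> U" "X \<in> E" "y \<in> E"
  shows "DP p X (P p y) + P p (DP p X y) = DP p X y"
  using dderiv_P[OF assms(1,2) smooth_P mem, of y] DP_eq assms by (simp add: idem)

lemma Q_DP: "p \<in> U \<Longrightarrow> X \<in> E \<Longrightarrow> y \<in> E \<Longrightarrow> DP p X y - P p (DP p X y) = DP p X (P p y)"
  using DP_split[of p X y] by (simp add: algebra_simps)

lemma P_DP_tangent: "p \<in> U \<Longrightarrow> X \<in> E \<Longrightarrow> y \<in> E \<Longrightarrow> P p y = y \<Longrightarrow> P p (DP p X y) = 0"
  using DP_split[of p X y] by simp

lemma P_DP_normal: "p \<in> U \<Longrightarrow> X \<in> E \<Longrightarrow> y \<in> E \<Longrightarrow> P p y = 0 \<Longrightarrow> P p (DP p X y) = DP p X y"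
  using DP_split[of p X y] by (simp add: lins[OF linear_DP])

lemma DP_self_adjoint:
  assumes p: "p \<in> U" and "X \<in> E" "y \<in> E" "z \<in> E"
  shows "inner (DP p X y) z = inner y (DP p X z)"
proof -
  have "dderiv E (\<lambda>q. inner (P q y) z) p X = dderiv E (\<lambda>q. inner y (P q z)) p X"
    by (simp add: self_adjoint)
  moreover have "dderiv E (\<lambda>q. inner (P q y) z) p X = inner (DP p X y) z"
    using dderiv_linear[OF U E p assms(2) bounded_linear_inner_left smooth_P] DP_eq[OF p assms(2,3)] by simp
  moreover have "dderiv E (\<lambda>q. inner y (P q z)) p X = inner y (DP p X z)"
    using dderiv_linear[OF U E p assms(2) bounded_linear_inner_right smooth_P] DP_eq[OF p assms(2,4)] by simp
  ultimately show ?thesis by simp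
qed

text \<open>Exchanges a trace over a tangent basis, which is chosen anew at each point, for a sum
  over the ambient basis, which depends smoothly on the point.\<close>

lemma trace_P:
  assumes p: "p \<in> U" and B: "orthonormal_basis (range (P p)) B"
    and \<beta>: "\<And>y. linear (\<beta> y)" "\<And>z. linear (\<lambda>y. \<beta> y z)"
  shows "(\<Sum>i<N. \<beta> (bas i) (P p (bas i))) = (\<Sum>e\<in>B. \<beta> e e)"
proof -
  have e: "e \<in> E" "P p e = e" if "e \<in> B" for e
    using orthonormal_basis_mem[OF B that] mem[OF p] idem by auto
  have "P p (bas i) = (\<Sum>e\<in>B. coord e i *\<^sub>R e)" for i
    by (subst orthonormal_basis_expand[OF B, of "P p (bas i)"])
       (auto simp: self_adjoint e intro!: sum.cong)
  then have "(\<Sum>i<N. \<beta> (bas i) (P p (bas i))) = (\<Sum>i<N. \<Sum>e\<in>B. coord e i *\<^sub>R \<beta> (bas i) e)"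
    by (simp add: linear_sum[OF \<beta>(1)] linear_scale[OF \<beta>(1)])
  also have "\<dots> = (\<Sum>e\<in>B. \<Sum>i<N. coord e i *\<^sub>R \<beta> (bas i) e)" by (rule sum.swap)
  also have "\<dots> = (\<Sum>e\<in>B. \<beta> e e)"
    using e by (intro sum.cong refl linear_sum_bas[OF \<beta>(2), symmetric])
  finally show ?thesis .
qed

end

text \<open>The added assumption is the symmetry of the second fundamental form of the distribution
  \<open>range (P q)\<close>, that is, its Frobenius integrability.\<close>

locale integrable_field = projection_field +
  assumes DP_commute: "q \<in> U \<Longrightarrow> y \<in> E \<Longrightarrow> z \<in> E \<Longrightarrow> DP q (P q y) (P q z) = DP q (P q z) (P q y)"
begin

text \<open>On tangent vectors this is the covariant derivative of the second fundamental form.\<close>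

definition DA :: "fseq \<Rightarrow> fseq \<Rightarrow> fseq \<Rightarrow> fseq \<Rightarrow> fseq" where
  "DA p W Y Z = (D2P p W Y Z + DP p (DP p W Y) Z) - P p (D2P p W Y Z + DP p (DP p W Y) Z)"

text \<open>The symmetry \<open>DP_commute\<close> is differentiated along \<open>W\<close>. The
  terms \<open>DP p Y (DP p W Z)\<close> are tangential, because \<open>DP p W Z\<close> is normal,
  and drop out of the normal part.\<close>

lemma DA_swap_right:
  assumes p: "p \<in> U" and t: "W \<in> range (P p)" "Y \<in> range (P p)" "Z \<in> range (P p)"
  shows "DA p W Y Z = DA p W Z Y"
proof -
  have tE: "P p W = W" "P p Y = Y" "P p Z = Z" "W \<in> E" "Y \<in> E" "Z \<in> E"
    using t mem[OF p] idem by auto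
  have d: "dderiv E (\<lambda>q. P q y) p W = DP p W y" if "y \<in> E" for y using DP_eq p tE that by simp
  have "dderiv E (\<lambda>q. DP q (P q Y) (P q Z)) p W = dderiv E (\<lambda>q. DP q (P q Z) (P q Y)) p W"
    using tE by (intro fun_cong[OF dderiv_cong[OF U p]] DP_commute)
  then have eq: "D2P p W Y Z + DP p (DP p W Y) Z + DP p Y (DP p W Z)
      = D2P p W Z Y + DP p (DP p W Z) Y + DP p Z (DP p W Y)"
    by (simp add: dderiv_DP[OF p tE(4) smooth_P mem smooth_P mem] d tE)
  have Q: "DP p Y (DP p W Z) - P p (DP p Y (DP p W Z)) = 0"
    if "P p Z = Z" "Y \<in> E" "Z \<in> E" for Y Z
    using that p tE(4) by (simp add: Q_DP DP_mem P_DP_tangent lins[OF linear_DP])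
  have "DA p W Y Z = (D2P p W Y Z + DP p (DP p W Y) Z + DP p Y (DP p W Z))
      - P p (D2P p W Y Z + DP p (DP p W Y) Z + DP p Y (DP p W Z))"
    using Q[of Z Y] tE unfolding DA_def by (simp add: lins[OF lin] algebra_simps)
  also have "\<dots> = DA p W Z Y"
    using Q[of Y Z] tE unfolding DA_def eq by (simp add: lins[OF lin] algebra_simps)
  finally show ?thesis .
qed

text \<open>The Codazzi equation in flat space: second derivatives of \<open>P\<close> commute, and
  so does \<open>DP\<close> on tangent vectors.\<close>

lemma DA_swap_left:
  assumes p: "p \<in> U" and t: "W \<in> range (P p)" "Y \<in> range (P p)" "Z \<in> range (P p)"
  shows "DA p W Y Z = DA p Y W Z"
proof -
  have tE: "P p W = W" "P p Y = Y" "W \<in> E" "Y \<in> E" "Z \<in> E"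
    using t mem[OF p] idem by auto
  have "DP p W Y = DP p Y W" using DP_commute[OF p tE(3,4)] tE by simp
  then show ?thesis using D2P_commute[OF p tE(3,4,5)] by (simp add: DA_def)
qed

text \<open>The trace of the second fundamental form of the leaves, which along
  \<open>\<Sigma>\<close> is the negative of \<open>mean_curvature\<close>.\<close>

definition Htrace :: "fseq \<Rightarrow> fseq" where
  "Htrace q = (\<Sum>i<N. DP q (P q (bas i)) (P q (bas i)))"

lemma smooth_Htrace: "smooth_on E Htrace U"
  unfolding Htrace_def by (intro smooth_on_sum[OF U E] smooth_DP smooth_P) auto

context
  fixes p B
  assumes p: "p \<in> U" and B: "orthonormal_basis (range (P p)) B"
begin

lemma B_mem: "e \<in> B \<Longrightarrow> e \<in> E" "e \<in> B \<Longrightarrow> P p e = e"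
  using orthonormal_basis_mem[OF B] mem[OF p] idem by auto

lemma Htrace_eq: "Htrace p = (\<Sum>e\<in>B. DP p e e)"
proof -
  have "Htrace p = (\<Sum>e\<in>B. DP p (P p e) e)"
    unfolding Htrace_def
    by (rule trace_P[OF p B, of "\<lambda>y z. DP p (P p y) z"])
       (rule linear_DP, rule linear_compose[OF lin linear_DP_left, unfolded o_def])
  then show ?thesis using B_mem by simp
qed

lemma dderiv_Htrace:
  assumes X: "X \<in> range (P p)"
  shows "dderiv E Htrace p X - P p (dderiv E Htrace p X) = (\<Sum>e\<in>B. DA p X e e)"
proof -
  let ?t = "\<lambda>i. P p (bas i)"
  let ?S1 = "\<Sum>i<N. D2P p X (?t i) (?t i)" and ?S2 = "\<Sum>i<N. DP p (DP p X (bas i)) (?t i)"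
    and ?S3 = "\<Sum>i<N. DP p (?t i) (DP p X (bas i))"
  have XE: "X \<in> E" "P p X = X" using X mem[OF p] idem by auto
  have l1: "linear (\<lambda>y. D2P p X (P p y) z)" for z
    using linear_compose[OF lin linear_D2P_left[OF p XE(1)], unfolded o_def] .
  have l2: "linear (\<lambda>y. DP p (DP p X y) z)" for z
    using linear_compose[OF linear_DP linear_DP_left, unfolded o_def] .
  have l3: "linear (\<lambda>y. DP p z (DP p X y))" for z
    using linear_compose[OF linear_DP linear_DP, unfolded o_def] .
  have "dderiv E Htrace p X = (\<Sum>i<N. D2P p X (?t i) (?t i)
      + DP p (DP p X (bas i)) (?t i) + DP p (?t i) (DP p X (bas i)))"
    unfolding Htrace_def
    by (simp add: dderiv_sum[OF U E p XE(1)] smooth_DP smooth_P dderiv_DP[OF p XE(1)] mem DP_eq[OF p XE(1)])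
  also have "\<dots> = ?S1
      + ?S2 + ?S3"
    by (simp add: sum.distrib)
  also have "?S1 = (\<Sum>e\<in>B. D2P p X (P p e) e)"
    by (rule trace_P[OF p B linear_D2P[OF p XE(1)] l1])
  also have "?S2 = (\<Sum>e\<in>B. DP p (DP p X e) e)"
    by (rule trace_P[OF p B linear_DP l2])
  also have "?S3 = (\<Sum>e\<in>B. DP p e (DP p X e))"
    by (rule trace_P[OF p B linear_DP_left l3])
  finally have d: "dderiv E Htrace p X = (\<Sum>e\<in>B. D2P p X e e + DP p (DP p X e) e + DP p e (DP p X e))"
    using B_mem by (simp add: sum.distrib)
  \<comment> \<open>The product rule term in which the second argument is differentiated is
    tangential and does not contribute to the normal part.\<close>
  have Q: "DP p e (DP p X e) = P p (DP p e (DP p X e))" if "e \<in> B" for e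
    using Q_DP[OF p _ DP_mem[OF p XE(1)], of e e] that B_mem[OF that] P_DP_tangent[OF p XE(1)]
    by (simp add: lins[OF linear_DP])
  show ?thesis
    unfolding d linear_sum[OF lin] sum_subtractf[symmetric] DA_def
  proof (rule sum.cong)
    fix e assume "e \<in> B"
    then show "D2P p X e e + DP p (DP p X e) e + DP p e (DP p X e)
        - P p (D2P p X e e + DP p (DP p X e) e + DP p e (DP p X e))
      = D2P p X e e + DP p (DP p X e) e - P p (D2P p X e e + DP p (DP p X e) e)"
      using Q[of e] by (simp add: lins[OF lin] algebra_simps)
  qed simp
qed

end

text \<open>The normal covariant derivative of \<open>\<phi>\<close> times the normal part of
  \<open>e0\<close> along \<open>P q e\<close>, by \<open>normal_deriv\<close>, as a smooth field on
  all of \<open>U\<close> that can be differentiated again.\<close>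

definition grad_field :: "(fseq \<Rightarrow> real) \<Rightarrow> fseq \<Rightarrow> fseq \<Rightarrow> fseq \<Rightarrow> fseq" where
  "grad_field \<phi> e0 e q = dderiv E \<phi> q (P q e) *\<^sub>R (e0 - P q e0) - \<phi> q *\<^sub>R DP q (P q e) (P q e0)"

lemma smooth_dderiv_P: "smooth_on E \<phi> U \<Longrightarrow> smooth_on E (\<lambda>q. dderiv E \<phi> q (P q e)) U"
  for \<phi> :: "fseq \<Rightarrow> real"
  by (rule smooth_on_family[OF U])
     (auto intro: linear_dderiv[OF U E _ subspace_0[OF E]] smooth_on_dderiv smooth_P mem)

lemma smooth_grad_field: "smooth_on E \<phi> U \<Longrightarrow> smooth_on E (grad_field \<phi> e0 e) U"
  unfolding grad_field_def
  by (intro smooth_on_diff[OF U E] smooth_on_scaleR[OF U E] smooth_dderiv_P smooth_DP smooth_P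
      smooth_on_const[OF U E])

text \<open>As \<open>e0\<close> is constant, its normal part varies only through \<open>P\<close>,
  and the normal component of \<open>DP p X e0\<close> is \<open>DP p X (P p e0)\<close>.\<close>

lemma normal_deriv:
  assumes p: "p \<in> U" and \<phi>: "smooth_on E \<phi> U" and e0: "e0 \<in> E" and X: "X \<in> E"
  shows "dderiv E (\<lambda>q. \<phi> q *\<^sub>R (e0 - P q e0)) p X - P p (dderiv E (\<lambda>q. \<phi> q *\<^sub>R (e0 - P q e0)) p X)
    = dderiv E \<phi> p X *\<^sub>R (e0 - P p e0) - \<phi> p *\<^sub>R DP p X (P p e0)"
proof -
  have d: "dderiv E (\<lambda>q. \<phi> q *\<^sub>R (e0 - P q e0)) p X = \<phi> p *\<^sub>R - DP p X e0 + dderiv E \<phi> p X *\<^sub>R (e0 - P p e0)"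
    using dderiv_scaleR[OF U E p X \<phi> smooth_on_diff[OF U E smooth_on_const[OF U E, of e0] smooth_P[of e0]]]
      dderiv_diff[OF U E p X smooth_on_const[OF U E, of e0] smooth_P[of e0]]
    by (simp add: dderiv_const[OF U E p X] DP_eq[OF p X e0])
  show ?thesis
    unfolding d Q_DP[OF p X e0, symmetric]
    by (simp add: lins[OF lin] idem algebra_simps)
qed

text \<open>The four terms are the Hessian of \<open>\<phi>\<close>, the cross term (once from each
  factor), the derivative of the second fundamental form, and the second fundamental form composed
  with the shape operator of the normal part of \<open>e0\<close>.\<close>

lemma normal_deriv_grad_field:
  assumes p: "p \<in> U" and \<phi>: "smooth_on E \<phi> U" and e0: "e0 \<in> E" and e: "e \<in> range (P p)"
  shows "dderiv E (grad_field \<phi> e0 e) p e - P p (dderiv E (grad_field \<phi> e0 e) p e)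
    = dderiv E (\<lambda>q. dderiv E \<phi> q (P q e)) p e *\<^sub>R (e0 - P p e0)
      - (2 * dderiv E \<phi> p e) *\<^sub>R DP p e (P p e0) - \<phi> p *\<^sub>R DA p e e (P p e0)
      - \<phi> p *\<^sub>R DP p e (DP p e (e0 - P p e0))"
proof -
  have eE: "e \<in> E" "P p e = e" using e mem[OF p] idem by auto
  note sc = smooth_on_const[OF U E]
  have dP: "dderiv E (\<lambda>q. P q y) p e = DP p e y" if "y \<in> E" for y using DP_eq[OF p eE(1) that] .
  have d1: "dderiv E (\<lambda>q. dderiv E \<phi> q (P q e) *\<^sub>R (e0 - P q e0)) p e
      = dderiv E \<phi> p e *\<^sub>R - DP p e e0 + dderiv E (\<lambda>q. dderiv E \<phi> q (P q e)) p e *\<^sub>R (e0 - P p e0)"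
    using dderiv_scaleR[OF U E p eE(1) smooth_dderiv_P[OF \<phi>, of e] smooth_on_diff[OF U E sc smooth_P[of e0]], of e0]
      dderiv_diff[OF U E p eE(1) sc smooth_P[of e0], of e0]
    by (simp add: dderiv_const[OF U E p eE(1)] dP e0 eE)
  have d2: "dderiv E (\<lambda>q. \<phi> q *\<^sub>R DP q (P q e) (P q e0)) p e
      = \<phi> p *\<^sub>R (D2P p e e (P p e0) + DP p (DP p e e) (P p e0) + DP p e (DP p e e0))
        + dderiv E \<phi> p e *\<^sub>R DP p e (P p e0)"
    using dderiv_scaleR[OF U E p eE(1) \<phi> smooth_DP[OF smooth_P[of e] smooth_P[of e0]]]
      dderiv_DP[OF p eE(1) smooth_P[of e] mem smooth_P[of e0] mem]
    by (simp add: dP e0 eE)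
  have d: "dderiv E (grad_field \<phi> e0 e) p e
      = dderiv E \<phi> p e *\<^sub>R - DP p e e0 + dderiv E (\<lambda>q. dderiv E \<phi> q (P q e)) p e *\<^sub>R (e0 - P p e0)
        - (\<phi> p *\<^sub>R (D2P p e e (P p e0) + DP p (DP p e e) (P p e0) + DP p e (DP p e e0))
        + dderiv E \<phi> p e *\<^sub>R DP p e (P p e0))"
    unfolding grad_field_def
    using dderiv_diff[OF U E p eE(1), of "\<lambda>q. dderiv E \<phi> q (P q e) *\<^sub>R (e0 - P q e0)"
        "\<lambda>q. \<phi> q *\<^sub>R DP q (P q e) (P q e0)"]
      smooth_on_scaleR[OF U E smooth_dderiv_P[OF \<phi>, of e] smooth_on_diff[OF U E sc smooth_P[of e0]], of e0]
      smooth_on_scaleR[OF U E \<phi> smooth_DP[OF smooth_P[of e] smooth_P[of e0]]] d1 d2 by simp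
  define a b c g where "a = DP p e e0" and "b = DP p e (P p e0)" and "c = DP p e a"
    and "g = D2P p e e (P p e0) + DP p (DP p e e) (P p e0)"
  have Qa: "P p a = a - b" using Q_DP[OF p eE(1) e0] by (simp add: a_def b_def algebra_simps)
  have Qb: "P p b = 0" unfolding b_def by (rule P_DP_tangent[OF p eE(1) mem[OF p] idem])
  have Qc: "P p c = c - DP p e (a - b)"
    using Q_DP[OF p eE(1) DP_mem[OF p eE(1) e0]] Qa unfolding a_def[symmetric] c_def
    by (simp add: algebra_simps)
  have ab: "a - b = DP p e (e0 - P p e0)" by (simp add: a_def b_def lins[OF linear_DP])
  have g: "DA p e e (P p e0) = g - P p g" by (simp add: DA_def g_def)
  show ?thesis
    unfolding d g a_def[symmetric] b_def[symmetric] c_def[symmetric] g_def[symmetric] ab[symmetric]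
    by (simp add: lins[OF lin] idem Qa Qb Qc algebra_simps) (simp flip: scaleR_add_left)
qed

text \<open>For normal \<open>y\<close> the vector \<open>DP p e y\<close> is tangent, with
  coefficients \<open>inner (DP p e f) y\<close> by self-adjointness. This identifies the quadratic
  curvature term of \<open>L\<close>.\<close>

lemma sum_DP_DP:
  assumes p: "p \<in> U" and B: "orthonormal_basis (range (P p)) B" and y: "y \<in> E" "P p y = 0"
  shows "(\<Sum>e\<in>B. DP p e (DP p e y)) = (\<Sum>e\<in>B. \<Sum>f\<in>B. inner (DP p e f) y *\<^sub>R DP p e f)"
proof (rule sum.cong)
  fix e assume "e \<in> B"
  then have e: "e \<in> E" "P p e = e" using B_mem[OF p B] by auto
  have "DP p e y \<in> range (P p)"
    using P_DP_normal[OF p e(1) y] by (metis rangeI)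
  then have "DP p e y = (\<Sum>f\<in>B. inner (DP p e y) f *\<^sub>R f)"
    by (rule orthonormal_basis_expand[OF B])
  also have "\<dots> = (\<Sum>f\<in>B. inner (DP p e f) y *\<^sub>R f)"
    using DP_self_adjoint[OF p e(1) y(1)] B_mem[OF p B] by (intro sum.cong) (auto simp: inner_commute)
  finally show "DP p e (DP p e y) = (\<Sum>f\<in>B. inner (DP p e f) y *\<^sub>R DP p e f)"
    using linear_sum[OF linear_DP, of p e "\<lambda>f. inner (DP p e f) y *\<^sub>R f" B] by (simp add: lins[OF linear_DP])
qed simp

text \<open>\<open>shr\<close> is the derivative of the shrinker equation \<open>H = x\<^sup>\<bottom> / 2\<close>, which holds only along \<open>\<Sigma>\<close>.\<close>

context
  fixes p B and \<phi> :: "fseq \<Rightarrow> real" and e0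
  assumes p: "p \<in> U" and B: "orthonormal_basis (range (P p)) B"
    and \<phi>: "smooth_on E \<phi> U" and e0: "e0 \<in> E"
    and shr: "\<And>X. X \<in> range (P p) \<Longrightarrow>
        dderiv E Htrace p X = dderiv E (\<lambda>q. - ((1/2) *\<^sub>R (q - P q q))) p X"
begin

text \<open>Codazzi moves \<open>X\<close> into the differentiating slot, which leaves the normal
  derivative of the trace. By \<open>shr\<close> the latter is that of minus half the normal part of
  the position vector.\<close>

lemma sum_DA:
  assumes X: "X \<in> range (P p)"
  shows "(\<Sum>e\<in>B. DA p e e X) = (1/2) *\<^sub>R DP p X (P p p)"
proof -
  have XE: "X \<in> E" "P p X = X" using X mem[OF p] idem by auto
  have "(\<Sum>e\<in>B. DA p e e X) = (\<Sum>e\<in>B. DA p X e e)"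
  proof (rule sum.cong)
    fix e assume "e \<in> B"
    then have e: "e \<in> range (P p)" using orthonormal_basis_mem[OF B] by simp
    show "DA p e e X = DA p X e e"
      using DA_swap_right[OF p e e X] DA_swap_left[OF p e X e] by simp
  qed simp
  also have "\<dots> = dderiv E Htrace p X - P p (dderiv E Htrace p X)"
    using dderiv_Htrace[OF p B X] by simp
  also have "dderiv E Htrace p X = - ((1/2) *\<^sub>R (X - (DP p X p + P p X)))"
  proof -
    have s: "smooth_on E (\<lambda>q. P q q) U" by (rule smooth[OF smooth_on_id[OF U E]])
    have "dderiv E (\<lambda>q. q - P q q) p X = X - (DP p X p + P p X)"
      using dderiv_diff[OF U E p XE(1) smooth_on_id[OF U E] s] dderiv_id[OF U E p XE(1)]
        dderiv_P[OF p XE(1) smooth_on_id[OF U E] U_sub] by simp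
    then show ?thesis
      unfolding shr[OF X]
      using dderiv_linear[OF U E p XE(1) bounded_linear_minus[OF bounded_linear_scaleR_right]
          smooth_on_diff[OF U E smooth_on_id[OF U E] s], of "1/2"] by simp
  qed
  also have "\<dots> = (1/2) *\<^sub>R DP p X p" using XE by simp
  also have "(1/2) *\<^sub>R DP p X p - P p ((1/2) *\<^sub>R DP p X p) = (1/2) *\<^sub>R DP p X (P p p)"
    using Q_DP[OF p XE(1) U_sub[OF p]] by (simp add: lins[OF lin] scaleR_diff_right[symmetric])
  finally show ?thesis .
qed

text \<open>The left-hand side is \<open>L (\<phi> e0\<^sup>\<bottom>)\<close>. All terms with derivatives of the second fundamental form
  cancel: by Codazzi and \<open>shr\<close> they sum up to the drift term, and \<open>L e0\<^sup>\<bottom> = e0\<^sup>\<bottom> / 2\<close>.\<close>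

lemma L_formula:
  defines "v \<equiv> \<phi> p *\<^sub>R (e0 - P p e0)"
  shows "(\<Sum>e\<in>B. dderiv E (grad_field \<phi> e0 e) p e - P p (dderiv E (grad_field \<phi> e0 e) p e))
      - (1/2) *\<^sub>R grad_field \<phi> e0 p p
      + (\<Sum>e\<in>B. \<Sum>f\<in>B. inner (DP p e f) v *\<^sub>R DP p e f) + (1/2) *\<^sub>R v
    = ((\<Sum>e\<in>B. dderiv E (\<lambda>q. dderiv E \<phi> q (P q e)) p e) - dderiv E \<phi> p (P p p) / 2 + \<phi> p / 2) *\<^sub>R (e0 - P p e0)
      - 2 *\<^sub>R (\<Sum>e\<in>B. dderiv E \<phi> p e *\<^sub>R DP p e (P p e0))"
proof -
  have Q0: "e0 - P p e0 \<in> E" "P p (e0 - P p e0) = 0"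
    using e0 mem[OF p] by (auto intro: subspace_diff[OF E] simp: lins[OF lin] idem)
  have "(\<Sum>e\<in>B. dderiv E (grad_field \<phi> e0 e) p e - P p (dderiv E (grad_field \<phi> e0 e) p e))
    = (\<Sum>e\<in>B. dderiv E (\<lambda>q. dderiv E \<phi> q (P q e)) p e *\<^sub>R (e0 - P p e0)
      - (2 * dderiv E \<phi> p e) *\<^sub>R DP p e (P p e0) - \<phi> p *\<^sub>R DA p e e (P p e0)
      - \<phi> p *\<^sub>R DP p e (DP p e (e0 - P p e0)))"
    using orthonormal_basis_mem[OF B] by (intro sum.cong normal_deriv_grad_field p \<phi> e0) auto
  also have "\<dots> = (\<Sum>e\<in>B. dderiv E (\<lambda>q. dderiv E \<phi> q (P q e)) p e) *\<^sub>R (e0 - P p e0)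
      - 2 *\<^sub>R (\<Sum>e\<in>B. dderiv E \<phi> p e *\<^sub>R DP p e (P p e0)) - \<phi> p *\<^sub>R (\<Sum>e\<in>B. DA p e e (P p e0))
      - \<phi> p *\<^sub>R (\<Sum>e\<in>B. DP p e (DP p e (e0 - P p e0)))"
    by (simp add: sum_subtractf scaleR_sum_left scaleR_sum_right)
  \<comment> \<open>Symmetry of \<open>DP\<close> brings this into the form in which it cancels
    against the undifferentiated-\<open>\<phi>\<close> part of the drift term.\<close>
  also have "(\<Sum>e\<in>B. DA p e e (P p e0)) = (1/2) *\<^sub>R DP p (P p p) (P p e0)"
    using sum_DA[of "P p e0"] DP_commute[OF p e0 U_sub[OF p]] by simp
  also have "\<phi> p *\<^sub>R (\<Sum>e\<in>B. DP p e (DP p e (e0 - P p e0)))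
      = (\<Sum>e\<in>B. \<Sum>f\<in>B. inner (DP p e f) v *\<^sub>R DP p e f)"
    unfolding sum_DP_DP[OF p B Q0] v_def by (simp add: scaleR_sum_right)
  finally show ?thesis
    unfolding grad_field_def v_def by (simp add: idem algebra_simps)
qed

end

end

subsection \<open>The second variation operator in a chart\<close>

definition test_field :: "real \<Rightarrow> fseq set \<Rightarrow> nat \<Rightarrow> fseq \<Rightarrow> fseq" where
  "test_field c \<Sigma> i q = cutoff c 0 (inner q q) *\<^sub>R nor_part \<Sigma> q (bas i)"

context slice
begin

sublocale pf: projection_field N U proj
  by (rule projection_field.intro)
     (rule U linear_proj proj_mem proj_idem proj_self_adjoint smooth_proj, assumption?)+

text \<open>Differentiating \<open>proj q (tvec k q) = tvec k q\<close> shows that \<open>DP\<close>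
  is the normal part of the derivative of a coordinate field, and coordinate fields commute.\<close>

lemma DP_tvec:
  assumes q: "q \<in> U" and jk: "j < n" "k < n"
  shows "pf.DP q (tvec j q) (tvec k q) = pf.DP q (tvec k q) (tvec j q)"
proof -
  have "pf.DP q (tvec j q) (tvec k q)
      = dderiv E (tvec k) q (tvec j q) - proj q (dderiv E (tvec k) q (tvec j q))" if "j < n" "k < n" for j k
  proof -
    have "dderiv E (\<lambda>q. proj q (tvec k q)) q (tvec j q)
        = pf.DP q (tvec j q) (tvec k q) + proj q (dderiv E (tvec k) q (tvec j q))"
      using that nN by (intro pf.dderiv_P q tvec_mem smooth_tvec) auto
    moreover have "dderiv E (\<lambda>q. proj q (tvec k q)) q = dderiv E (tvec k) q"
      using that by (intro dderiv_cong[OF U q] proj_tvec)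
    ultimately show ?thesis by (simp add: algebra_simps)
  qed
  then show ?thesis using jk dderiv_tvec_commute[OF q jk] by simp
qed

lemma DP_span_commute:
  assumes q: "q \<in> U" and xy: "x \<in> tspan q" "y \<in> tspan q"
  shows "pf.DP q x y = pf.DP q y x"
proof -
  let ?T = "(\<lambda>j. tvec j q) ` {..<n}"
  have "span ?T \<subseteq> {y. pf.DP q (tvec j q) y = pf.DP q y (tvec j q)}" if "j < n" for j
    using DP_tvec[OF q that]
    by (intro span_minimal)
       (auto simp: subspace_def linear_0[OF pf.linear_DP] linear_add[OF pf.linear_DP] linear_scale[OF pf.linear_DP]
         linear_0[OF pf.linear_DP_left] linear_add[OF pf.linear_DP_left] linear_scale[OF pf.linear_DP_left])
  then have "span ?T \<subseteq> {x. pf.DP q x y = pf.DP q y x}"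
    using xy(2)
    by (intro span_minimal)
       (auto simp: subspace_def linear_0[OF pf.linear_DP] linear_add[OF pf.linear_DP] linear_scale[OF pf.linear_DP]
         linear_0[OF pf.linear_DP_left] linear_add[OF pf.linear_DP_left] linear_scale[OF pf.linear_DP_left])
  then show ?thesis using xy(1) by blast
qed

sublocale pf: integrable_field N U proj
  by unfold_locales (auto intro!: DP_span_commute simp: proj_def gs_proj_in_span)

lemma nor_part_eq: "q \<in> U \<Longrightarrow> q \<in> \<Sigma> \<Longrightarrow> nor_part \<Sigma> q x = x - proj q x"
  by (simp add: nor_part_def tan_part_eq)

lemma tangent_basis_onb:
  assumes q: "q \<in> U" "q \<in> \<Sigma>"
  shows "orthonormal_basis (range (proj q)) (tangent_basis \<Sigma> q)"
proof -
  have "\<exists>B. orthonormal_basis (tangent_space \<Sigma> q) B"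
    unfolding tangent_space_eq[OF q] by (rule orthonormal_basis_span_exists) simp
  then show ?thesis
    unfolding tangent_basis_def tangent_space_range[OF q, symmetric] by (rule someI_ex)
qed

lemma card_tangent_basis_le:
  assumes q: "q \<in> U" "q \<in> \<Sigma>"
  shows "card (tangent_basis \<Sigma> q) \<le> n"
proof -
  let ?B = "tangent_basis \<Sigma> q"
  have B: "orthonormal_basis (range (proj q)) ?B" by (rule tangent_basis_onb[OF q])
  then have "independent ?B"
    by (intro pairwise_orthogonal_independent) (auto simp: orthonormal_basis_def)
  moreover have "?B \<subseteq> tspan q"
    using orthonormal_basis_mem[OF B] tangent_space_eq[OF q] tangent_space_range[OF q] by auto
  ultimately have "card ?B \<le> card ((\<lambda>j. tvec j q) ` {..<n})"
    using independent_span_bound[of "(\<lambda>j. tvec j q) ` {..<n}" ?B] by simp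
  also have "\<dots> \<le> n" using card_image_le[of "{..<n}"] by fastforce
  finally show ?thesis .
qed

lemma euclidean_deriv_tan_field:
  assumes q: "q \<in> U" "q \<in> \<Sigma>" and X: "X q \<in> range (proj q)" and e: "e \<in> E"
  shows "euclidean_deriv \<Sigma> X (tan_field \<Sigma> e) q = pf.DP q (X q) e"
proof -
  have XE: "X q \<in> E" using X proj_mem[OF q(1)] by auto
  have "euclidean_deriv \<Sigma> X (tan_field \<Sigma> e) q = dderiv E (\<lambda>r. proj r e) q (X q)"
    by (rule euclidean_deriv_eq[where X = X, OF q pf.smooth_P _ X]) (simp add: tan_field_def tan_part_eq)
  then show ?thesis using pf.DP_eq[OF q(1) XE e] by simp
qed

lemma tan_field_range: "q \<in> U \<Longrightarrow> q \<in> \<Sigma> \<Longrightarrow> tan_field \<Sigma> e q = proj q e"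
  by (simp add: tan_field_def tan_part_eq)

lemma second_ff_at_eq:
  assumes q: "q \<in> U" "q \<in> \<Sigma>" and e: "e \<in> range (proj q)" "f \<in> range (proj q)"
  shows "second_ff_at \<Sigma> q e f = pf.DP q e f"
proof -
  have "e \<in> E" "f \<in> E" "proj q e = e" "proj q f = f" using e proj_mem[OF q(1)] proj_idem by auto
  then show ?thesis
    unfolding second_ff_at_def second_ff_def
    using euclidean_deriv_tan_field[OF q, of "tan_field \<Sigma> e" f] tan_field_range[OF q, of e] e(1)
      pf.P_DP_tangent[OF q(1), of e f]
    by (simp add: nor_part_eq[OF q])
qed

lemma mean_curvature_eq:
  assumes q: "q \<in> U" "q \<in> \<Sigma>"
  shows "mean_curvature \<Sigma> q = - pf.Htrace q"
  unfolding mean_curvature_def pf.Htrace_eq[OF q(1) tangent_basis_onb[OF q]]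
  using second_ff_at_eq[OF q] orthonormal_basis_mem[OF tangent_basis_onb[OF q]] by simp

section \<open>The test fields in a chart\<close>

lemma smooth_norm_cutoff: "c > 0 \<Longrightarrow> smooth_on E (\<lambda>q. cutoff c k (inner q q)) U"
  by (rule smooth_on_compose[OF U E orthonormal_basis_real _ smooth_on_cutoff])
     (auto intro: smooth_on_inner[OF U E] smooth_on_id[OF U E])

lemma dderiv_norm_cutoff:
  assumes c: "c > 0" and q: "q \<in> U" and X: "X \<in> E"
  shows "dderiv E (\<lambda>q. cutoff c k (inner q q)) q X = 2 * cutoff c (Suc k) (inner q q) * inner q X"
proof -
  have "(cutoff c k has_derivative (\<lambda>h. cutoff c (Suc k) (inner q q) * h)) (at (inner q q))"
    using cutoff_has_derivative[OF c] by (simp add: has_field_derivative_def)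
  then have "((\<lambda>q. cutoff c k (inner q q)) has_derivative
      (\<lambda>h. cutoff c (Suc k) (inner q q) * (inner q h + inner h q))) (at q within E)"
    by (rule has_derivative_compose[rotated]) (auto intro!: derivative_eq_intros)
  from smooth_on_dderiv_eq[OF this E U_sub[OF q] X] show ?thesis by (simp add: inner_commute)
qed

text \<open>The trace of the projection, hence the dimension of its range, in a form that is visibly
  smooth in \<open>q\<close>.\<close>

definition tangent_dim :: "fseq \<Rightarrow> real" where
  "tangent_dim q = (\<Sum>i<N. inner (bas i) (proj q (bas i)))"

definition cutoff_laplacian :: "real \<Rightarrow> fseq \<Rightarrow> real" where
  "cutoff_laplacian c q = 4 * cutoff c (Suc (Suc 0)) (inner q q) * inner q (proj q q)
     + cutoff c (Suc 0) (inner q q) * (2 * tangent_dim q - inner q q)"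

definition test_integrand :: "real \<Rightarrow> nat \<Rightarrow> fseq \<Rightarrow> real" where
  "test_integrand c i q = cutoff c 0 (inner q q) *
     ((cutoff_laplacian c q + cutoff c 0 (inner q q) / 2) * inner (bas i - proj q (bas i)) (bas i - proj q (bas i))
      - 4 * cutoff c (Suc 0) (inner q q)
          * inner (bas i - proj q (bas i)) (pf.DP q (proj q q) (proj q (bas i))))"

lemma smooth_test_integrand:
  assumes c: "c > 0"
  shows "smooth_on E (test_integrand c i) U"
proof -
  have id: "smooth_on E (\<lambda>q. inner q q) U"
    by (intro smooth_on_inner[OF U E] smooth_on_id[OF U E])
  have half: "smooth_on E (\<lambda>q. cutoff c 0 (inner q q) / 2) U"
    using smooth_on_linear_compose[OF U E bounded_linear_divide smooth_norm_cutoff[OF c]] .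
  show ?thesis
    unfolding test_integrand_def cutoff_laplacian_def tangent_dim_def
    by (intro smooth_on_mult[OF U E] smooth_on_diff[OF U E] smooth_on_add[OF U E] smooth_on_inner[OF U E]
        smooth_norm_cutoff[OF c] half id smooth_on_const[OF U E] pf.smooth_P pf.smooth_DP smooth_proj
        smooth_on_id[OF U E] smooth_on_sum[OF U E] finite_lessThan)
qed

context
  fixes p
  assumes p: "p \<in> U" "p \<in> \<Sigma>"
    and shr: "\<And>x. x \<in> \<Sigma> \<Longrightarrow> mean_curvature \<Sigma> x = (1/2) *\<^sub>R nor_part \<Sigma> x x"
begin

lemma Htrace_shrinker:
  assumes "q \<in> U" "q \<in> \<Sigma>"
  shows "pf.Htrace q = - ((1/2) *\<^sub>R (q - proj q q))"
  using shr[OF assms(2)] mean_curvature_eq[OF assms] nor_part_eq[OF assms, of q] by (metis minus_minus)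

text \<open>Both functions are smooth extensions of the same function on \<open>\<Sigma>\<close>, so
  their derivatives agree in tangent directions.\<close>

lemma dderiv_Htrace_shrinker:
  assumes X: "X \<in> range (proj p)"
  shows "dderiv E pf.Htrace p X = dderiv E (\<lambda>q. - ((1/2) *\<^sub>R (q - proj q q))) p X"
proof -
  have "euclidean_deriv \<Sigma> (\<lambda>_. X) pf.Htrace p = dderiv E pf.Htrace p X"
    by (rule euclidean_deriv_eq[where X = "\<lambda>_. X", OF p pf.smooth_Htrace _ X]) simp
  moreover have "smooth_on E (\<lambda>q. - ((1/2) *\<^sub>R (q - proj q q))) U"
    by (intro smooth_on_minus[OF U E] smooth_on_scaleR[OF U E] smooth_on_diff[OF U E] smooth_on_const[OF U E]
        smooth_proj smooth_on_id[OF U E])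
  then have "euclidean_deriv \<Sigma> (\<lambda>_. X) pf.Htrace p = dderiv E (\<lambda>q. - ((1/2) *\<^sub>R (q - proj q q))) p X"
    by (rule euclidean_deriv_eq[where X = "\<lambda>_. X", OF p _ _ X]) (rule Htrace_shrinker)
  ultimately show ?thesis by simp
qed

context
  fixes \<phi> :: "fseq \<Rightarrow> real" and e0 and \<eta> :: "fseq \<Rightarrow> fseq"
  assumes \<phi>: "smooth_on E \<phi> U" and e0: "e0 \<in> E"
    and \<eta>: "\<And>r. r \<in> U \<Longrightarrow> r \<in> \<Sigma> \<Longrightarrow> \<eta> r = \<phi> r *\<^sub>R (e0 - proj r e0)"
begin

lemma smooth_normal: "smooth_on E (\<lambda>r. \<phi> r *\<^sub>R (e0 - proj r e0)) U"
  by (intro smooth_on_scaleR[OF U E] smooth_on_diff[OF U E] smooth_on_const[OF U E] pf.smooth_P \<phi>)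

lemma normal_conn_eq:
  assumes r: "r \<in> U" "r \<in> \<Sigma>" and X: "X r \<in> range (proj r)"
  shows "normal_conn \<Sigma> X \<eta> r
    = dderiv E \<phi> r (X r) *\<^sub>R (e0 - proj r e0) - \<phi> r *\<^sub>R pf.DP r (X r) (proj r e0)"
proof -
  have XE: "X r \<in> E" using X proj_mem[OF r(1)] by auto
  have "euclidean_deriv \<Sigma> X \<eta> r = dderiv E (\<lambda>r. \<phi> r *\<^sub>R (e0 - proj r e0)) r (X r)"
    by (rule euclidean_deriv_eq[where X = X, OF r smooth_normal \<eta> X])
  then show ?thesis
    unfolding normal_conn_def using pf.normal_deriv[OF r(1) \<phi> e0 XE] by (simp add: nor_part_eq[OF r])
qed

lemma normal_conn_tan_field:
  assumes r: "r \<in> U" "r \<in> \<Sigma>"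
  shows "normal_conn \<Sigma> (tan_field \<Sigma> e) \<eta> r = pf.grad_field \<phi> e0 e r"
  using normal_conn_eq[OF r, of "tan_field \<Sigma> e"] tan_field_range[OF r] by (simp add: pf.grad_field_def)

lemma normal_laplacian_eq:
  "normal_laplacian \<Sigma> \<eta> p = (\<Sum>e\<in>tangent_basis \<Sigma> p.
      dderiv E (pf.grad_field \<phi> e0 e) p e - proj p (dderiv E (pf.grad_field \<phi> e0 e) p e))"
  unfolding normal_laplacian_def Let_def
proof (rule sum.cong)
  fix e
  let ?F = "tan_field \<Sigma> e" and ?G = "pf.grad_field \<phi> e0 e"
  assume "e \<in> tangent_basis \<Sigma> p"
  then have er: "e \<in> range (proj p)" using orthonormal_basis_mem[OF tangent_basis_onb[OF p]] by blast
  then have e: "e \<in> E" "proj p e = e" using proj_mem[OF p(1)] proj_idem by auto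
  have F: "?F p = e" using tan_field_range[OF p] e by simp
  \<comment> \<open>The derivative of \<open>q \<mapsto> proj q e\<close> along a tangent
    \<open>e\<close> is normal at \<open>p\<close>, so the frame is geodesic there and the
    correction term of the Laplacian vanishes.\<close>
  have "tangential_conn \<Sigma> ?F ?F p = 0"
    unfolding tangential_conn_def
    using euclidean_deriv_tan_field[OF p, of "?F" e] F er e pf.P_DP_tangent[OF p(1)]
    by (simp add: tan_part_eq[OF p])
  then have "normal_conn \<Sigma> (tangential_conn \<Sigma> ?F ?F) \<eta> p = 0"
    using normal_conn_eq[OF p, of "tangential_conn \<Sigma> ?F ?F"]
      linear_0[OF pf.linear_DP_left] linear_0[OF linear_dderiv[OF U E p(1) subspace_0[OF E] \<phi>]]
      linear_0[OF linear_proj] by (simp add: image_iff) (metis linear_0 linear_proj)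
  \<comment> \<open>The inner derivative is known on all of \<open>U \<inter> \<Sigma>\<close>, not
    just at \<open>p\<close>; hence it can be differentiated through its extension
    \<open>grad_field\<close>.\<close>
  moreover have "euclidean_deriv \<Sigma> ?F (normal_conn \<Sigma> ?F \<eta>) p
      = dderiv E ?G p (?F p)"
    using er F by (intro euclidean_deriv_eq p pf.smooth_grad_field \<phi> normal_conn_tan_field) auto
  ultimately show "normal_conn \<Sigma> ?F (normal_conn \<Sigma> ?F \<eta>) p
      - normal_conn \<Sigma> (tangential_conn \<Sigma> ?F ?F) \<eta> p
    = dderiv E ?G p e - proj p (dderiv E ?G p e)"
    unfolding normal_conn_def[of _ _ "normal_conn \<Sigma> ?F \<eta>"] by (simp add: F nor_part_eq[OF p])
qed simp

lemma L_op_eq: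
  "L_op \<Sigma> \<eta> p = ((\<Sum>e\<in>tangent_basis \<Sigma> p. dderiv E (\<lambda>q. dderiv E \<phi> q (proj q e)) p e)
        - dderiv E \<phi> p (proj p p) / 2 + \<phi> p / 2) *\<^sub>R (e0 - proj p e0)
      - 2 *\<^sub>R (\<Sum>e\<in>tangent_basis \<Sigma> p. dderiv E \<phi> p e *\<^sub>R pf.DP p e (proj p e0))"
proof -
  let ?B = "tangent_basis \<Sigma> p"
  note B = tangent_basis_onb[OF p]
  have "normal_conn \<Sigma> (\<lambda>q. tan_part \<Sigma> q q) \<eta> p = pf.grad_field \<phi> e0 p p"
    using normal_conn_eq[OF p, of "\<lambda>q. tan_part \<Sigma> q q"] tan_part_eq[OF p] by (simp add: pf.grad_field_def)
  moreover have "second_ff_at \<Sigma> p e f = pf.DP p e f" if "e \<in> ?B" "f \<in> ?B" for e f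
    using that orthonormal_basis_mem[OF B] by (intro second_ff_at_eq p) auto
  ultimately have "L_op \<Sigma> \<eta> p
      = (\<Sum>e\<in>?B. dderiv E (pf.grad_field \<phi> e0 e) p e - proj p (dderiv E (pf.grad_field \<phi> e0 e) p e))
      - (1/2) *\<^sub>R pf.grad_field \<phi> e0 p p
      + (\<Sum>e\<in>?B. \<Sum>f\<in>?B. inner (pf.DP p e f) (\<phi> p *\<^sub>R (e0 - proj p e0)) *\<^sub>R pf.DP p e f)
      + (1/2) *\<^sub>R \<phi> p *\<^sub>R (e0 - proj p e0)"
    unfolding L_op_def drift_laplacian_def normal_laplacian_eq \<eta>[OF p] by (simp cong: sum.cong)
  then show ?thesis
    by (rule trans[OF _ pf.L_formula[OF p(1) B \<phi> e0 dderiv_Htrace_shrinker]])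
qed

end

lemma tangent_dim_eq: "tangent_dim p = card (tangent_basis \<Sigma> p)"
proof -
  note B = tangent_basis_onb[OF p]
  have "tangent_dim p = (\<Sum>e\<in>tangent_basis \<Sigma> p. inner e e)"
    unfolding tangent_dim_def
    by (rule pf.trace_P[OF p(1) B]) (auto intro!: linearI simp: inner_add_left inner_add_right)
  also have "\<dots> = card (tangent_basis \<Sigma> p)"
    using B by (simp add: orthonormal_basis_inner[OF B])
  finally show ?thesis .
qed

text \<open>By the shrinker equation the traced second fundamental form paired with \<open>p\<close>
  is minus half the squared length of the normal part of \<open>p\<close>. Together with the drift,
  which supplies the tangential part, this gives the full \<open>inner p p\<close>.\<close>

lemma drift_laplacian_norm_cutoff:
  assumes c: "c > 0"
  defines "\<phi> \<equiv> \<lambda>q. cutoff c 0 (inner q q)"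
  shows "(\<Sum>e\<in>tangent_basis \<Sigma> p. dderiv E (\<lambda>q. dderiv E \<phi> q (proj q e)) p e)
      - dderiv E \<phi> p (proj p p) / 2 = cutoff_laplacian c p"
proof -
  let ?B = "tangent_basis \<Sigma> p" and ?g = "\<lambda>k. cutoff c k (inner p p)"
  note B = tangent_basis_onb[OF p]
  have B': "e \<in> E" "proj p e = e" if "e \<in> ?B" for e
    using pf.B_mem[OF p(1) B that] by auto
  have hess: "dderiv E (\<lambda>q. dderiv E \<phi> q (proj q e)) p e
      = 4 * ?g (Suc (Suc 0)) * (inner p e * inner e p) + 2 * ?g (Suc 0) * (1 + inner p (pf.DP p e e))"
    if e: "e \<in> ?B" for e
  proof -
    have "dderiv E (\<lambda>q. dderiv E \<phi> q (proj q e)) p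
        = dderiv E (\<lambda>q. 2 *\<^sub>R (cutoff c (Suc 0) (inner q q) *\<^sub>R inner q (proj q e))) p"
      unfolding \<phi>_def using dderiv_norm_cutoff[OF c] proj_mem
      by (intro dderiv_cong[OF U p(1)]) simp
    moreover have s: "smooth_on E (\<lambda>q. inner q (proj q e)) U"
      by (intro smooth_on_inner[OF U E] smooth_on_id[OF U E] pf.smooth_P)
    moreover have "dderiv E (\<lambda>q. inner q (proj q e)) p e = inner p (pf.DP p e e) + inner e e"
      using dderiv_inner[OF U E p(1) B'(1)[OF e] smooth_on_id[OF U E] pf.smooth_P[of e]]
        dderiv_id[OF U E p(1) B'(1)[OF e]] pf.DP_eq[OF p(1) B'(1)[OF e] B'(1)[OF e]] B'(2)[OF e] by simp
    ultimately show ?thesis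
      using dderiv_linear[OF U E p(1) B'(1)[OF e] bounded_linear_scaleR_right
          smooth_on_scaleR[OF U E smooth_norm_cutoff[OF c, of "Suc 0"] s], of 2]
        dderiv_scaleR[OF U E p(1) B'(1)[OF e] smooth_norm_cutoff[OF c, of "Suc 0"] s]
        dderiv_norm_cutoff[OF c p(1) B'(1)[OF e], of "Suc 0"] B'(2)[OF e]
        orthonormal_basis_inner[OF B e e]
      by (simp add: algebra_simps inner_commute)
  qed
  have s1: "(\<Sum>e\<in>?B. inner p e * inner e p) = inner p (proj p p)"
  proof -
    have "inner p (proj p p) = inner (proj p p) (proj p p)" by (metis proj_idem proj_self_adjoint)
    also have "\<dots> = (\<Sum>e\<in>?B. inner (proj p p) e * inner e (proj p p))"
      by (rule orthonormal_basis_parseval[OF B]) simp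
    also have "\<dots> = (\<Sum>e\<in>?B. inner p e * inner e p)"
      using B' by (intro sum.cong) (auto simp: proj_self_adjoint proj_self_adjoint[of _ _ p, symmetric])
    finally show ?thesis ..
  qed
  have s2: "(\<Sum>e\<in>?B. inner p (pf.DP p e e)) = - ((inner p p - inner p (proj p p)) / 2)"
    using Htrace_shrinker[OF p] pf.Htrace_eq[OF p(1) B]
    by (simp add: inner_sum_right[symmetric] inner_diff_right)
  have "(\<Sum>e\<in>?B. dderiv E (\<lambda>q. dderiv E \<phi> q (proj q e)) p e)
      = 4 * ?g (Suc (Suc 0)) * (\<Sum>e\<in>?B. inner p e * inner e p)
        + 2 * ?g (Suc 0) * (card ?B + (\<Sum>e\<in>?B. inner p (pf.DP p e e)))"
    by (simp add: hess sum.distrib sum_distrib_left algebra_simps)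
  moreover have "dderiv E \<phi> p (proj p p) = 2 * ?g (Suc 0) * inner p (proj p p)"
    unfolding \<phi>_def by (rule dderiv_norm_cutoff[OF c p(1) proj_mem[OF p(1)]])
  ultimately show ?thesis
    unfolding s1 s2 cutoff_laplacian_def tangent_dim_eq by (simp add: field_simps)
qed

lemma test_field_L_op:
  assumes c: "c > 0" and i: "i < N"
  shows "inner (test_field c \<Sigma> i p) (L_op \<Sigma> (test_field c \<Sigma> i) p) = test_integrand c i p"
proof -
  let ?\<phi> = "\<lambda>q. cutoff c 0 (inner q q)" and ?B = "tangent_basis \<Sigma> p"
  note B = tangent_basis_onb[OF p]
  have B': "e \<in> E" "proj p e = e" if "e \<in> ?B" for e
    using pf.B_mem[OF p(1) B that] by auto
  have \<eta>: "test_field c \<Sigma> i r = ?\<phi> r *\<^sub>R (bas i - proj r (bas i))" if "r \<in> U" "r \<in> \<Sigma>" for r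
    using that by (simp add: test_field_def nor_part_eq)
  have "(\<Sum>e\<in>?B. dderiv E ?\<phi> p e *\<^sub>R pf.DP p e (proj p (bas i)))
      = (\<Sum>e\<in>?B. (2 * cutoff c (Suc 0) (inner p p) * inner p e) *\<^sub>R pf.DP p e (proj p (bas i)))"
    using B' dderiv_norm_cutoff[OF c p(1)] by (intro sum.cong) auto
  also have "\<dots> = (2 * cutoff c (Suc 0) (inner p p)) *\<^sub>R pf.DP p (\<Sum>e\<in>?B. inner p e *\<^sub>R e) (proj p (bas i))"
    by (simp add: linear_sum[OF pf.linear_DP_left] linear_scale[OF pf.linear_DP_left] scaleR_sum_right)
  \<comment> \<open>The tangential gradient of the cutoff is a multiple of the tangential part of
    the position vector.\<close>
  also have "(\<Sum>e\<in>?B. inner p e *\<^sub>R e) = proj p p"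
    by (subst orthonormal_basis_expand[OF B, of "proj p p"]) (auto simp: proj_self_adjoint B' intro!: sum.cong)
  finally have s: "(\<Sum>e\<in>?B. dderiv E ?\<phi> p e *\<^sub>R pf.DP p e (proj p (bas i)))
      = (2 * cutoff c (Suc 0) (inner p p)) *\<^sub>R pf.DP p (proj p p) (proj p (bas i))" .
  have "L_op \<Sigma> (test_field c \<Sigma> i) p = ((\<Sum>e\<in>?B. dderiv E (\<lambda>q. dderiv E ?\<phi> q (proj q e)) p e)
        - dderiv E ?\<phi> p (proj p p) / 2 + ?\<phi> p / 2) *\<^sub>R (bas i - proj p (bas i))
      - 2 *\<^sub>R (\<Sum>e\<in>?B. dderiv E ?\<phi> p e *\<^sub>R pf.DP p e (proj p (bas i)))"
    by (rule L_op_eq[OF smooth_norm_cutoff[OF c] _ \<eta>]) (simp_all add: i)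
  also have "\<dots> = (cutoff_laplacian c p + ?\<phi> p / 2) *\<^sub>R (bas i - proj p (bas i))
      - (4 * cutoff c (Suc 0) (inner p p)) *\<^sub>R pf.DP p (proj p p) (proj p (bas i))"
    unfolding s drift_laplacian_norm_cutoff[OF c] by simp
  finally show ?thesis
    unfolding \<eta>[OF p] test_integrand_def
    by (simp only: inner_diff_right[of "?\<phi> p *\<^sub>R _" "_ *\<^sub>R _"] inner_scaleR_left inner_scaleR_right)
      (simp add: algebra_simps)
qed

text \<open>\<open>trace_P\<close> turns the sum of the cross terms into a sum over tangent vectors
  \<open>e\<close>, for which \<open>e - proj p e = 0\<close>.\<close>

lemma sum_test_integrand:
  assumes c: "c > 0"
  shows "(\<Sum>i<N. test_integrand c i p) = cutoff c 0 (inner p p)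
    * ((cutoff_laplacian c p + cutoff c 0 (inner p p) / 2) * (real N - card (tangent_basis \<Sigma> p)))"
proof -
  let ?B = "tangent_basis \<Sigma> p"
  note B = tangent_basis_onb[OF p]
  have Q: "inner (x - proj p x) (x - proj p x) = inner x x - inner x (proj p x)" for x
    by (simp add: inner_diff_left inner_diff_right proj_self_adjoint proj_idem inner_commute)
  have "(\<Sum>i<N. inner (bas i - proj p (bas i)) (bas i - proj p (bas i))) = real N - tangent_dim p"
    unfolding Q tangent_dim_def by (simp add: sum_subtractf coord_bas)
  then have 1: "(\<Sum>i<N. inner (bas i - proj p (bas i)) (bas i - proj p (bas i))) = real N - card ?B"
    by (simp only: tangent_dim_eq)
  have l: "linear (\<lambda>y. inner (y - proj p y) z)" "linear (\<lambda>z. inner y (pf.DP p x z))" for x y z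
    by (auto intro!: linearI simp: linear_add[OF linear_proj] linear_scale[OF linear_proj]
        linear_add[OF pf.linear_DP] linear_scale[OF pf.linear_DP] inner_add_left inner_add_right
        inner_diff_left algebra_simps)
  have "(\<Sum>i<N. inner (bas i - proj p (bas i)) (pf.DP p (proj p p) (proj p (bas i))))
      = (\<Sum>e\<in>?B. inner (e - proj p e) (pf.DP p (proj p p) e))"
    by (rule pf.trace_P[OF p(1) B]) (rule l)+
  also have "\<dots> = 0"
    using pf.B_mem[OF p(1) B] by simp
  finally have 2: "(\<Sum>i<N. inner (bas i - proj p (bas i)) (pf.DP p (proj p p) (proj p (bas i)))) = 0" .
  show ?thesis
    unfolding test_integrand_def sum_distrib_left[symmetric] sum_subtractf 1 2 by simp
qed

end

end

subsection \<open>Hausdorff measure\<close>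

definition hausdorff_gauge :: "nat \<Rightarrow> 'a::metric_space set \<Rightarrow> ennreal" where
  "hausdorff_gauge n S =
     (if S = {} then 0 else ennreal (unit_ball_vol (real n) * (diameter S / 2) ^ n))"

definition hausdorff_covers :: "real \<Rightarrow> 'a::metric_space set \<Rightarrow> (nat \<Rightarrow> 'a set) set" where
  "hausdorff_covers \<delta> A = {C. A \<subseteq> (\<Union>i. C i) \<and> (\<forall>i. bounded (C i) \<and> diameter (C i) \<le> \<delta>)}"

lemma hausdorff_pre_eq:
  "hausdorff_pre n \<delta> A = (INF C \<in> hausdorff_covers \<delta> A. \<Sum>i. hausdorff_gauge n (C i))"
  unfolding hausdorff_pre_def hausdorff_covers_def hausdorff_gauge_def by simp

lemma hausdorff_gauge_empty [simp]: "hausdorff_gauge n {} = 0"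
  by (simp add: hausdorff_gauge_def)

lemma hausdorff_pre_mono: "A \<subseteq> B \<Longrightarrow> hausdorff_pre n \<delta> A \<le> hausdorff_pre n \<delta> B"
  unfolding hausdorff_pre_eq by (rule INF_superset_mono) (auto simp: hausdorff_covers_def)

lemma hausdorff_pre_antimono: "\<delta> \<le> \<epsilon> \<Longrightarrow> hausdorff_pre n \<epsilon> A \<le> hausdorff_pre n \<delta> A"
  unfolding hausdorff_pre_eq
  by (rule INF_superset_mono) (auto simp: hausdorff_covers_def intro: order_trans)

lemma hausdorff_pre_empty: "\<delta> > 0 \<Longrightarrow> hausdorff_pre n \<delta> {} = 0"
proof -
  assume "\<delta> > 0"
  then have "hausdorff_pre n \<delta> {} \<le> (\<Sum>i::nat. hausdorff_gauge n {})"
    unfolding hausdorff_pre_eq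
    by (intro INF_lower2[of "\<lambda>_. {}"]) (auto simp: hausdorff_covers_def diameter_def)
  then show ?thesis by simp
qed

lemma hausdorff_pre_countably_subadditive:
  fixes A :: "nat \<Rightarrow> 'a::metric_space set"
  shows "hausdorff_pre n \<delta> (\<Union>i. A i) \<le> (\<Sum>i. hausdorff_pre n \<delta> (A i))"
proof (rule ennreal_le_epsilon)
  fix e :: real
  \<comment> \<open>The exponent starts at 1 so that the errors of the nearly optimal covers add up
    to exactly \<open>e\<close>.\<close>
  let ?e = "\<lambda>k. e * (1/2) ^ Suc k"
  assume "0 < e" and fin: "(\<Sum>i. hausdorff_pre n \<delta> (A i)) < top"
  have "\<exists>B \<in> hausdorff_covers \<delta> (A k).
          (\<Sum>i. hausdorff_gauge n (B i)) < hausdorff_pre n \<delta> (A k) + ennreal (?e k)" for k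
  proof -
    have "hausdorff_pre n \<delta> (A k) < top"
      using fin by (auto dest!: ennreal_suminf_lessD)
    then have "hausdorff_pre n \<delta> (A k) < hausdorff_pre n \<delta> (A k) + ennreal (?e k)"
      using \<open>0 < e\<close> by simp
    then show ?thesis
      unfolding hausdorff_pre_eq[of n \<delta> "A k"] INF_less_iff by simp
  qed
  then obtain B where B: "\<And>k. B k \<in> hausdorff_covers \<delta> (A k)"
    and Ble: "\<And>k. (\<Sum>i. hausdorff_gauge n (B k i))
                < hausdorff_pre n \<delta> (A k) + ennreal (?e k)"
    by metis
  define C where "C = case_prod B \<circ> prod_decode"
  have "C \<in> hausdorff_covers \<delta> (\<Union>i. A i)"
    using B unfolding hausdorff_covers_def C_def
    by (auto simp: split_def subset_eq) (metis fst_conv prod_encode_inverse snd_conv)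
  then have "hausdorff_pre n \<delta> (\<Union>i. A i) \<le> (\<Sum>i. hausdorff_gauge n (C i))"
    unfolding hausdorff_pre_eq by (rule INF_lower)
  also have "\<dots> = (\<Sum>k. \<Sum>i. hausdorff_gauge n (B k i))"
    using suminf_ennreal_2dimen[of "\<lambda>k. \<Sum>i. hausdorff_gauge n (B k i)"
        "\<lambda>x. hausdorff_gauge n (case_prod B x)"]
    unfolding C_def comp_def by simp
  also have "\<dots> \<le> (\<Sum>k. hausdorff_pre n \<delta> (A k) + ennreal (?e k))"
    using Ble by (intro suminf_le) (auto intro: less_imp_le)
  also have "\<dots> = (\<Sum>k. hausdorff_pre n \<delta> (A k)) + (\<Sum>k. ennreal e * ennreal ((1/2) ^ Suc k))"
    using \<open>0 < e\<close> by (subst suminf_add[symmetric])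
      (auto simp del: ennreal_suminf_cmult simp add: ennreal_mult[symmetric])
  also have "\<dots> = (\<Sum>k. hausdorff_pre n \<delta> (A k)) + e"
    unfolding ennreal_suminf_cmult
    by (subst suminf_ennreal_eq[OF zero_le_power power_half_series]) auto
  finally show "hausdorff_pre n \<delta> (\<Union>i. A i) \<le> (\<Sum>i. hausdorff_pre n \<delta> (A i)) + ennreal e" .
qed

lemma hausdorff_outer_mono: "A \<subseteq> B \<Longrightarrow> hausdorff_outer n A \<le> hausdorff_outer n B"
  unfolding hausdorff_outer_def by (intro SUP_mono) (auto intro: hausdorff_pre_mono)

lemma hausdorff_outer_empty [simp]: "hausdorff_outer n {} = 0"
  unfolding hausdorff_outer_def by (simp add: hausdorff_pre_empty SUP_constant cong: SUP_cong_simp)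

lemma hausdorff_pre_le_outer: "\<delta> > 0 \<Longrightarrow> hausdorff_pre n \<delta> A \<le> hausdorff_outer n A"
  unfolding hausdorff_outer_def by (rule SUP_upper) simp

lemma hausdorff_outer_countably_subadditive:
  fixes A :: "nat \<Rightarrow> 'a::metric_space set"
  shows "hausdorff_outer n (\<Union>i. A i) \<le> (\<Sum>i. hausdorff_outer n (A i))"
  unfolding hausdorff_outer_def[of n "\<Union>i. A i"]
proof (rule SUP_least)
  fix \<delta> :: real assume "\<delta> \<in> {0<..}"
  then have "(\<Sum>i. hausdorff_pre n \<delta> (A i)) \<le> (\<Sum>i. hausdorff_outer n (A i))"
    by (intro suminf_le) (auto intro: hausdorff_pre_le_outer)
  then show "hausdorff_pre n \<delta> (\<Union>i. A i) \<le> (\<Sum>i. hausdorff_outer n (A i))"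
    using hausdorff_pre_countably_subadditive order_trans by blast
qed

lemma hausdorff_outer_space: "outer_measure_space UNIV (hausdorff_outer n)"
  unfolding outer_measure_space_def positive_def increasing_def countably_subadditive_def
  by (auto intro: hausdorff_outer_mono hausdorff_outer_countably_subadditive)

lemma hausdorff_outer_Un: "hausdorff_outer n (A \<union> B) \<le> hausdorff_outer n A + hausdorff_outer n B"
proof -
  interpret sigma_algebra UNIV UNIV using sigma_algebra_Pow[of UNIV] by simp
  have "subadditive UNIV (hausdorff_outer n)"
    using hausdorff_outer_space countably_subadditive_subadditive
    unfolding outer_measure_space_def by blast
  moreover have "hausdorff_outer n (A \<union> B) = hausdorff_outer n (A \<union> (B - A))" by simp
  ultimately have "hausdorff_outer n (A \<union> B) \<le> hausdorff_outer n A + hausdorff_outer n (B - A)"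
    unfolding subadditive_def by (metis Diff_disjoint UNIV_I)
  also have "\<dots> \<le> hausdorff_outer n A + hausdorff_outer n B"
    by (intro add_left_mono hausdorff_outer_mono) auto
  finally show ?thesis .
qed

section \<open>Additivity on separated sets and the Caratheodory criterion\<close>

lemma hausdorff_pre_separated:
  fixes A B :: "'a::metric_space set"
  assumes sep: "\<And>x y. x \<in> A \<Longrightarrow> y \<in> B \<Longrightarrow> \<delta> < dist x y"
  shows "hausdorff_pre n \<delta> A + hausdorff_pre n \<delta> B \<le> hausdorff_pre n \<delta> (A \<union> B)"
  unfolding hausdorff_pre_eq[of n \<delta> "A \<union> B"]
proof (rule INF_greatest)
  fix C assume C: "C \<in> hausdorff_covers \<delta> (A \<union> B)"
  define CA where "CA i = (if C i \<inter> A = {} then {} else C i)" for i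
  define CB where "CB i = (if C i \<inter> B = {} then {} else C i)" for i
  \<comment> \<open>A set of diameter at most \<open>\<delta>\<close> is too small to meet both
    sides, so the cover splits into one of \<open>A\<close> and one of \<open>B\<close>.\<close>
  have "\<not> (C i \<inter> A \<noteq> {} \<and> C i \<inter> B \<noteq> {})" for i
  proof
    assume "C i \<inter> A \<noteq> {} \<and> C i \<inter> B \<noteq> {}"
    then obtain x y where xy: "x \<in> C i" "x \<in> A" "y \<in> C i" "y \<in> B" by auto
    have "dist x y \<le> diameter (C i)"
      using C xy by (intro diameter_bounded_bound) (auto simp: hausdorff_covers_def)
    also have "\<dots> \<le> \<delta>" using C by (auto simp: hausdorff_covers_def)
    finally show False using sep[OF xy(2,4)] by simp
  qed
  then have sum: "hausdorff_gauge n (CA i) + hausdorff_gauge n (CB i) \<le> hausdorff_gauge n (C i)" for i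
    by (auto simp: CA_def CB_def)
  have pos: "0 \<le> \<delta>"
    using C diameter_ge_0[of "C 0"] order_trans unfolding hausdorff_covers_def by blast
  have "CA \<in> hausdorff_covers \<delta> A" "CB \<in> hausdorff_covers \<delta> B"
    using C pos unfolding hausdorff_covers_def CA_def CB_def by (auto simp: subset_eq Bex_def) blast+
  then have "hausdorff_pre n \<delta> A + hausdorff_pre n \<delta> B
      \<le> (\<Sum>i. hausdorff_gauge n (CA i)) + (\<Sum>i. hausdorff_gauge n (CB i))"
    unfolding hausdorff_pre_eq by (intro add_mono INF_lower)
  also have "\<dots> = (\<Sum>i. hausdorff_gauge n (CA i) + hausdorff_gauge n (CB i))"
    by (rule suminf_add) auto
  also have "\<dots> \<le> (\<Sum>i. hausdorff_gauge n (C i))"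
    by (intro suminf_le sum) auto
  finally show "hausdorff_pre n \<delta> A + hausdorff_pre n \<delta> B \<le> (\<Sum>i. hausdorff_gauge n (C i))" .
qed

lemma hausdorff_outer_separated:
  fixes A B :: "'a::metric_space set"
  assumes "0 < d" and sep: "\<And>x y. x \<in> A \<Longrightarrow> y \<in> B \<Longrightarrow> d \<le> dist x y"
  shows "hausdorff_outer n A + hausdorff_outer n B \<le> hausdorff_outer n (A \<union> B)"
proof -
  have *: "hausdorff_pre n a A + hausdorff_pre n b B \<le> hausdorff_outer n (A \<union> B)"
    if "a \<in> {0<..}" "b \<in> {0<..}" for a b
  proof -
    define \<delta> where "\<delta> = min (min a b) (d/2)"
    have \<delta>: "0 < \<delta>" "\<delta> \<le> a" "\<delta> \<le> b" "\<delta> < d" using that assms(1) by (auto simp: \<delta>_def)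
    have "hausdorff_pre n a A + hausdorff_pre n b B \<le> hausdorff_pre n \<delta> A + hausdorff_pre n \<delta> B"
      using \<delta> by (intro add_mono hausdorff_pre_antimono)
    also have "\<dots> \<le> hausdorff_pre n \<delta> (A \<union> B)"
      using sep \<delta> by (intro hausdorff_pre_separated) force
    also have "\<dots> \<le> hausdorff_outer n (A \<union> B)" using \<delta> by (intro hausdorff_pre_le_outer)
    finally show ?thesis .
  qed
  have ne: "{0::real<..} \<noteq> {}" by auto
  have "hausdorff_outer n A + hausdorff_pre n b B \<le> hausdorff_outer n (A \<union> B)" if "b \<in> {0<..}" for b
    unfolding hausdorff_outer_def[of n A] using that *
    by (subst ennreal_SUP_add_left[symmetric, OF ne]) (auto intro!: SUP_least)
  then show ?thesis
    unfolding hausdorff_outer_def[of n B]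
    by (subst ennreal_SUP_add_right[OF ne]) (auto intro!: SUP_least)
qed

lemma hausdorff_outer_separated_sum:
  fixes R :: "nat \<Rightarrow> 'a::metric_space set"
  assumes sep: "\<And>i. \<exists>d>0. \<forall>j<i. \<forall>x\<in>R i. \<forall>y\<in>R j. d \<le> dist x y"
  shows "(\<Sum>i<m. hausdorff_outer n (R i)) \<le> hausdorff_outer n (\<Union>i<m. R i)"
proof (induction m)
  case (Suc m)
  obtain d where d: "d > 0" "\<forall>j<m. \<forall>x\<in>R m. \<forall>y\<in>R j. d \<le> dist x y" using sep by blast
  have "(\<Sum>i<Suc m. hausdorff_outer n (R i)) \<le> hausdorff_outer n (\<Union>i<m. R i) + hausdorff_outer n (R m)"
    using Suc by (simp add: add_right_mono)
  also have "\<dots> \<le> hausdorff_outer n ((\<Union>i<m. R i) \<union> R m)"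
    using d by (intro hausdorff_outer_separated[of d]) (auto, metis dist_commute)
  also have "(\<Union>i<m. R i) \<union> R m = (\<Union>i<Suc m. R i)" by (auto simp: less_Suc_eq)
  finally show ?case .
qed simp

text \<open>\<open>A' k\<close> keeps distance \<open>1 / real (Suc k)\<close> from
  \<open>F\<close>, so additivity holds for \<open>A \<inter> F\<close> and \<open>A' k\<close>.
  What is missing from \<open>A - F\<close> consists of thin shells \<open>R j\<close> with
  \<open>j \<ge> k\<close>, whose measures are summable and therefore have small tails.\<close>

lemma hausdorff_outer_closed_split:
  fixes F A :: "'a::metric_space set"
  assumes F: "closed F"
  shows "hausdorff_outer n (A \<inter> F) + hausdorff_outer n (A - F) \<le> hausdorff_outer n A"
proof (cases "F = {} \<or> hausdorff_outer n A = top")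
  case True
  then show ?thesis by auto
next
  let ?H = "hausdorff_outer n :: 'a set \<Rightarrow> _"
  case False
  then have ne: "F \<noteq> {}" and fin: "?H A < top" by (auto simp: less_top)
  define A' where "A' k = {x \<in> A. 1 / real (Suc k) \<le> infdist x F}" for k
  define R where "R k = {x \<in> A. 1 / real (Suc (Suc k)) \<le> infdist x F \<and> infdist x F < 1 / real (Suc k)}" for k
  have near: "1 / real (Suc k) \<le> dist x y + infdist y F" if "1 / real (Suc k) \<le> infdist x F" for k x y
    using infdist_triangle[of x F y] that by linarith
  have sepR: "1 / real (Suc (Suc k)) - 1 / real (Suc l) \<le> dist x y"
    if "x \<in> R k" "y \<in> R l" for k l x y
    using infdist_triangle[of x F y] that unfolding R_def by auto
  have decr: "1 / real (Suc l) < 1 / real (Suc (Suc k))" if "l > Suc k" for k l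
    using that by (intro divide_strict_left_mono) auto
  \<comment> \<open>Only every second shell is summed, because neighbouring shells need not have
    positive distance; \<open>p\<close> will be the parity.\<close>
  have sums: "(\<Sum>i<m. ?H (R (2 * i + p))) \<le> ?H A" for m p
  proof -
    have "(\<Sum>i<m. ?H (R (2 * i + p))) \<le> ?H (\<Union>i<m. R (2 * i + p))"
    proof (rule hausdorff_outer_separated_sum)
      fix i
      show "\<exists>d>0. \<forall>j<i. \<forall>x\<in>R (2 * i + p). \<forall>y\<in>R (2 * j + p). d \<le> dist x y"
      proof (cases i)
        case (Suc i')
        \<comment> \<open>The width of the omitted shell in between. Since \<open>i\<close> is a
          successor, the subtraction does not truncate.\<close>
        define d where "d = 1 / real (Suc (2 * i + p - 1)) - 1 / real (Suc (2 * i + p))"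
        have "d > 0" unfolding d_def
            using Suc divide_strict_left_mono[of "real (Suc (2 * i + p - 1))" "real (Suc (2 * i + p))" 1] by simp
        moreover have "d \<le> dist x y" if "j < i" "x \<in> R (2 * i + p)" "y \<in> R (2 * j + p)" for j x y
        proof -
          have "1 / real (Suc (2 * i + p - 1)) \<le> 1 / real (Suc (Suc (2 * j + p)))"
            using that(1) by (intro divide_left_mono) auto
          then show ?thesis
            using sepR[OF that(3,2)] unfolding d_def by (simp add: dist_commute)
        qed
        ultimately show ?thesis by blast
      qed (auto intro: exI[of _ 1])
    qed
    also have "\<dots> \<le> ?H A"
      by (intro hausdorff_outer_mono) (auto simp: R_def)
    finally show ?thesis .
  qed
  have sum_le: "(\<Sum>i<m. ?H (R i)) \<le> 2 * ?H A" for m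
  proof -
    have "(\<Sum>i<m. ?H (R i)) \<le> (\<Sum>i<2*m. ?H (R i))"
      by (rule sum_mono2) auto
    also have "\<dots> = (\<Sum>i<m. ?H (R (2 * i + 0))) + (\<Sum>i<m. ?H (R (2 * i + 1)))"
      by (induction m) (auto simp: algebra_simps)
    also have "\<dots> \<le> ?H A + ?H A"
      by (intro add_mono sums)
    finally show ?thesis by (simp add: mult_2)
  qed
  have fin_sum: "(\<Sum>i. ?H (R i)) < top"
  proof -
    have "(\<Sum>i. ?H (R i)) \<le> 2 * ?H A"
      using sum_le by (intro suminf_le_const) auto
    also have "\<dots> < top" using fin by (simp add: ennreal_mult_less_top)
    finally show ?thesis .
  qed
  have finR: "?H (R i) < top" for i
    using fin_sum ennreal_suminf_lessD by blast
  define r where "r i = enn2real (?H (R i))" for i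
  have r: "?H (R i) = ennreal (r i)" "0 \<le> r i" for i
    using finR[of i] by (auto simp: r_def)
  have "summable r"
    using fin_sum r by (intro summable_suminf_not_top) (auto simp: less_top)
  show ?thesis
  proof (rule ennreal_le_epsilon)
    fix e :: real assume "0 < e"
    obtain k where k: "\<And>m. m \<ge> k \<Longrightarrow> norm (\<Sum>i. r (i + m)) < e"
      using suminf_exist_split[OF \<open>0 < e\<close> \<open>summable r\<close>] by blast
    have cover: "A - F \<subseteq> A' k \<union> (\<Union>i. R (i + k))"
    proof
      fix x assume x: "x \<in> A - F"
      have "0 < infdist x F"
        using x ne F by (meson Diff_iff infdist_pos_not_in_closed)
      then obtain l where l: "1 / real (Suc l) < infdist x F"
        using reals_Archimedean by (metis inverse_eq_divide)
      show "x \<in> A' k \<union> (\<Union>i. R (i + k))"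
      proof (cases "1 / real (Suc k) \<le> infdist x F")
        case False
        \<comment> \<open>The first threshold reached by the distance of \<open>x\<close>; then
          \<open>x\<close> lies in the shell with index \<open>j - 1\<close>.\<close>
        define j where "j = (LEAST l. 1 / real (Suc l) \<le> infdist x F)"
        have j: "1 / real (Suc j) \<le> infdist x F"
          unfolding j_def using l by (intro LeastI) (rule less_imp_le)
        have "\<not> j \<le> k"
        proof
          assume "j \<le> k"
          then have "1 / real (Suc k) \<le> 1 / real (Suc j)" by (intro divide_left_mono) auto
          then show False using j False by linarith
        qed
        then obtain i where i: "j = Suc (i + k)" using less_imp_Suc_add[of k j] by (auto simp: ac_simps)
        have "infdist x F < 1 / real (Suc (i + k))"
          using not_less_Least[of "i + k" "\<lambda>l. 1 / real (Suc l) \<le> infdist x F"] i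
          unfolding j_def[symmetric] by auto
        then have "x \<in> R (i + k)" using x j i by (auto simp: R_def)
        then show ?thesis by blast
      qed (use x in \<open>auto simp: A'_def\<close>)
    qed
    have "?H (A - F) \<le> ?H (A' k) + ?H (\<Union>i. R (i + k))"
      using hausdorff_outer_mono[OF cover] hausdorff_outer_Un order_trans by blast
    also have "\<dots> \<le> ?H (A' k) + (\<Sum>i. ennreal (r (i + k)))"
      using hausdorff_outer_countably_subadditive[of n "\<lambda>i. R (i + k)"] r
      by (intro add_left_mono) simp
    also have "(\<Sum>i. ennreal (r (i + k))) = ennreal (\<Sum>i. r (i + k))"
      using r \<open>summable r\<close> by (intro suminf_ennreal2) (auto simp: summable_iff_shift)
    also have "?H (A' k) + \<dots> \<le> ?H (A' k) + ennreal e"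
      using k[of k] by (intro add_left_mono ennreal_leI) auto
    finally have 1: "?H (A - F) \<le> ?H (A' k) + ennreal e" .
    have "?H (A \<inter> F) + ?H (A' k) \<le> ?H ((A \<inter> F) \<union> A' k)"
    proof (rule hausdorff_outer_separated[of "1 / real (Suc k)"])
      fix x y assume "x \<in> A \<inter> F" "y \<in> A' k"
      then show "1 / real (Suc k) \<le> dist x y"
        using infdist_le[of x F y] unfolding A'_def by (auto simp: dist_commute)
    qed auto
    also have "\<dots> \<le> ?H A"
      by (intro hausdorff_outer_mono) (auto simp: A'_def)
    finally have 2: "?H (A \<inter> F) + ?H (A' k) \<le> ?H A" .
    have "?H (A \<inter> F) + ?H (A - F)
        \<le> (?H (A \<inter> F) + ?H (A' k)) + ennreal e"
      using add_left_mono[OF 1] by (simp add: add.assoc)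
    also have "\<dots> \<le> ?H A + ennreal e" using 2 by (rule add_right_mono)
    finally show "?H (A \<inter> F) + ?H (A - F) \<le> ?H A + ennreal e" .
  qed
qed

lemma sets_hausdorff_measure [simp, measurable_cong]: "sets (hausdorff_measure n) = sets borel"
  unfolding hausdorff_measure_def using sets.sigma_sets_eq[of borel] by (simp add: sets_measure_of)

lemma space_hausdorff_measure [simp]: "space (hausdorff_measure n) = UNIV"
  unfolding hausdorff_measure_def by (simp add: space_measure_of)

text \<open>Closed sets are Caratheodory measurable, so the Borel sets are too, and the outer
  measure is countably additive on them; only then does \<open>measure_of\<close> return it.\<close>

lemma emeasure_hausdorff_measure:
  fixes A :: "'a::metric_space set"
  assumes "A \<in> sets borel"
  shows "emeasure (hausdorff_measure n) A = hausdorff_outer n A"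
proof -
  interpret sigma_algebra UNIV "UNIV :: 'a set set" using sigma_algebra_Pow[of UNIV] by simp
  define L where "L = lambda_system UNIV UNIV (hausdorff_outer n :: 'a set \<Rightarrow> _)"
  have L: "measure_space UNIV L (hausdorff_outer n)"
    unfolding L_def using caratheodory_lemma[OF hausdorff_outer_space] .
  then interpret L: sigma_algebra UNIV L by (simp add: measure_space_def)
  have "F \<in> L" if "closed F" for F
  proof -
    have "hausdorff_outer n (x \<inter> F) + hausdorff_outer n (x - F) = hausdorff_outer n x" for x
      using hausdorff_outer_closed_split[OF that, of n x] hausdorff_outer_Un[of n "x \<inter> F" "x - F"]
      by (intro antisym) (auto simp: Int_Diff_Un)
    then show ?thesis unfolding L_def lambda_system_eq by auto
  qed
  then have sub: "sets borel \<subseteq> L"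
    unfolding borel_eq_closed using L.sigma_sets_subset[of "Collect closed"]
    by (simp add: subset_eq sets_measure_of)
  have "measure_space UNIV (sets borel) (hausdorff_outer n :: 'a set \<Rightarrow> _)"
  proof -
    have "sigma_algebra UNIV (sets borel :: 'a set set)"
      using sets.sigma_algebra_axioms[of borel] by simp
    moreover have "countably_additive (sets borel) (hausdorff_outer n :: 'a set \<Rightarrow> _)"
      using L sub unfolding measure_space_def countably_additive_def by blast
    ultimately show ?thesis by (auto simp: measure_space_def positive_def)
  qed
  then show ?thesis
    unfolding hausdorff_measure_def
    using sets.sigma_sets_eq[of borel] assms
    by (intro emeasure_measure_of_sigma) (auto simp: measure_space_def)
qed

section \<open>Finite and positive area of Lipschitz pieces\<close>

lemma hausdorff_pre_finite_cover:
  fixes A :: "'a::metric_space set" and C :: "'i \<Rightarrow> 'a set"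
  assumes I: "finite I" and A: "A \<subseteq> (\<Union>i\<in>I. C i)" and \<delta>: "0 \<le> \<delta>"
    and C: "\<And>i. i \<in> I \<Longrightarrow> bounded (C i) \<and> diameter (C i) \<le> \<delta>"
  shows "hausdorff_pre n \<delta> A \<le> (\<Sum>i\<in>I. hausdorff_gauge n (C i))"
proof -
  obtain h where h: "bij_betw h {0..<card I} I" using ex_bij_betw_nat_finite[OF I] by blast
  define D where "D k = (if k < card I then C (h k) else {})" for k
  have mem: "h k \<in> I" if "k < card I" for k using h that by (auto simp: bij_betw_def)
  have "A \<subseteq> (\<Union>k. D k)"
  proof
    fix x assume "x \<in> A"
    then obtain i where "i \<in> I" "x \<in> C i" using A by auto
    moreover obtain k where "k < card I" "h k = i"
      using h \<open>i \<in> I\<close> unfolding bij_betw_def by (metis atLeastLessThan_iff imageE)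
    ultimately show "x \<in> (\<Union>k. D k)" by (auto simp: D_def)
  qed
  then have "D \<in> hausdorff_covers \<delta> A"
    using C mem \<delta> by (auto simp: hausdorff_covers_def D_def)
  then have "hausdorff_pre n \<delta> A \<le> (\<Sum>k. hausdorff_gauge n (D k))"
    unfolding hausdorff_pre_eq by (rule INF_lower)
  also have "\<dots> = (\<Sum>k\<in>{0..<card I}. hausdorff_gauge n (D k))"
    by (rule suminf_finite) (auto simp: D_def)
  also have "\<dots> = (\<Sum>k\<in>{0..<card I}. hausdorff_gauge n (C (h k)))"
    by (rule sum.cong) (auto simp: D_def)
  also have "\<dots> = (\<Sum>i\<in>I. hausdorff_gauge n (C i))"
    by (rule sum.reindex_bij_betw[OF h])
  finally show ?thesis .
qed

lemma hausdorff_gauge_le: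
  fixes S :: "'a::metric_space set"
  assumes "bounded S" "diameter S \<le> d"
  shows "hausdorff_gauge n S \<le> ennreal (unit_ball_vol (real n) * (d / 2) ^ n)"
  unfolding hausdorff_gauge_def using assms diameter_ge_0[OF assms(1)]
  by (auto intro!: ennreal_leI mult_left_mono power_mono)

definition euc_cube :: "nat \<Rightarrow> fseq \<Rightarrow> real \<Rightarrow> fseq set" where
  "euc_cube n w r = {y \<in> euc n. \<forall>j<n. coord w j \<le> coord y j \<and> coord y j \<le> coord w j + r}"

lemma dist_euc_le:
  assumes "x \<in> euc n" "y \<in> euc n" "\<And>j. j < n \<Longrightarrow> \<bar>coord x j - coord y j\<bar> \<le> d"
  shows "dist x y \<le> real n * d"
proof -
  have "x - y \<in> euc n" using assms(1,2) subspace_euc subspace_diff by blast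
  then have "norm (x - y) = norm (\<Sum>j<n. coord (x - y) j *\<^sub>R bas j)" using euc_expand by metis
  also have "\<dots> \<le> (\<Sum>j<n. \<bar>coord (x - y) j\<bar>)" by (rule order_trans[OF norm_sum]) simp
  also have "\<dots> \<le> (\<Sum>j<n. d)" using assms(3) by (intro sum_mono) simp
  finally show ?thesis by (simp add: dist_norm)
qed

lemma coord_diff_le_dist: "\<bar>coord x j - coord y j\<bar> \<le> dist x y"
  using Cauchy_Schwarz_ineq2[of "x - y" "bas j"] by (simp add: dist_norm)

text \<open>Subdividing the cube into \<open>m\<^sup>n\<close> cubes of side \<open>r / m\<close>, the sums over the covers do not depend on \<open>m\<close>.\<close>

lemma hausdorff_outer_lipschitz_cube_finite:
  fixes f :: "fseq \<Rightarrow> 'a::metric_space"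
  assumes r: "r > 0" and L: "L > 0"
    and lip: "\<And>x y. x \<in> euc_cube n w r \<Longrightarrow> y \<in> euc_cube n w r \<Longrightarrow> dist (f x) (f y) \<le> L * dist x y"
  shows "hausdorff_outer n (f ` euc_cube n w r) < top"
proof -
  define K where "K = ennreal (unit_ball_vol (real n) * (L * real n * r / 2) ^ n)"
  have "hausdorff_pre n \<delta> (f ` euc_cube n w r) \<le> K" if "\<delta> > 0" for \<delta>
  proof -
    obtain m0 where m0: "L * (real n * r) / \<delta> < real m0" using reals_Archimedean2 by blast
    define m where "m = Suc m0"
    have m: "L * (real n * (r / m)) \<le> \<delta>" "m > 0"
    proof -
      have "L * (real n * r) / \<delta> \<le> real m" using m0 by (simp add: m_def)
      then show "L * (real n * (r / m)) \<le> \<delta>" using that by (simp add: field_simps m_def)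
    qed (simp add: m_def)
    define I where "I = PiE {..<n} (\<lambda>_. {..<m})"
    define Q where "Q h = {y \<in> euc_cube n w r. \<forall>j<n. coord w j + real (h j) * (r/m) \<le> coord y j
        \<and> coord y j \<le> coord w j + real (h j) * (r/m) + r/m}" for h :: "nat \<Rightarrow> nat"
    have fin: "finite I" unfolding I_def by (intro finite_PiE) auto
    have card: "card I = m ^ n" unfolding I_def by (simp add: card_PiE)
    have diam: "bounded (f ` Q h) \<and> diameter (f ` Q h) \<le> L * (real n * (r / m))" for h
    proof -
      have *: "dist a b \<le> L * (real n * (r / m))" if "a \<in> f ` Q h" "b \<in> f ` Q h" for a b
      proof -
        obtain x y where xy: "x \<in> Q h" "y \<in> Q h" "a = f x" "b = f y"
          using \<open>a \<in> f ` Q h\<close> \<open>b \<in> f ` Q h\<close> by blast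
        have "dist x y \<le> real n * (r / m)"
          using xy(1,2) by (intro dist_euc_le) (force simp: Q_def euc_cube_def abs_le_iff)+
        then have "L * dist x y \<le> L * (real n * (r / m))" using L by (intro mult_left_mono) auto
        then show ?thesis using lip[of x y] xy by (auto simp: Q_def)
      qed
      have "0 \<le> L * (real n * (r / m))" using L r m by simp
      then have "diameter (f ` Q h) \<le> L * (real n * (r / m))"
        unfolding diameter_def using * by (auto intro!: cSUP_least simp del: image_eqI)
      then show ?thesis using * by (auto simp: bounded_two_points intro!: exI[of _ "L * (real n * (r / m))"])
    qed
    have cover: "f ` euc_cube n w r \<subseteq> (\<Union>h\<in>I. f ` Q h)"
    proof -
      have "euc_cube n w r \<subseteq> (\<Union>h\<in>I. Q h)"
      proof
        fix y assume y: "y \<in> euc_cube n w r"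
        \<comment> \<open>The minimum puts points on the far face of the cube into the last layer of
          subcubes.\<close>
        define g where "g j = min (m - 1) (nat \<lfloor>(coord y j - coord w j) / (r/m)\<rfloor>)" for j
        have "coord w j + real (g j) * (r/m) \<le> coord y j \<and> coord y j \<le> coord w j + real (g j) * (r/m) + r/m"
          if "j < n" for j
        proof -
          define t where "t = (coord y j - coord w j) / (r/m)"
          have rm: "r / m > 0" using r m by simp
          have t: "0 \<le> t" "t \<le> m"
            using y that m(2) unfolding t_def pos_divide_le_eq[OF rm] pos_le_divide_eq[OF rm]
            by (auto simp: euc_cube_def)
          have "real (g j) \<le> t \<and> t \<le> real (g j) + 1"
          proof (cases "nat \<lfloor>t\<rfloor> \<le> m - 1")
            case True
            then have "g j = nat \<lfloor>t\<rfloor>" by (simp add: g_def t_def)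
            then show ?thesis using t(1) by (simp add: of_nat_floor)
          next
            case False
            then have "g j = m - 1" by (simp add: g_def t_def)
            moreover have "real m \<le> t" using False t m by linarith
            ultimately show ?thesis using t m by (simp add: of_nat_diff)
          qed
          then have "real (g j) * (r/m) \<le> t * (r/m)" "t * (r/m) \<le> (real (g j) + 1) * (r/m)"
            using rm by (auto intro!: mult_right_mono simp del: times_divide_eq_right)
          moreover have "t * (r/m) = coord y j - coord w j" using r m(2) unfolding t_def by simp
          ultimately show ?thesis by (simp add: algebra_simps)
        qed
        then have "y \<in> Q (restrict g {..<n})" using y by (auto simp: Q_def)
        moreover have "restrict g {..<n} \<in> I" using m by (auto simp: I_def g_def)
        ultimately show "y \<in> (\<Union>h\<in>I. Q h)" by blast
      qed
      then show ?thesis by blast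
    qed
    have "hausdorff_pre n \<delta> (f ` euc_cube n w r) \<le> (\<Sum>h\<in>I. hausdorff_gauge n (f ` Q h))"
    proof (rule hausdorff_pre_finite_cover[OF fin cover])
      show "bounded (f ` Q h) \<and> diameter (f ` Q h) \<le> \<delta>" for h
        using diam[of h] m(1) by linarith
    qed (use that in simp)
    also have "\<dots> \<le> (\<Sum>h\<in>I. ennreal (unit_ball_vol (real n) * (L * (real n * (r / m)) / 2) ^ n))"
      using diam by (intro sum_mono hausdorff_gauge_le) auto
    also have "\<dots> = ennreal (real (m ^ n) * (unit_ball_vol (real n) * (L * (real n * (r / m)) / 2) ^ n))"
      using L r by (simp add: card ennreal_mult ennreal_of_nat_eq_real_of_nat)
    also have "real (m ^ n) * (unit_ball_vol (real n) * (L * (real n * (r / m)) / 2) ^ n)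
        = unit_ball_vol (real n) * (L * real n * r / 2) ^ n"
      using m(2) by (simp add: power_divide power_mult_distrib field_simps)
    finally show ?thesis by (simp add: K_def)
  qed
  then have "hausdorff_outer n (f ` euc_cube n w r) \<le> K"
    unfolding hausdorff_outer_def by (intro SUP_least) auto
  also have "K < top" by (simp add: K_def)
  finally show ?thesis .
qed

text \<open>A set of diameter \<open>d\<close> projects into a box of side \<open>2 d\<close>, so a cover of a unit cube
  by sets of diameter \<open>d\<^sub>i\<close> satisfies \<open>1 \<le> \<Sum> (2 d\<^sub>i)\<^sup>n\<close> by subadditivity of Lebesgue measure.\<close>

lemma euc_cube_cover_sum:
  fixes C :: "nat \<Rightarrow> fseq set"
  assumes r: "r \<ge> 0" and cover: "euc_cube n w r \<subseteq> (\<Union>i. C i)"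
    and C: "\<And>i. d i \<ge> 0" "\<And>i x y. x \<in> C i \<Longrightarrow> y \<in> C i \<Longrightarrow> dist x y \<le> d i"
  shows "ennreal (r ^ n) \<le> (\<Sum>i. if C i = {} then 0 else ennreal ((2 * d i) ^ n))"
proof -
  interpret finite_product_sigma_finite "\<lambda>_. lborel :: real measure" "{..<n}"
    by unfold_locales auto
  define M where "M = PiM {..<n} (\<lambda>_. lborel :: real measure)"
  define z where "z i = (SOME x. x \<in> C i)" for i
  define X where "X i = (if C i = {} then {} else PiE {..<n} (\<lambda>j. {coord (z i) j - d i .. coord (z i) j + d i}))" for i
  have box: "PiE {..<n} (\<lambda>j. {a j .. b j}) \<in> sets M" for a b :: "nat \<Rightarrow> real"
    unfolding M_def by (intro sets_PiM_I_finite) auto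
  have X: "range X \<subseteq> sets M" using box by (auto simp: X_def)
  have emX: "emeasure M (X i) = (if C i = {} then 0 else ennreal ((2 * d i) ^ n))" for i
  proof (cases "C i = {}")
    case False
    then have "emeasure M (X i) = (\<Prod>j<n. emeasure lborel {coord (z i) j - d i .. coord (z i) j + d i})"
      unfolding M_def X_def by (simp add: emeasure_PiM)
    also have "\<dots> = (\<Prod>j<n. ennreal (2 * d i))" using C(1)[of i] by (intro prod.cong) auto
    also have "\<dots> = ennreal ((2 * d i) ^ n)" using C(1)[of i] by (simp add: ennreal_power)
    finally show ?thesis using False by simp
  qed (simp add: X_def)
  have "PiE {..<n} (\<lambda>j. {coord w j .. coord w j + r}) \<subseteq> (\<Union>i. X i)"
  proof
    fix f assume f: "f \<in> PiE {..<n} (\<lambda>j. {coord w j .. coord w j + r})"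
    define y where "y = (\<Sum>j<n. f j *\<^sub>R bas j)"
    have cy: "coord y j = (if j < n then f j else 0)" for j
      by (simp add: y_def coord_sum coord_bas if_distrib[of "\<lambda>x. _ * x"] cong: if_cong)
    have "y \<in> euc_cube n w r" using f by (auto simp: euc_cube_def euc_def cy PiE_iff)
    then obtain i where i: "y \<in> C i" using cover by auto
    then have "z i \<in> C i" unfolding z_def by (rule someI)
    then have "\<bar>coord y j - coord (z i) j\<bar> \<le> d i" for j
      using C(2)[OF i] coord_diff_le_dist order_trans by blast
    then have "f j \<in> {coord (z i) j - d i .. coord (z i) j + d i}" if "j < n" for j
      using that cy[of j] by (auto simp: abs_le_iff) (smt (verit) abs_le_iff)+
    then have "f \<in> X i" using f i by (auto simp: X_def PiE_iff)
    then show "f \<in> (\<Union>i. X i)" by blast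
  qed
  then have "emeasure M (PiE {..<n} (\<lambda>j. {coord w j .. coord w j + r})) \<le> emeasure M (\<Union>i. X i)"
    using X by (intro emeasure_mono) auto
  also have "\<dots> \<le> (\<Sum>i. emeasure M (X i))" by (rule emeasure_subadditive_countably[OF X])
  also have "emeasure M (PiE {..<n} (\<lambda>j. {coord w j .. coord w j + r})) = (\<Prod>j<n. ennreal r)"
    unfolding M_def using r by (simp add: emeasure_PiM)
  also have "\<dots> = ennreal (r ^ n)" using r by (simp add: ennreal_power)
  finally show ?thesis unfolding emX .
qed

text \<open>A cover of \<open>S\<close> is pushed forward to a cover of the cube. Diameters grow at
  most by the factor \<open>L\<close>, so the sums of gauges are bounded below by the volume of the
  cube.\<close>

lemma hausdorff_outer_lipschitz_cube_pos:
  fixes S :: "'a::metric_space set"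
  assumes r: "r > 0" and L: "L > 0"
    and cover: "euc_cube n w r \<subseteq> f ` S"
    and lip: "\<And>x y. x \<in> S \<Longrightarrow> y \<in> S \<Longrightarrow> dist (f x) (f y) \<le> L * dist x y"
  shows "0 < hausdorff_outer n S"
proof -
  \<comment> \<open>With this constant \<open>c * (2 * (L * d)) ^ n\<close> is the gauge of a
    nonempty set of diameter \<open>d\<close>.\<close>
  define c where "c = unit_ball_vol (real n) / (4 * L) ^ n"
  have c: "c > 0" unfolding c_def using L by (simp add: unit_ball_vol_pos)
  have "ennreal (c * r ^ n) \<le> hausdorff_pre n 1 S"
    unfolding hausdorff_pre_eq
  proof (rule INF_greatest)
    fix C assume C: "C \<in> hausdorff_covers 1 S"
    define D where "D i = f ` (C i \<inter> S)" for i
    have bd: "bounded (C i)" for i using C by (auto simp: hausdorff_covers_def)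
    have "ennreal (r ^ n) \<le> (\<Sum>i. if D i = {} then 0 else ennreal ((2 * (L * diameter (C i))) ^ n))"
    proof (rule euc_cube_cover_sum)
      show "euc_cube n w r \<subseteq> (\<Union>i. D i)"
        using cover C by (fastforce simp: hausdorff_covers_def D_def)
      show "dist x y \<le> L * diameter (C i)" if "x \<in> D i" "y \<in> D i" for i x y
      proof -
        obtain a b where ab: "a \<in> C i \<inter> S" "b \<in> C i \<inter> S" "x = f a" "y = f b" using \<open>x \<in> D i\<close> \<open>y \<in> D i\<close> by (auto simp: D_def)
        have "dist a b \<le> diameter (C i)" using diameter_bounded_bound[OF bd] ab by auto
        then have "L * dist a b \<le> L * diameter (C i)" using L by simp
        then show ?thesis using lip[of a b] ab by auto
      qed
      show "0 \<le> L * diameter (C i)" for i using L diameter_ge_0[OF bd] by simp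
    qed (use r in simp)
    then have "ennreal c * ennreal (r ^ n)
        \<le> ennreal c * (\<Sum>i. if D i = {} then 0 else ennreal ((2 * (L * diameter (C i))) ^ n))"
      by (rule mult_left_mono) simp
    also have "\<dots> = (\<Sum>i. ennreal c * (if D i = {} then 0 else ennreal ((2 * (L * diameter (C i))) ^ n)))"
      by simp
    also have "\<dots> \<le> (\<Sum>i. hausdorff_gauge n (C i))"
    proof (rule suminf_le)
      fix i
      have "c * (2 * (L * diameter (C i))) ^ n = unit_ball_vol (real n) * (diameter (C i) / 2) ^ n"
      proof -
        have "c * (2 * (L * diameter (C i))) ^ n
            = unit_ball_vol (real n) * ((2 * (L * diameter (C i))) / (4 * L)) ^ n"
          unfolding c_def power_divide by simp
        also have "(2 * (L * diameter (C i))) / (4 * L) = diameter (C i) / 2" using L by simp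
        finally show ?thesis .
      qed
      then show "ennreal c * (if D i = {} then 0 else ennreal ((2 * (L * diameter (C i))) ^ n)) \<le> hausdorff_gauge n (C i)"
        using c L diameter_ge_0[OF bd[of i]]
        by (auto simp: hausdorff_gauge_def D_def ennreal_mult[symmetric])
    qed auto
    finally show "ennreal (c * r ^ n) \<le> (\<Sum>i. hausdorff_gauge n (C i))"
      using c r by (simp add: ennreal_mult)
  qed
  also have "\<dots> \<le> hausdorff_outer n S" by (rule hausdorff_pre_le_outer) simp
  finally show ?thesis using c r by (metis ennreal_0 ennreal_less_zero_iff leD le_less_linear mult_pos_pos order_le_less_trans zero_less_power not_gr_zero ennreal_eq_0_iff)
qed

subsection \<open>Area of compact pieces\<close>

lemma euc_mono: "n \<le> N \<Longrightarrow> euc n \<subseteq> euc N"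
  by (auto simp: euc_def)

lemma euc_cube_around:
  assumes z: "z \<in> euc n" and \<rho>: "\<rho> > 0"
  obtains w d where "d > 0" "euc_cube n w (2 * d) \<subseteq> euc n \<inter> ball z \<rho>"
    "\<And>y. y \<in> euc n \<Longrightarrow> dist y z < d \<Longrightarrow> y \<in> euc_cube n w (2 * d)"
proof -
  \<comment> \<open>Points of the cube have distance at most \<open>real n * d\<close> from its
    centre, which is then strictly below \<open>\<rho>\<close>.\<close>
  define d where "d = \<rho> / (real n + 1)"
  define w where "w = z - d *\<^sub>R (\<Sum>j<n. bas j)"
  have d: "d > 0" using \<rho> by (simp add: d_def)
  have nd: "real n * d < \<rho>" using \<rho> by (simp add: d_def field_simps)
  have w: "coord w j = coord z j - d" if "j < n" for j
    using that by (simp add: w_def coord_sum coord_bas)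
  show ?thesis
  proof (rule that[OF d])
    show "euc_cube n w (2 * d) \<subseteq> euc n \<inter> ball z \<rho>"
    proof
      fix y assume y: "y \<in> euc_cube n w (2 * d)"
      then have yn: "y \<in> euc n" by (simp add: euc_cube_def)
      have "dist z y \<le> real n * d"
        using y w by (intro dist_euc_le z yn) (force simp: euc_cube_def abs_le_iff)
      then show "y \<in> euc n \<inter> ball z \<rho>" using nd yn by simp
    qed
    show "y \<in> euc_cube n w (2 * d)" if "y \<in> euc n" "dist y z < d" for y
    proof -
      have "\<bar>coord y j - coord z j\<bar> \<le> d" for j using coord_diff_le_dist[of y j z] that(2) by linarith
      then show ?thesis using that(1) w by (auto simp: euc_cube_def abs_le_iff) (smt (verit))+
    qed
  qed
qed

context slice
begin

text \<open>Near \<open>p\<close> the submanifold lies in the image of a cube under the locally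
  Lipschitz map \<open>\<Psi>\<close>.\<close>

lemma locally_finite_area:
  assumes p: "p \<in> U" "p \<in> \<Sigma>"
  obtains O' where "open O'" "p \<in> O'" "hausdorff_outer n (O' \<inter> \<Sigma>) < top"
proof -
  have \<Phi>p: "\<Phi> p \<in> euc n" "\<Phi> p \<in> V" using p slice by auto
  obtain r L where r: "r > 0" "L > 0"
    and lip: "\<And>x y. x \<in> E \<inter> ball (\<Phi> p) r \<Longrightarrow> y \<in> E \<inter> ball (\<Phi> p) r \<Longrightarrow> dist (\<Psi> x) (\<Psi> y) \<le> L * dist x y"
    using smooth_on_locally_lipschitz[OF onb \<Psi> \<Phi>p(2)] by blast
  obtain w d where d: "d > 0" and cube: "euc_cube n w (2 * d) \<subseteq> euc n \<inter> ball (\<Phi> p) r"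
    and in_cube: "\<And>y. y \<in> euc n \<Longrightarrow> dist y (\<Phi> p) < d \<Longrightarrow> y \<in> euc_cube n w (2 * d)"
    by (rule euc_cube_around[OF \<Phi>p(1) r(1)]) (rule that, assumption+)
  have fin: "hausdorff_outer n (\<Psi> ` euc_cube n w (2 * d)) < top"
    using d r(2) cube euc_mono[OF nN] by (intro hausdorff_outer_lipschitz_cube_finite[of _ L] lip) auto
  have "openin (top_of_set U) (U \<inter> \<Phi> -` ball (\<Phi> p) d)"
    by (intro continuous_openin_preimage_gen smooth_on_continuous_on[OF \<Phi>] open_ball)
  then have "openin (top_of_set E) (U \<inter> \<Phi> -` ball (\<Phi> p) d)" using U openin_trans by blast
  then obtain O' where O: "open O'" "U \<inter> \<Phi> -` ball (\<Phi> p) d = E \<inter> O'" by (auto simp: openin_open)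
  have "O' \<inter> \<Sigma> \<subseteq> \<Psi> ` euc_cube n w (2 * d)"
  proof
    fix q assume "q \<in> O' \<inter> \<Sigma>"
    then have q: "q \<in> \<Sigma>" "q \<in> U" "dist (\<Phi> p) (\<Phi> q) < d" using O sub by auto
    have "\<Phi> q \<in> euc_cube n w (2 * d)"
      using q slice by (intro in_cube) (auto simp: dist_commute)
    then show "q \<in> \<Psi> ` euc_cube n w (2 * d)" using inv[OF q(2)] by (metis imageI)
  qed
  then have "hausdorff_outer n (O' \<inter> \<Sigma>) < top"
    using hausdorff_outer_mono fin by (meson order_le_less_trans)
  moreover have "p \<in> O'" using O p d by auto
  ultimately show ?thesis using that O(1) by blast
qed

text \<open>The locally Lipschitz map \<open>\<Phi>\<close> carries a small piece of
  \<open>\<Sigma>\<close> around \<open>p\<close> onto a set containing a cube.\<close>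

lemma locally_positive_area:
  assumes p: "p \<in> U" "p \<in> \<Sigma>" and O: "open O'" "p \<in> O'"
  shows "0 < hausdorff_outer n (O' \<inter> \<Sigma>)"
proof -
  have \<Phi>p: "\<Phi> p \<in> euc n" "\<Phi> p \<in> V" using p slice by auto
  obtain r L where r: "r > 0" "L > 0"
    and lip: "\<And>x y. x \<in> E \<inter> ball p r \<Longrightarrow> y \<in> E \<inter> ball p r \<Longrightarrow> dist (\<Phi> x) (\<Phi> y) \<le> L * dist x y"
    using smooth_on_locally_lipschitz[OF onb \<Phi> p(1)] by blast
  have "openin (top_of_set V) (V \<inter> \<Psi> -` (O' \<inter> ball p r))"
    using O by (intro continuous_openin_preimage_gen smooth_on_continuous_on[OF \<Psi>] open_Int open_ball)
  then have "openin (top_of_set E) (V \<inter> \<Psi> -` (O' \<inter> ball p r))" using V openin_trans by blast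
  then obtain W where W: "open W" "V \<inter> \<Psi> -` (O' \<inter> ball p r) = E \<inter> W" by (auto simp: openin_open)
  have "\<Phi> p \<in> W" using W \<Phi>p inv[OF p(1)] O r by auto
  then obtain \<rho> where \<rho>: "\<rho> > 0" "ball (\<Phi> p) \<rho> \<subseteq> W" using W(1) open_contains_ball by blast
  obtain w d where d: "d > 0" and cube: "euc_cube n w (2 * d) \<subseteq> euc n \<inter> ball (\<Phi> p) \<rho>"
    by (rule euc_cube_around[OF \<Phi>p(1) \<rho>(1)]) (rule that, assumption+)
  have cover: "euc_cube n w (2 * d) \<subseteq> \<Phi> ` (O' \<inter> \<Sigma> \<inter> ball p r)"
  proof
    fix y assume y: "y \<in> euc_cube n w (2 * d)"
    then have yn: "y \<in> euc n" "y \<in> E \<inter> W" using cube \<rho> euc_mono[OF nN] by auto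
    then have yV: "y \<in> V" "\<Psi> y \<in> O' \<inter> ball p r" using W(2) by auto
    then have "\<Psi> y \<in> O' \<inter> \<Sigma> \<inter> ball p r" using \<Psi>_slice yn by auto
    then show "y \<in> \<Phi> ` (O' \<inter> \<Sigma> \<inter> ball p r)" using inv'[OF yV(1)] by (metis imageI)
  qed
  have "0 < hausdorff_outer n (O' \<inter> \<Sigma> \<inter> ball p r)"
    using d sub by (intro hausdorff_outer_lipschitz_cube_pos[OF _ r(2) cover lip]) auto
  also have "\<dots> \<le> hausdorff_outer n (O' \<inter> \<Sigma>)" by (intro hausdorff_outer_mono) auto
  finally show ?thesis .
qed

end

lemma compact_finite_area:
  assumes K: "compact K" and loc: "\<And>p. p \<in> K \<Longrightarrow> \<exists>O'. open O' \<and> p \<in> O' \<and> hausdorff_outer n (O' \<inter> \<Sigma>) < top"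
    and "K \<subseteq> \<Sigma>"
  shows "hausdorff_outer n K < top"
proof -
  obtain W where W: "\<And>p. p \<in> K \<Longrightarrow> open (W p) \<and> p \<in> W p \<and> hausdorff_outer n (W p \<inter> \<Sigma>) < top"
    using loc by metis
  obtain D where D: "D \<subseteq> K" "finite D" "K \<subseteq> (\<Union>p\<in>D. W p)"
    using compactE_image[OF K, of K W] W by blast
  have "hausdorff_outer n (\<Union>p\<in>D. W p \<inter> \<Sigma>) < top"
    using D(2,1)
  proof (induction D)
    case (insert p D)
    have "hausdorff_outer n (\<Union>p\<in>insert p D. W p \<inter> \<Sigma>)
        \<le> hausdorff_outer n (W p \<inter> \<Sigma>) + hausdorff_outer n (\<Union>p\<in>D. W p \<inter> \<Sigma>)"
      using hausdorff_outer_Un by simp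
    also have "\<dots> < top" using insert W by auto
    finally show ?case .
  qed simp
  moreover have "K \<subseteq> (\<Union>p\<in>D. W p \<inter> \<Sigma>)" using D assms(3) by auto
  ultimately show ?thesis using hausdorff_outer_mono by (meson order_le_less_trans)
qed

section \<open>The destabilising field\<close>

theorem theorem1p8:
  fixes n :: nat
  assumes "n \<ge> 1"
  shows "\<exists>R\<^sub>n :: real. \<forall>(N :: nat) (\<Sigma> :: fseq set) (R :: real).
           N > n \<longrightarrow> properly_embedded N n \<Sigma> \<longrightarrow> shrinker N n \<Sigma> \<longrightarrow> R \<ge> R\<^sub>n \<longrightarrow>
           ball 0 R \<inter> \<Sigma> \<noteq> {} \<longrightarrow> ball 0 R \<inter> mfd_boundary N n \<Sigma> = {} \<longrightarrow>
           gaussian_unstable N n \<Sigma>"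
proof (intro exI[of _ "4 * sqrt (real n) + 1"] allI impI notI)
  fix N :: nat and \<Sigma> :: "fseq set" and R :: real
  assume N: "N > n" and pe: "properly_embedded N n \<Sigma>" and sh: "shrinker N n \<Sigma>"
    and R: "R \<ge> 4 * sqrt (real n) + 1"
    and meets: "ball 0 R \<inter> \<Sigma> \<noteq> {}" and bd: "ball 0 R \<inter> mfd_boundary N n \<Sigma> = {}"
    and stable: "gaussian_stable N n \<Sigma>"
  let ?\<mu> = "hausdorff_measure n :: fseq measure"
  have M: "embedded_submanifold N n \<Sigma>" and proper: "\<And>K. K \<subseteq> euc N \<Longrightarrow> compact K \<Longrightarrow> compact (K \<inter> \<Sigma>)"
    using pe by (auto simp: properly_embedded_def)
  have sub: "\<Sigma> \<subseteq> euc N" using M by (simp add: embedded_submanifold_def)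
  have shr: "\<And>x. x \<in> \<Sigma> \<Longrightarrow> mean_curvature \<Sigma> x = (1/2) *\<^sub>R nor_part \<Sigma> x x"
    using sh by (simp add: shrinker_def)
  have R0: "R > 0" using R real_sqrt_ge_zero[of "real n"] by linarith
  have in_ball: "q \<in> ball 0 R \<longleftrightarrow> inner q q < R\<^sup>2" for q :: fseq
  proof -
    have "norm q < R \<longleftrightarrow> (norm q)\<^sup>2 < R\<^sup>2"
      using R0 power2_less_imp_less[of "norm q" R] power_strict_mono[of "norm q" R 2] by auto
    then show ?thesis by (simp add: power2_norm_eq_inner)
  qed
  have chart: "\<exists>U V \<Phi> \<Psi>. slice N n \<Sigma> U V \<Phi> \<Psi> \<and> q \<in> U" if "q \<in> \<Sigma>" "inner q q < R\<^sup>2" for q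
    using that in_ball[of q] bd by (intro interior_slice[OF M] assms) auto
  obtain p0 where p0: "p0 \<in> \<Sigma>" "inner p0 p0 < R\<^sup>2" using meets in_ball by auto
  \<comment> \<open>The midpoint puts \<open>p0\<close> inside the region where the cutoff is
    positive. The summand 1 in the radius makes \<open>16 * real n < R\<^sup>2\<close> strict, so
    \<open>c < R\<^sup>2\<close> and the supports stay away from the boundary.\<close>
  define c where "c = max (16 * real n) ((inner p0 p0 + R\<^sup>2) / 2)"
  have "(4 * sqrt (real n)) ^ 2 < R ^ 2" using R by (intro power_strict_mono) auto
  then have c: "c \<ge> 16 * real n" "inner p0 p0 < c" "c < R\<^sup>2"
    using p0(2) by (auto simp: c_def power_mult_distrib less_max_iff_disj)
  have c0: "c > 0" using c(1) assms by simp
  define K where "K = {q \<in> \<Sigma>. inner q q \<le> c}"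
  define A where "A = {q \<in> \<Sigma>. inner q q < c}"
  have KS: "K \<subseteq> \<Sigma>" and AK: "A \<subseteq> K" by (auto simp: K_def A_def)
  have "compact K"
  proof -
    have "compact (cball 0 (sqrt c) \<inter> euc N)"
      by (intro compact_orthonormal_basis[OF orthonormal_basis_euc]) auto
    then have "compact ((cball 0 (sqrt c) \<inter> euc N) \<inter> \<Sigma>)" by (intro proper) auto
    moreover have "(cball 0 (sqrt c) \<inter> euc N) \<inter> \<Sigma> = K"
      using sub by (auto simp: K_def norm_eq_sqrt_inner)
    ultimately show ?thesis by simp
  qed
  then have K: "closed K" "K \<in> sets borel" by (auto intro: compact_imp_closed borel_closed)
  define \<eta> where "\<eta> = test_field c \<Sigma>"
  have \<eta>0: "\<eta> i q = 0" if "c \<le> inner q q" for i q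
    using that by (simp add: \<eta>_def test_field_def cutoff_beyond)
  have normal: "normal_field N \<Sigma> (\<eta> i)" if i: "i < N" for i
    unfolding normal_field_def smooth_along_def
  proof (intro conjI ballI)
    fix p assume p: "p \<in> \<Sigma>"
    show "\<exists>U g. p \<in> U \<and> smooth_on (euc N) g U \<and> (\<forall>q\<in>U \<inter> \<Sigma>. \<eta> i q = g q)"
    proof (cases "inner p p < R\<^sup>2")
      case True
      then obtain U V \<Phi> \<Psi> where s: "slice N n \<Sigma> U V \<Phi> \<Psi>" "p \<in> U" using chart p by blast
      then interpret slice N n \<Sigma> U V \<Phi> \<Psi> by simp
      have "smooth_on E (\<lambda>q. cutoff c 0 (inner q q) *\<^sub>R (bas i - proj q (bas i))) U"
        by (intro smooth_on_scaleR[OF U E] smooth_on_diff[OF U E] smooth_on_const[OF U E] pf.smooth_P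
            smooth_norm_cutoff[OF c0])
      then show ?thesis
        using s(2) by (intro exI[of _ U] exI conjI) (auto simp: \<eta>_def test_field_def nor_part_eq)
    next
      case False
      \<comment> \<open>There may be no interior chart at such a point, but the field vanishes on
        this neighbourhood because \<open>c < R\<^sup>2\<close>.\<close>
      let ?U = "euc N \<inter> {q. c < inner q q}"
      have U: "openin (top_of_set (euc N)) ?U"
        by (intro openin_open_Int open_Collect_less continuous_intros)
      have "smooth_on (euc N) (\<lambda>q. 0 :: fseq) ?U"
        by (rule smooth_on_const[OF U subspace_euc])
      then show ?thesis
        using False c(3) p sub by (intro exI[of _ ?U] exI[of _ "\<lambda>q. 0"] conjI) (auto simp: \<eta>0)
    qed
    have "\<eta> i p \<in> euc N \<and> (\<forall>w\<in>tangent_space \<Sigma> p. inner (\<eta> i p) w = 0)"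
    proof (cases "inner p p < c")
      case True
      then obtain U V \<Phi> \<Psi> where s: "slice N n \<Sigma> U V \<Phi> \<Psi>" "p \<in> U" using chart p c(3) by fastforce
      then interpret slice N n \<Sigma> U V \<Phi> \<Psi> by simp
      have \<eta>p: "\<eta> i p = cutoff c 0 (inner p p) *\<^sub>R (bas i - proj p (bas i))"
        by (simp add: \<eta>_def test_field_def nor_part_eq[OF s(2) p])
      have "inner (bas i - proj p (bas i)) (proj p w) = 0" for w
        unfolding proj_self_adjoint[symmetric]
        by (simp add: linear_diff[OF linear_proj] proj_idem)
      then show ?thesis
        using tangent_space_range[OF s(2) p] i proj_mem[OF s(2)] E
        by (auto simp: \<eta>p intro!: subspace_scale[OF E] subspace_diff[OF E])
    next
      case False
      then show ?thesis using \<eta>0[of p i] subspace_0[OF subspace_euc[of N]] by simp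
    qed
    then show "\<eta> i p \<in> euc N" "\<And>w. w \<in> tangent_space \<Sigma> p \<Longrightarrow> inner (\<eta> i p) w = 0" by auto
  qed
  have supp: "compactly_supported_in \<Sigma> (\<eta> i) (\<Sigma> - mfd_boundary N n \<Sigma>)" for i
  proof -
    have "{p \<in> \<Sigma>. \<eta> i p \<noteq> 0} \<subseteq> K" using \<eta>0 by (auto simp: K_def not_le intro: less_imp_le) (meson leI less_imp_le)
    then have cl: "closure {p \<in> \<Sigma>. \<eta> i p \<noteq> 0} \<subseteq> K" using K(1) by (rule closure_minimal)
    moreover have "K \<subseteq> \<Sigma> - mfd_boundary N n \<Sigma>"
      using in_ball c(3) bd by (fastforce simp: K_def)
    ultimately show ?thesis
      using \<open>compact K\<close> compact_Int_closed[OF \<open>compact K\<close> closed_closure[of "{p \<in> \<Sigma>. \<eta> i p \<noteq> 0}"]]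
      unfolding compactly_supported_in_def by (simp add: inf_absorb2)
  qed
  define f where "f i q = inner (\<eta> i q) (L_op \<Sigma> (\<eta> i) q) * exp (- (norm q)\<^sup>2 / 4)" for i q
  have int_le: "(\<integral>q. indicator K q *\<^sub>R f i q \<partial>?\<mu>) \<le> 0" if "i < N" for i
  proof -
    have "(LINT q:\<Sigma>|?\<mu>. f i q) \<le> 0"
      using stable normal[OF that] supp unfolding gaussian_stable_def f_def by blast
    moreover have "indicator \<Sigma> q *\<^sub>R f i q = indicator K q *\<^sub>R f i q" for q
      using \<eta>0[of q i] by (auto simp: indicator_def K_def f_def)
    then have "(\<lambda>q. indicator \<Sigma> q *\<^sub>R f i q) = (\<lambda>q. indicator K q *\<^sub>R f i q)" by (rule ext)
    ultimately show ?thesis by (simp only: set_lebesgue_integral_def)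
  qed
  \<comment> \<open>\<open>L_op\<close> refers to bases chosen pointwise; continuity comes from the
    smooth expression \<open>test_integrand\<close>, which equals it along
    \<open>\<Sigma>\<close>.\<close>
  have cont: "continuous_on K (f i)" if i: "i < N" for i
    unfolding continuous_on_eq_continuous_within
  proof
    fix p assume p: "p \<in> K"
    then have p': "p \<in> \<Sigma>" "inner p p < R\<^sup>2" using c(3) by (auto simp: K_def)
    then obtain U V \<Phi> \<Psi> where s: "slice N n \<Sigma> U V \<Phi> \<Psi>" "p \<in> U" using chart by blast
    then interpret slice N n \<Sigma> U V \<Phi> \<Psi> by simp
    let ?F = "\<lambda>q. test_integrand c i q * exp (- (norm q)\<^sup>2 / 4)"
    obtain O' where O: "open O'" "U = E \<inter> O'" using U by (auto simp: openin_open)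
    obtain d where d: "d > 0" "ball p d \<subseteq> O'" using O s(2) open_contains_ball by blast
    have "continuous_on U ?F"
      by (intro continuous_on_mult smooth_on_continuous_on[OF smooth_test_integrand[OF c0]]
          continuous_intros) auto
    then have "continuous (at p within E) ?F"
      using s(2) unfolding at_within_openin[OF U s(2), symmetric] continuous_on_eq_continuous_within
      by blast
    then have "continuous (at p within K) ?F"
      using continuous_within_subset sub KS by blast
    then show "continuous (at p within K) (f i)"
    proof (rule continuous_transform_within[OF _ d(1) p])
      fix q assume q: "q \<in> K" "dist q p < d"
      then have "q \<in> U" "q \<in> \<Sigma>" using d(2) O(2) sub KS by (auto simp: dist_commute)
      then show "?F q = f i q"
        unfolding f_def \<eta>_def using test_field_L_op[OF _ _ shr c0 i] by simp
    qed
  qed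
  have "\<exists>O'. open O' \<and> p \<in> O' \<and> hausdorff_outer n (O' \<inter> \<Sigma>) < top" if "p \<in> K" for p
  proof -
    have "p \<in> \<Sigma>" "inner p p < R\<^sup>2" using that c(3) by (auto simp: K_def)
    then obtain U V \<Phi> \<Psi> where s: "slice N n \<Sigma> U V \<Phi> \<Psi>" "p \<in> U" using chart by blast
    then interpret slice N n \<Sigma> U V \<Phi> \<Psi> by simp
    show ?thesis using locally_finite_area[OF s(2) \<open>p \<in> \<Sigma>\<close>] by blast
  qed
  then have finK: "emeasure ?\<mu> K < top"
    using compact_finite_area[OF \<open>compact K\<close> _ KS] K(2) by (simp add: emeasure_hausdorff_measure)
  have integrable: "integrable ?\<mu> (\<lambda>q. indicator K q *\<^sub>R f i q)" if i: "i < N" for i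
  proof -
    have "(\<lambda>q. indicator K q *\<^sub>R f i q) \<in> borel_measurable ?\<mu>"
      using borel_measurable_continuous_on_indicator[OF K(2) cont[OF i]] by (simp cong: measurable_cong_sets)
    moreover obtain B where "\<And>q. q \<in> K \<Longrightarrow> norm (f i q) \<le> B"
      using compact_imp_bounded[OF compact_continuous_image[OF cont[OF i] \<open>compact K\<close>]] by (auto simp: bounded_iff)
    ultimately show ?thesis
      using K(2) finK by (intro integrableI_bounded_set[of K _ _ B]) auto
  qed
  \<comment> \<open>The positive codimension \<open>N - n\<close> enters here: without normal
    directions the sum would vanish.\<close>
  have pos: "0 < (\<Sum>i<N. f i p)" if p: "p \<in> A" for p
  proof -
    have p': "p \<in> \<Sigma>" "inner p p < c" using p by (auto simp: A_def)
    then obtain U V \<Phi> \<Psi> where s: "slice N n \<Sigma> U V \<Phi> \<Psi>" "p \<in> U" using chart c(3) by fastforce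
    then interpret slice N n \<Sigma> U V \<Phi> \<Psi> by simp
    let ?m = "real (card (tangent_basis \<Sigma> p))"
    have m: "?m \<le> n" using card_tangent_basis_le[OF s(2) p'(1)] by simp
    have "0 \<le> inner p (proj p p)"
      by (metis inner_ge_zero proj_idem proj_self_adjoint)
    then have "0 < cutoff c 0 (inner p p) / 2 + cutoff_laplacian c p"
      unfolding cutoff_laplacian_def
      using m tangent_dim_eq[OF s(2) p'(1) shr] assms c(1) p'(2) by (intro cutoff_second_variation_pos[of _ "real n"]) auto
    moreover have "0 < cutoff c 0 (inner p p)" using p'(2) by (simp add: cutoff_0)
    moreover have "0 < real N - ?m" using m N by linarith
    ultimately have "0 < (\<Sum>i<N. test_integrand c i p)"
      by (subst sum_test_integrand[OF s(2) p'(1) shr c0]) (auto intro!: mult_pos_pos simp: add.commute)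
    then have "0 < (\<Sum>i<N. test_integrand c i p) * exp (- (norm p)\<^sup>2 / 4)" by simp
    also have "\<dots> = (\<Sum>i<N. f i p)"
      unfolding f_def \<eta>_def using test_field_L_op[OF s(2) p'(1) shr c0] by (simp add: sum_distrib_right)
    finally show ?thesis .
  qed
  define G where "G q = (\<Sum>i<N. indicator K q *\<^sub>R f i q)" for q
  have G: "G q = (if q \<in> A then \<Sum>i<N. f i q else 0)" for q
    using AK \<eta>0[of q] by (auto simp: G_def A_def K_def indicator_def f_def)
  have "integrable ?\<mu> G" unfolding G_def using integrable by (intro Bochner_Integration.integrable_sum) auto
  moreover have "AE q in ?\<mu>. 0 \<le> G q" using pos by (auto simp: G intro: less_imp_le)
  \<comment> \<open>Stability bounds each of the \<open>N\<close> integrals by 0, while their sum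
    has a nonnegative integrand; integrability of each \<open>f i\<close> on \<open>K\<close>
    permits exchanging sum and integral.\<close>
  moreover have "(\<integral>q. G q \<partial>?\<mu>) = 0"
  proof -
    have "(\<integral>q. G q \<partial>?\<mu>) = (\<Sum>i<N. \<integral>q. indicator K q *\<^sub>R f i q \<partial>?\<mu>)"
      unfolding G_def using integrable by (intro Bochner_Integration.integral_sum) auto
    also have "\<dots> \<le> 0" using int_le by (intro sum_nonpos) auto
    finally show ?thesis
      using integral_nonneg_AE[OF \<open>AE q in ?\<mu>. 0 \<le> G q\<close>] by simp
  qed
  ultimately have "AE q in ?\<mu>. G q = 0"
    using integral_nonneg_eq_0_iff_AE by blast
  then have "AE q in ?\<mu>. q \<notin> A" using pos by (auto simp: G elim!: eventually_mono split: if_splits) (metis less_irrefl)+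
  moreover have A: "A \<in> sets borel"
  proof -
    have "A = K \<inter> {q. inner q q < c}" by (auto simp: A_def K_def)
    moreover have "open {q :: fseq. inner q q < c}" by (intro open_Collect_less continuous_intros)
    ultimately show ?thesis using K(2) by auto
  qed
  ultimately have "emeasure ?\<mu> A = 0"
    using AE_iff_measurable[of A ?\<mu> "\<lambda>q. q \<notin> A"] by auto
  then have null: "hausdorff_outer n A = 0" using A by (simp add: emeasure_hausdorff_measure)
  \<comment> \<open>\<open>A\<close> would have to be a null set, but it is a relatively open
    neighbourhood of the interior point \<open>p0\<close> in \<open>\<Sigma>\<close>.\<close>
  obtain U V \<Phi> \<Psi> where s: "slice N n \<Sigma> U V \<Phi> \<Psi>" "p0 \<in> U" using chart p0 by blast
  then interpret slice N n \<Sigma> U V \<Phi> \<Psi> by simp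
  have "open {q :: fseq. inner q q < c}" by (intro open_Collect_less continuous_intros)
  then have "0 < hausdorff_outer n ({q. inner q q < c} \<inter> \<Sigma>)"
    using c(2) by (intro locally_positive_area[OF s(2) p0(1)]) auto
  moreover have "{q. inner q q < c} \<inter> \<Sigma> = A" by (auto simp: A_def)
  ultimately show False using null by simp
qed

end
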